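(* Let $\mathbb{K}$ be an algebraically closed field of characteristic zero and let $X \subset \mathbb{P}^4$ be an irreducible cubic hypersurface over $\mathbb{K}$. Assume that $X$ is not a cone. Then $X$ is developable if and only if $X$ is projectively equivalent to a linear section of the secant variety of the Veronese surface, i.e. to $H\cap S(\mathcal V)\subset H\simeq \mathbb{P}^4$ for some hyperplane $H\subset \mathbb{P}^5$, where $\mathcal V\subset \mathbb{P}^5$ is the Veronese surface and $S(\mathcal V)$ is its secant variety.
   Context: For an irreducible projective variety $X\subset \mathbb{P}^N$ of dimension $n\ge 1$, the Gauss map $\gamma: X\dashrightarrow \mathbb{G}(n,N)$ sends a regular point $x\in X$ to its embedded tangent space $T_xX$, where $\mathbb{G}(n,N)$ is the Grassmannian of $n$-planes in $\mathbb{P}^N$. Let $X^\vee$ be the closure of the image of $\gamma$. $X$ is developable if $\dim X^\vee<n$. For projective subvarieties $V,W\subset\mathbb{P}^N$, the join $S(V,W)$ is the closure of the union of the lines joining $V$ to $W$, and $S(V)=S(V,V)$ is the secant variety of $V$. $V$ is a cone if there exists $x\in V$ with $S(x,V)=V$. The Veronese surface $\mathcal V\subset\mathbb{P}^5=\mathbb{P}(\mathrm{Sym}_2\mathbb{K}^3)$ is the image of $\mathbb{P}^2\to\mathbb{P}^5$, $(a:b:c)\mapsto(a^2:b^2:c^2:ab:ac:bc)$. Identifying $\mathbb{P}^5$ with the projectivization of the space of symmetric $3\times 3$ matrices, $\mathcal V$ is the locus of rank one matrices and $S(\mathcal V)$ is the cubic hypersurface of singular matrices. *)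

theory Defs
  imports
    "HOL-Analysis.Analysis"
    "HOL-Library.Poly_Mapping"
    "HOL-Library.Extended_Nat"
    "HOL-Combinatorics.Permutations"
    "HOL-Computational_Algebra.Polynomial"
begin

section \<open>Polynomials in indeterminates indexed by an arbitrary type\<close>

type_synonym ('i, 'a) mpoly = "('i \<Rightarrow>\<^sub>0 nat) \<Rightarrow>\<^sub>0 'a"

definition mp_eval :: "('i, 'a::field) mpoly \<Rightarrow> ('i \<Rightarrow> 'a) \<Rightarrow> 'a" where
  "mp_eval p x =
     (\<Sum>m \<in> Poly_Mapping.keys p.
        Poly_Mapping.lookup p m * (\<Prod>i \<in> Poly_Mapping.keys m. x i ^ Poly_Mapping.lookup m i))"

definition mp_vars :: "('i, 'a::field) mpoly \<Rightarrow> 'i set" where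
  "mp_vars p = (\<Union>m \<in> Poly_Mapping.keys p. Poly_Mapping.keys m)"

definition homogeneous :: "nat \<Rightarrow> ('i, 'a::field) mpoly \<Rightarrow> bool" where
  "homogeneous d p \<longleftrightarrow>
     (\<forall>m \<in> Poly_Mapping.keys p. (\<Sum>i \<in> Poly_Mapping.keys m. Poly_Mapping.lookup m i) = d)"

text \<open>The truncated subtraction of exponents is harmless: the coefficient is zero for monomials
  that do not contain the indeterminate \<open>i\<close>.\<close>

definition mp_pderiv :: "'i \<Rightarrow> ('i, 'a::field) mpoly \<Rightarrow> ('i, 'a) mpoly" where
  "mp_pderiv i p =
     (\<Sum>m \<in> Poly_Mapping.keys p.
        Poly_Mapping.single (m - Poly_Mapping.single i 1)
          (of_nat (Poly_Mapping.lookup m i) * Poly_Mapping.lookup p m))"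


section \<open>Projective spaces and Grassmannians\<close>

text \<open>An \<open>n\<close>-plane of the projective space of lines in \<open>'a ^ 'n\<close> is a linear subspace of \<open>'a ^ 'n\<close>
  of vector space dimension \<open>n + 1\<close>. Points are the case \<open>n = 0\<close>, so that a subset of the
  projective space is a set of one-dimensional subspaces, and a point \<open>L\<close> lies on a plane \<open>H\<close>
  iff \<open>L \<subseteq> H\<close>.\<close>

definition Gr :: "nat \<Rightarrow> ('a::field ^ 'n::finite) set set" where
  "Gr n = {L. vec.subspace L \<and> vec.dim L = n + 1}"

abbreviation proj_space :: "('a::field ^ 'n::finite) set set" where
  "proj_space \<equiv> Gr 0"

text \<open>The homogeneous coordinate vectors of a point, and the Pluecker coordinate vectors of a
  plane \<open>L\<close>: the maximal minors of a basis of \<open>L\<close>, indexed by all lists of column indices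
  (repetitions and all orderings allowed), with junk value \<open>0\<close> for lists of the wrong length.\<close>

definition point_coords :: "('a::field ^ 'n::finite) set \<Rightarrow> ('n \<Rightarrow> 'a) set" where
  "point_coords L = {vec_nth v | v. v \<in> L \<and> v \<noteq> 0}"

definition minor :: "('a::field ^ 'n::finite) list \<Rightarrow> 'n list \<Rightarrow> 'a" where
  "minor vs I =
     (if length I = length vs
      then \<Sum>\<pi> | \<pi> permutes {..<length vs}.
             of_int (sign \<pi>) * (\<Prod>j<length vs. (vs ! j) $ (I ! \<pi> j))
      else 0)"

definition pluecker_coords :: "('a::field ^ 'n::finite) set \<Rightarrow> ('n list \<Rightarrow> 'a) set" where
  "pluecker_coords L = {minor vs | vs. vec.span (set vs) = L \<and> length vs = vec.dim L}"


section \<open>Zariski topology and dimension\<close>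

text \<open>The notions below are shared by projective spaces and Grassmannians. The parameter \<open>co\<close>
  maps a point to the set of its homogeneous coordinate vectors; it is \<open>point_coords\<close> for a
  projective space and \<open>pluecker_coords\<close> for a Grassmannian.\<close>

definition vanishes_on ::
    "('p \<Rightarrow> ('i \<Rightarrow> 'a::field) set) \<Rightarrow> ('i, 'a) mpoly \<Rightarrow> 'p set \<Rightarrow> bool" where
  "vanishes_on co F Z \<longleftrightarrow> (\<forall>z \<in> Z. \<forall>x \<in> co z. mp_eval F x = 0)"

definition zero_locus ::
    "('p \<Rightarrow> ('i \<Rightarrow> 'a::field) set) \<Rightarrow> 'p set \<Rightarrow> ('i, 'a) mpoly set \<Rightarrow> 'p set" where
  "zero_locus co U S = {u \<in> U. \<forall>F \<in> S. vanishes_on co F {u}}"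

text \<open>The homogeneous elements of the ideal of \<open>Z\<close>.\<close>

definition forms_vanishing_on ::
    "('p \<Rightarrow> ('i \<Rightarrow> 'a::field) set) \<Rightarrow> 'p set \<Rightarrow> ('i, 'a) mpoly set" where
  "forms_vanishing_on co Z = {F. (\<exists>d. homogeneous d F) \<and> vanishes_on co F Z}"

definition zariski_closure ::
    "('p \<Rightarrow> ('i \<Rightarrow> 'a::field) set) \<Rightarrow> 'p set \<Rightarrow> 'p set \<Rightarrow> 'p set" where
  "zariski_closure co U Z = zero_locus co U (forms_vanishing_on co Z)"

text \<open>The dimension of a variety is the transcendence degree of its field of rational functions.
  Finitely many rational functions can be written as \<open>f 0 / g, \<dots>, f (r - 1) / g\<close> with forms
  \<open>f i\<close>, \<open>g\<close> of the same degree, where \<open>g\<close> is not identically zero on \<open>Z\<close>; a polynomial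
  expression in them is zero as a rational function iff it vanishes wherever \<open>g\<close> does not.\<close>

definition alg_indep_rational ::
    "('p \<Rightarrow> ('i \<Rightarrow> 'a::field) set) \<Rightarrow> 'p set \<Rightarrow> nat \<Rightarrow>
     (nat \<Rightarrow> ('i, 'a) mpoly) \<Rightarrow> ('i, 'a) mpoly \<Rightarrow> bool" where
  "alg_indep_rational co Z r f g \<longleftrightarrow>
     (\<forall>Q :: (nat, 'a) mpoly.
        mp_vars Q \<subseteq> {..<r} \<longrightarrow>
        (\<forall>z \<in> Z. \<forall>x \<in> co z. mp_eval g x \<noteq> 0 \<longrightarrow>
           mp_eval Q (\<lambda>i. mp_eval (f i) x / mp_eval g x) = 0) \<longrightarrow>
        Q = 0)"

definition variety_dim :: "('p \<Rightarrow> ('i \<Rightarrow> 'a::field) set) \<Rightarrow> 'p set \<Rightarrow> enat" where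
  "variety_dim co Z =
     Sup {enat r | r.
       \<exists>d f g. homogeneous d g \<and> \<not> vanishes_on co g Z \<and>
         (\<forall>i<r. homogeneous d (f i)) \<and> alg_indep_rational co Z r f g}"


section \<open>Hypersurfaces, Gauss map, developable varieties\<close>

definition irreducible_hypersurface :: "nat \<Rightarrow> ('a::field ^ 'n::finite) set set \<Rightarrow> bool" where
  "irreducible_hypersurface d X \<longleftrightarrow>
     (\<exists>F :: ('n, 'a) mpoly. homogeneous d F \<and> irreducible F \<and>
        X = zero_locus point_coords proj_space {F})"

definition embedded_tangent_space ::
    "('a::field ^ 'n::finite) set set \<Rightarrow> ('a ^ 'n) set \<Rightarrow> ('a ^ 'n) set" where
  "embedded_tangent_space X p =
     {v. \<forall>F \<in> forms_vanishing_on point_coords X. \<forall>x \<in> point_coords p.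
           (\<Sum>i \<in> UNIV. mp_eval (mp_pderiv i F) x * v $ i) = 0}"

text \<open>For \<open>X\<close> of dimension \<open>n\<close>; a point is regular iff its embedded tangent space has (projective)
  dimension \<open>n\<close>.\<close>

definition gauss_image ::
    "nat \<Rightarrow> ('a::field ^ 'n::finite) set set \<Rightarrow> ('a ^ 'n) set set" where
  "gauss_image n X = {embedded_tangent_space X p | p. p \<in> X \<and> embedded_tangent_space X p \<in> Gr n}"

definition dual_variety ::
    "nat \<Rightarrow> ('a::field ^ 'n::finite) set set \<Rightarrow> ('a ^ 'n) set set" where
  "dual_variety n X = zariski_closure pluecker_coords (Gr n) (gauss_image n X)"

definition developable :: "('a::field ^ 'n::finite) set set \<Rightarrow> bool" where
  "developable X \<longleftrightarrow>
     (\<exists>n. variety_dim point_coords X = enat n \<and>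
          variety_dim pluecker_coords (dual_variety n X) < enat n)"


section \<open>Joins, cones, the Veronese surface\<close>

text \<open>For \<open>p = q\<close> the subspace \<open>vec.span (p \<union> q)\<close> is the point \<open>p\<close> itself, so that the join of a
  point with itself is that point.\<close>

definition join ::
    "('a::field ^ 'n::finite) set set \<Rightarrow> ('a ^ 'n) set set \<Rightarrow> ('a ^ 'n) set set" where
  "join V W = zariski_closure point_coords proj_space
     {r \<in> proj_space. \<exists>p \<in> V. \<exists>q \<in> W. r \<subseteq> vec.span (p \<union> q)}"

definition secant_variety :: "('a::field ^ 'n::finite) set set \<Rightarrow> ('a ^ 'n) set set" where
  "secant_variety V = join V V"

definition is_cone :: "('a::field ^ 'n::finite) set set \<Rightarrow> bool" where
  "is_cone V \<longleftrightarrow> (\<exists>p \<in> V. join {p} V = V)"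

definition veronese_surface :: "('a::field ^ 6) set set" where
  "veronese_surface =
     {vec.span {vector [a\<^sup>2, b\<^sup>2, c\<^sup>2, a * b, a * c, b * c]} | a b c. (a, b, c) \<noteq> (0, 0, 0)}"


section \<open>Projective equivalence with a hyperplane section\<close>

text \<open>\<open>Y\<close> is a subset of the projective space of all lines in \<open>H\<close>, and \<open>X\<close> corresponds to it under
  some projective isomorphism onto that space.\<close>

definition projectively_equivalent_in ::
    "('a::field ^ 'm::finite) set set \<Rightarrow> ('a ^ 'n::finite) set \<Rightarrow> ('a ^ 'n) set set \<Rightarrow> bool" where
  "projectively_equivalent_in X H Y \<longleftrightarrow>
     (\<exists>f. Vector_Spaces.linear (*s) (*s) f \<and> bij_betw f UNIV H \<and> (\<lambda>L. f ` L) ` X = Y)"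

end

(* Let F be the cubic form of X and let T be its polarization. The Gauss map of X is given by the
   gradient x |-> T x x _.

   If the dual variety has dimension less than 3, then the components of the gradient are
   algebraically dependent on X, and differentiating a relation along the tangent directions of X
   shows that the Hessian determinant D vanishes on X. Suppose first that D is not identically zero,
   so that D = F * S. At a general point x of X the first order expansion of D shows that the kernel
   vector v of the Hessian satisfies T v v _ = c T x x _, so that the line through x and v meets X in
   two singular points. In a frame adapted to these two points, the degeneracy of the Hessian on X
   forces F to be the determinant of a symmetric 3 x 3 matrix of linear forms. If D = 0, an argument
   of Gordan and Noether shows that general kernel vectors are singular points of X, and they lead to
   a plane along which X is singular; then F lies in the square of the ideal of this plane, and is
   again such a determinant. Since X is not a cone, the linear map from 5-space to symmetric matrices
   is injective, and F = 0 is the pull-back of the singular matrices, that is of sums u u^T + v v^T.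

   Conversely, the adjugate of a singular symmetric 3 x 3 matrix is w w^T for some w, hence the
   gradient of a determinantal F is, on X, given by quadratic forms in the three coordinates of w.
   There are too few monomials in w for three algebraically independent functions on the image. *)
theory Submission
  imports Defs
begin

section \<open>Polynomials and their evaluation\<close>

text \<open>Tangent spaces, Hessian and gradient relations all need the same fact: a polynomial
  function vanishing on the hypersurface is a multiple of F. A point p with \<open>F p = 1\<close>
  makes F a monic cubic along p; the remainder of a division by it has degree at most two, but three
  zeros on a general line. General lines carry three distinct zeros because an identically vanishing
  discriminant would split off a linear factor, and irreducibility enters only in this form. As
  vanishing at general points suffices, a nonzero Hessian determinant D cannot have S vanish on X:
  F^2 has degree 6 and D degree 5. In the frame of two singular points, F = 0 becomes
  \<open>(r + T Q w w) * (s + T P w w) = h w\<close> with w in a plane. The Hessian is singular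
  along each of these hyperbolas; this forces both quadratic forms to have rank one and h to be a
  perfect square. Dimensions are transcendence degrees. Upper bounds compare the N^r monomials in r
  functions with spaces of forms on the variety whose dimension grows with an exponent below r.
  Lower bounds exhibit functions: with arbitrary values on X, with independent differentials on the
  dual variety.\<close>

definition mon_eval :: "('i \<Rightarrow>\<^sub>0 nat) \<Rightarrow> ('i \<Rightarrow> 'a::comm_semiring_1) \<Rightarrow> 'a" where
  "mon_eval m x = (\<Prod>i \<in> Poly_Mapping.keys m. x i ^ Poly_Mapping.lookup m i)"

definition mon_deg :: "('i \<Rightarrow>\<^sub>0 nat) \<Rightarrow> nat" where
  "mon_deg m = (\<Sum>i \<in> Poly_Mapping.keys m. Poly_Mapping.lookup m i)"

lemma mon_eval_superset:
  assumes "finite I" "Poly_Mapping.keys m \<subseteq> I"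
  shows "mon_eval m x = (\<Prod>i\<in>I. x i ^ Poly_Mapping.lookup m i)"
  unfolding mon_eval_def using assms
  by (intro prod.mono_neutral_left) (auto simp: in_keys_iff)

lemma mon_deg_superset:
  assumes "finite I" "Poly_Mapping.keys m \<subseteq> I"
  shows "mon_deg m = (\<Sum>i\<in>I. Poly_Mapping.lookup m i)"
  unfolding mon_deg_def using assms
  by (intro sum.mono_neutral_left) (auto simp: in_keys_iff)

lemma keys_add_nat: "Poly_Mapping.keys (m + m' :: 'i \<Rightarrow>\<^sub>0 nat) = Poly_Mapping.keys m \<union> Poly_Mapping.keys m'"
  by (auto simp: in_keys_iff lookup_add)

lemma mon_eval_0 [simp]: "mon_eval 0 x = 1"
  by (simp add: mon_eval_def)

lemma mon_deg_0 [simp]: "mon_deg 0 = 0"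
  by (simp add: mon_deg_def)

lemma mon_eval_single [simp]: "mon_eval (Poly_Mapping.single i n) x = x i ^ n"
  by (cases "n = 0") (auto simp: mon_eval_def)

lemma mon_deg_single [simp]: "mon_deg (Poly_Mapping.single i n) = n"
  by (cases "n = 0") (auto simp: mon_deg_def)

lemma mon_eval_add: "mon_eval (m + m') x = mon_eval m x * mon_eval m' x"
proof -
  let ?I = "Poly_Mapping.keys m \<union> Poly_Mapping.keys m'"
  have "mon_eval k x = (\<Prod>i\<in>?I. x i ^ Poly_Mapping.lookup k i)" if "k \<in> {m, m', m + m'}" for k
    using that by (intro mon_eval_superset) (auto simp: keys_add_nat)
  then show ?thesis
    by (simp add: lookup_add power_add prod.distrib)
qed

lemma mon_deg_add: "mon_deg (m + m') = mon_deg m + mon_deg m'"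
proof -
  let ?I = "Poly_Mapping.keys m \<union> Poly_Mapping.keys m'"
  have "mon_deg k = (\<Sum>i\<in>?I. Poly_Mapping.lookup k i)" if "k \<in> {m, m', m + m'}" for k
    using that by (intro mon_deg_superset) (auto simp: keys_add_nat)
  then show ?thesis
    by (simp add: lookup_add sum.distrib)
qed

lemma mon_eval_sum: "finite I \<Longrightarrow> mon_eval (\<Sum>i\<in>I. f i) x = (\<Prod>i\<in>I. mon_eval (f i) x)"
  by (induction I rule: finite_induct) (auto simp: mon_eval_add)

lemma mon_deg_0_iff: "mon_deg m = 0 \<longleftrightarrow> m = 0"
proof -
  have "mon_deg m \<noteq> 0" if "m \<noteq> 0"
  proof -
    from that have "Poly_Mapping.keys m \<noteq> {}" by simp
    then obtain i where "i \<in> Poly_Mapping.keys m" by blast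
    then show ?thesis by (auto simp: mon_deg_def in_keys_iff intro!: bexI[of _ i])
  qed
  then show ?thesis by (metis mon_deg_0)
qed

lemma mon_remove:
  assumes "Poly_Mapping.lookup m i \<noteq> (0::nat)"
  shows "m = (m - Poly_Mapping.single i 1) + Poly_Mapping.single i 1"
  using assms by (intro poly_mapping_eqI) (auto simp: lookup_add lookup_minus lookup_single when_def)

lemma mon_deg_SucE:
  assumes "mon_deg m = Suc n"
  obtains i m' where "m = Poly_Mapping.single i 1 + m'" "mon_deg m' = n"
proof -
  have "Poly_Mapping.keys m \<noteq> {}"
    using assms by (auto simp: mon_deg_def)
  then obtain i where "Poly_Mapping.lookup m i \<noteq> 0"
    by (metis all_not_in_conv in_keys_iff)
  from mon_remove[OF this] have "m = Poly_Mapping.single i 1 + (m - Poly_Mapping.single i 1)"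
    by (metis add.commute)
  moreover from this have "mon_deg m = 1 + mon_deg (m - Poly_Mapping.single i 1)"
    by (metis mon_deg_add mon_deg_single)
  ultimately show ?thesis using that assms by auto
qed

lemma mp_eval_superset:
  assumes "finite K" "Poly_Mapping.keys p \<subseteq> K"
  shows "mp_eval p x = (\<Sum>m\<in>K. Poly_Mapping.lookup p m * mon_eval m x)"
  unfolding mp_eval_def mon_eval_def using assms
  by (intro sum.mono_neutral_left) (auto simp: in_keys_iff)

lemma mp_eval_keys:
  "mp_eval p x = (\<Sum>m\<in>Poly_Mapping.keys p. Poly_Mapping.lookup p m * mon_eval m x)"
  by (simp add: mp_eval_def mon_eval_def)

lemma mp_eval_0 [simp]: "mp_eval 0 x = 0"
  by (simp add: mp_eval_def)

lemma mp_eval_single [simp]: "mp_eval (Poly_Mapping.single m c) x = c * mon_eval m x"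
  by (cases "c = 0") (auto simp: mp_eval_keys)

lemma mp_eval_1 [simp]: "mp_eval 1 x = 1"
  using mp_eval_single[of 0 1 x] by (simp del: mp_eval_single)

lemma mp_eval_add [simp]: "mp_eval (p + q) x = mp_eval p x + mp_eval q x"
proof -
  let ?K = "Poly_Mapping.keys p \<union> Poly_Mapping.keys q"
  have "mp_eval r x = (\<Sum>m\<in>?K. Poly_Mapping.lookup r m * mon_eval m x)" if "r \<in> {p, q, p + q}" for r
    using that keys_add[of p q] by (intro mp_eval_superset) auto
  then show ?thesis
    by (simp add: lookup_add ring_distribs sum.distrib)
qed

lemma mp_eval_sum [simp]: "mp_eval (\<Sum>i\<in>I. f i) x = (\<Sum>i\<in>I. mp_eval (f i) x)"
  by (induction I rule: infinite_finite_induct) auto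

lemma mp_decomp: "p = (\<Sum>m\<in>Poly_Mapping.keys p. Poly_Mapping.single m (Poly_Mapping.lookup p m))"
  by (intro poly_mapping_eqI) (auto simp: lookup_sum lookup_single when_def in_keys_iff)

lemma mp_eval_mult [simp]: "mp_eval (p * q) x = mp_eval p x * mp_eval q x"
proof -
  have "p * q = (\<Sum>m\<in>Poly_Mapping.keys p. \<Sum>m'\<in>Poly_Mapping.keys q.
      Poly_Mapping.single (m + m') (Poly_Mapping.lookup p m * Poly_Mapping.lookup q m'))"
    using arg_cong2[OF mp_decomp[of p] mp_decomp[of q], of "(*)"]
    by (simp add: sum_product mult_single)
  then show ?thesis
    by (simp add: mon_eval_add mp_eval_keys[of p] mp_eval_keys[of q] sum_product mult_ac)
qed

lemma mp_eval_power [simp]: "mp_eval (p ^ n) x = mp_eval p x ^ n"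
  by (induction n) auto

lemma mp_eval_prod [simp]: "mp_eval (\<Prod>i\<in>I. f i) x = (\<Prod>i\<in>I. mp_eval (f i) x)"
  by (induction I rule: infinite_finite_induct) auto

lemma mp_eval_uminus [simp]: "mp_eval (- p) x = - mp_eval p x"
  using mp_eval_add[of p "- p" x] by (simp add: add_eq_0_iff)

lemma mp_eval_diff [simp]: "mp_eval (p - q) x = mp_eval p x - mp_eval q x"
  using mp_eval_add[of p "- q" x] by simp

lemma mp_eval_cong:
  assumes "\<And>i. i \<in> mp_vars p \<Longrightarrow> x i = y i"
  shows "mp_eval p x = mp_eval p y"
  unfolding mp_eval_def using assms
  by (intro sum.cong arg_cong2[of _ _ _ _ "(*)"] prod.cong refl) (metis UN_I mp_vars_def)

lemma homogeneous_alt: "homogeneous d p \<longleftrightarrow> (\<forall>m\<in>Poly_Mapping.keys p. mon_deg m = d)"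
  by (simp add: homogeneous_def mon_deg_def)

lemma homogeneous_0 [simp]: "homogeneous d 0"
  by (simp add: homogeneous_def)

lemma homogeneous_single: "mon_deg m = d \<Longrightarrow> homogeneous d (Poly_Mapping.single m c)"
  by (auto simp: homogeneous_alt)

lemma homogeneous_add: "homogeneous d p \<Longrightarrow> homogeneous d q \<Longrightarrow> homogeneous d (p + q)"
  using keys_add[of p q] by (auto simp: homogeneous_alt)

lemma homogeneous_sum: "(\<And>i. i \<in> I \<Longrightarrow> homogeneous d (f i)) \<Longrightarrow> homogeneous d (\<Sum>i\<in>I. f i)"
  by (induction I rule: infinite_finite_induct) (auto intro: homogeneous_add)

lemma homogeneous_mult: "homogeneous d p \<Longrightarrow> homogeneous e q \<Longrightarrow> homogeneous (d + e) (p * q)"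
  using keys_mult[of p q] by (fastforce simp: homogeneous_alt mon_deg_add)

lemma homogeneous_1: "homogeneous 0 1"
  using homogeneous_single[of 0 0 1] by simp

lemma homogeneous_power: "homogeneous d p \<Longrightarrow> homogeneous (d * n) (p ^ n)"
  by (induction n) (auto intro: homogeneous_1 homogeneous_mult)

lemma homogeneous_prod:
  "finite I \<Longrightarrow> (\<And>i. i \<in> I \<Longrightarrow> homogeneous (d i) (f i)) \<Longrightarrow> homogeneous (\<Sum>i\<in>I. d i) (\<Prod>i\<in>I. f i)"
  by (induction I rule: finite_induct) (auto intro: homogeneous_1 homogeneous_mult)

definition mvar :: "'i \<Rightarrow> ('i, 'a::field) mpoly" where
  "mvar i = Poly_Mapping.single (Poly_Mapping.single i 1) 1"

definition mconst :: "'a::field \<Rightarrow> ('i, 'a) mpoly" where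
  "mconst c = Poly_Mapping.single 0 c"

lemma mp_eval_mvar [simp]: "mp_eval (mvar i) x = x i"
  by (simp add: mvar_def)

lemma mp_eval_mconst [simp]: "mp_eval (mconst c) x = c"
  by (simp add: mconst_def)

lemma homogeneous_mvar: "homogeneous 1 (mvar i)"
  by (simp add: mvar_def homogeneous_single)

lemma homogeneous_mconst: "homogeneous 0 (mconst c)"
  by (simp add: mconst_def homogeneous_single)

lemma homogeneous_mconst_mult: "homogeneous d p \<Longrightarrow> homogeneous d (mconst c * p)"
  using homogeneous_mult[OF homogeneous_mconst] by fastforce


subsection \<open>Partial derivatives\<close>

lemma lookup_mp_pderiv:
  "Poly_Mapping.lookup (mp_pderiv i p) m =
     of_nat (Suc (Poly_Mapping.lookup m i)) * Poly_Mapping.lookup p (m + Poly_Mapping.single i 1)"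
proof -
  let ?e = "Poly_Mapping.single i (1::nat)"
  have eq: "Poly_Mapping.lookup (Poly_Mapping.single (k - ?e)
          (of_nat (Poly_Mapping.lookup k i) * Poly_Mapping.lookup p k)) m =
      (if k = m + ?e then of_nat (Suc (Poly_Mapping.lookup m i)) * Poly_Mapping.lookup p k else 0)" for k
  proof (cases "Poly_Mapping.lookup k i = 0")
    case True
    then have "k \<noteq> m + ?e" by (auto simp: lookup_add)
    with True show ?thesis by simp
  next
    case False
    from mon_remove[OF this] have "k = m + ?e \<longleftrightarrow> k - ?e = m"
      by (metis add_right_cancel)
    moreover from False have "k = m + ?e \<Longrightarrow> Poly_Mapping.lookup k i = Suc (Poly_Mapping.lookup m i)"
      by (simp add: lookup_add)
    ultimately show ?thesis
      by (cases "k = m + ?e") (simp_all add: lookup_single when_def)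
  qed
  show ?thesis
    unfolding mp_pderiv_def lookup_sum eq by (auto simp: in_keys_iff)
qed

lemma mp_vars_pderiv: "mp_vars (mp_pderiv i p) \<subseteq> mp_vars p"
proof -
  have "Poly_Mapping.keys m \<subseteq> mp_vars p" if "m \<in> Poly_Mapping.keys (mp_pderiv i p)" for m
  proof -
    from that have "m + Poly_Mapping.single i 1 \<in> Poly_Mapping.keys p"
      by (auto simp: in_keys_iff lookup_mp_pderiv)
    then show ?thesis by (metis UN_upper keys_add_nat le_sup_iff mp_vars_def)
  qed
  then show ?thesis by (auto simp: mp_vars_def)
qed

text \<open>The chain rule along a polynomial curve. It returns a univariate polynomial, so that
  derivatives are read off by comparing coefficients in \<open>t\<close>.\<close>

lemma mp_eval_curve:
  fixes \<zeta> :: "'i \<Rightarrow> 'a::field poly"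
  assumes "finite I" "mp_vars Q \<subseteq> I"
  obtains R where "\<And>t. poly R t = mp_eval Q (\<lambda>i. poly (\<zeta> i) t)"
    "\<And>t. poly (pderiv R) t =
       (\<Sum>i\<in>I. mp_eval (mp_pderiv i Q) (\<lambda>i. poly (\<zeta> i) t) * poly (pderiv (\<zeta> i)) t)"
proof -
  define R where "R = (\<Sum>m\<in>Poly_Mapping.keys Q. smult (Poly_Mapping.lookup Q m)
    (\<Prod>i\<in>I. \<zeta> i ^ Poly_Mapping.lookup m i))"
  have sub: "Poly_Mapping.keys m \<subseteq> I" if "m \<in> Poly_Mapping.keys Q" for m
    using assms(2) that by (auto simp: mp_vars_def)
  have 1: "poly R t = mp_eval Q (\<lambda>i. poly (\<zeta> i) t)" for t
    unfolding R_def mp_eval_keys poly_sum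
    by (intro sum.cong refl) (simp add: poly_prod mon_eval_superset[OF assms(1) sub])
  have mon: "poly (pderiv (\<Prod>i\<in>I. \<zeta> i ^ Poly_Mapping.lookup m i)) t =
      (\<Sum>i\<in>I. of_nat (Poly_Mapping.lookup m i) * mon_eval (m - Poly_Mapping.single i 1) (\<lambda>i. poly (\<zeta> i) t)
           * poly (pderiv (\<zeta> i)) t)"
    if m: "m \<in> Poly_Mapping.keys Q" for m t
    unfolding pderiv_prod poly_sum
  proof (intro sum.cong refl)
    fix i assume i: "i \<in> I"
    have "Poly_Mapping.keys (m - Poly_Mapping.single i 1) \<subseteq> I"
      using sub[OF m] by (auto simp: in_keys_iff lookup_minus)
    then have "mon_eval (m - Poly_Mapping.single i 1) (\<lambda>i. poly (\<zeta> i) t) =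
       (\<Prod>j\<in>I. poly (\<zeta> j) t ^ Poly_Mapping.lookup (m - Poly_Mapping.single i 1) j)"
      by (rule mon_eval_superset[OF assms(1)])
    also have "\<dots> = poly (\<zeta> i) t ^ (Poly_Mapping.lookup m i - 1) *
        (\<Prod>j\<in>I - {i}. poly (\<zeta> j) t ^ Poly_Mapping.lookup m j)"
      unfolding prod.remove[OF assms(1) i]
      by (intro arg_cong2[of _ _ _ _ "(*)"] prod.cong refl) (auto simp: lookup_minus lookup_single when_def)
    finally show "poly ((\<Prod>j\<in>I - {i}. \<zeta> j ^ Poly_Mapping.lookup m j) * pderiv (\<zeta> i ^ Poly_Mapping.lookup m i)) t =
      of_nat (Poly_Mapping.lookup m i) * mon_eval (m - Poly_Mapping.single i 1) (\<lambda>i. poly (\<zeta> i) t) *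
      poly (pderiv (\<zeta> i)) t"
      by (simp add: pderiv_power poly_prod)
  qed
  have 2: "poly (pderiv R) t =
       (\<Sum>i\<in>I. mp_eval (mp_pderiv i Q) (\<lambda>i. poly (\<zeta> i) t) * poly (pderiv (\<zeta> i)) t)" for t
  proof -
    have "poly (pderiv R) t = (\<Sum>m\<in>Poly_Mapping.keys Q. \<Sum>i\<in>I. Poly_Mapping.lookup Q m *
      (of_nat (Poly_Mapping.lookup m i) * mon_eval (m - Poly_Mapping.single i 1) (\<lambda>i. poly (\<zeta> i) t)
           * poly (pderiv (\<zeta> i)) t))"
      by (simp add: R_def higher_pderiv_sum[where n = 1, simplified] pderiv_smult poly_sum mon sum_distrib_left)
    also have "\<dots> = (\<Sum>i\<in>I. mp_eval (mp_pderiv i Q) (\<lambda>i. poly (\<zeta> i) t) * poly (pderiv (\<zeta> i)) t)"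
      by (subst sum.swap) (simp add: mp_pderiv_def sum_distrib_left mult_ac)
    finally show ?thesis .
  qed
  show ?thesis using that 1 2 by blast
qed

text \<open>A nonzero polynomial of minimal degree vanishing on \<open>U\<close> would have zero
  partial derivatives by \<open>step\<close>, hence be constant in characteristic zero, and a
  nonzero constant does not vanish at the point of \<open>U\<close>. One use takes the whole space
  for \<open>U\<close>, the other the gradients at general points of the hypersurface.\<close>

lemma mp_zero_by_derivatives:
  fixes Q :: "('i, 'a::field_char_0) mpoly"
  assumes ne: "y \<in> U"
    and step: "\<And>Q i. mp_vars Q \<subseteq> I \<Longrightarrow> i \<in> I \<Longrightarrow> (\<And>y. y \<in> U \<Longrightarrow> mp_eval Q y = 0) \<Longrightarrow>
      (\<And>y. y \<in> U \<Longrightarrow> mp_eval (mp_pderiv i Q) y = 0)"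
    and "mp_vars Q \<subseteq> I" "\<And>y. y \<in> U \<Longrightarrow> mp_eval Q y = 0"
  shows "Q = 0"
proof -
  have *: "\<And>Q. (\<And>m. m \<in> Poly_Mapping.keys Q \<Longrightarrow> mon_deg m \<le> d) \<Longrightarrow> mp_vars Q \<subseteq> I \<Longrightarrow>
     (\<And>y. y \<in> U \<Longrightarrow> mp_eval Q y = 0) \<Longrightarrow> Q = 0" for d
  proof (induction d)
    case (0 Q)
    have "Poly_Mapping.keys Q \<subseteq> {0}" 
    proof
      fix m assume "m \<in> Poly_Mapping.keys Q"
      from 0(1)[OF this] show "m \<in> {0}" by (simp add: mon_deg_0_iff)
    qed
    then have "mp_eval Q y = Poly_Mapping.lookup Q 0" by (subst mp_eval_superset) auto
    then have "Poly_Mapping.lookup Q 0 = 0" using 0(3)[OF ne] by simp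
    with \<open>Poly_Mapping.keys Q \<subseteq> {0}\<close> show ?case
      by (intro poly_mapping_eqI) (auto simp: in_keys_iff)
  next
    case (Suc d Q)
    have pd: "mp_pderiv i Q = 0" if "i \<in> I" for i
    proof (rule Suc.IH)
      fix m assume "m \<in> Poly_Mapping.keys (mp_pderiv i Q)"
      then have "m + Poly_Mapping.single i 1 \<in> Poly_Mapping.keys Q"
        by (auto simp: in_keys_iff lookup_mp_pderiv)
      from Suc.prems(1)[OF this] show "mon_deg m \<le> d" by (simp add: mon_deg_add)
    next
      show "mp_vars (mp_pderiv i Q) \<subseteq> I" by (rule subset_trans[OF mp_vars_pderiv Suc.prems(2)])
      fix y assume y: "y \<in> U"
      show "mp_eval (mp_pderiv i Q) y = 0"
        by (rule step[of Q i y, OF Suc.prems(2) that _ y]) (rule Suc.prems(3))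
    qed
    \<comment> \<open>The integer factor in \<open>lookup_mp_pderiv\<close> is nonzero in
      characteristic zero, so a zero derivative rules out every monomial that contains
      \<open>i\<close>.\<close>
    have "m = 0" if "m \<in> Poly_Mapping.keys Q" for m
    proof (rule ccontr)
      assume "m \<noteq> 0"
      then have "Poly_Mapping.keys m \<noteq> {}" by simp
      then obtain i where i: "Poly_Mapping.lookup m i \<noteq> 0"
        by (metis all_not_in_conv in_keys_iff)
      then have "i \<in> I" using that Suc.prems(2) unfolding mp_vars_def by (metis UN_I in_keys_iff subsetD)
      from pd[OF this] have "Poly_Mapping.lookup (mp_pderiv i Q) (m - Poly_Mapping.single i 1) = 0"
        by simp
      then have "Poly_Mapping.lookup Q (m - Poly_Mapping.single i 1 + Poly_Mapping.single i 1) = 0"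
        unfolding lookup_mp_pderiv mult_eq_0_iff of_nat_eq_0_iff by blast
      then have "Poly_Mapping.lookup Q m = 0" by (simp only: mon_remove[OF i, symmetric])
      then show False using that by (simp add: in_keys_iff)
    qed
    then have "mon_deg m \<le> d" if "m \<in> Poly_Mapping.keys Q" for m
      using that by (metis le0 mon_deg_0)
    then show ?case by (rule Suc.IH) (use Suc.prems in auto)
  qed
  show ?thesis
    by (rule *[of Q "Max (mon_deg ` Poly_Mapping.keys Q)"]) (auto intro: assms(4) subsetD[OF assms(3)])
qed

lemma mp_eval_inject:
  fixes Q :: "('i, 'a::field_char_0) mpoly"
  assumes "\<And>y. mp_eval Q y = 0"
  shows "Q = 0"
proof (rule mp_zero_by_derivatives[of undefined UNIV UNIV])
  fix Q :: "('i, 'a) mpoly" and i y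
  assume z: "\<And>y. y \<in> UNIV \<Longrightarrow> mp_eval Q y = 0"
  have fin: "finite (insert i (mp_vars Q))" by (auto simp: mp_vars_def)
  define \<zeta> :: "'i \<Rightarrow> 'a poly" where "\<zeta> j = (if j = i then [:y i, 1:] else [:y j:])" for j
  obtain R where R: "\<And>t. poly R t = mp_eval Q (\<lambda>i. poly (\<zeta> i) t)"
    "\<And>t. poly (pderiv R) t = (\<Sum>j\<in>insert i (mp_vars Q).
       mp_eval (mp_pderiv j Q) (\<lambda>i. poly (\<zeta> i) t) * poly (pderiv (\<zeta> j)) t)"
    using mp_eval_curve[OF fin, of Q \<zeta>] by blast
  have "R = 0" using R(1) z by (simp flip: poly_all_0_iff_0)
  then have "0 = (\<Sum>j\<in>insert i (mp_vars Q).
       mp_eval (mp_pderiv j Q) (\<lambda>i. poly (\<zeta> i) 0) * poly (pderiv (\<zeta> j)) 0)"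
    using R(2)[of 0] by simp
  also have "\<dots> = (\<Sum>j\<in>insert i (mp_vars Q). if j = i then mp_eval (mp_pderiv i Q) (\<lambda>i. poly (\<zeta> i) 0) else 0)"
    by (intro sum.cong refl) (auto simp: \<zeta>_def pderiv_pCons)
  also have "\<dots> = mp_eval (mp_pderiv i Q) (\<lambda>i. poly (\<zeta> i) 0)"
    using fin by (simp add: sum.delta)
  also have "(\<lambda>i. poly (\<zeta> i) 0) = y" by (auto simp: \<zeta>_def)
  finally show "mp_eval (mp_pderiv i Q) y = 0" by simp
qed (use assms in auto)

section \<open>Polynomial functions\<close>

lemma poly_zero_off_finite:
  fixes p :: "'a::field_char_0 poly"
  assumes "finite S" "\<And>t. t \<notin> S \<Longrightarrow> poly p t = 0"
  shows "p = 0"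
proof (rule ccontr)
  assume "p \<noteq> 0"
  then have "finite {t. poly p t = 0}" by (rule poly_roots_finite)
  moreover have "UNIV = {t. poly p t = 0} \<union> S" using assms(2) by auto
  ultimately show False using assms(1) infinite_UNIV_char_0[where 'a = 'a] by (metis finite_Un)
qed

lemma poly_zero_off_0:
  fixes p :: "'a::field_char_0 poly"
  assumes "\<And>t. t \<noteq> 0 \<Longrightarrow> poly p t = 0"
  shows "p = 0"
  by (rule poly_zero_off_finite[of "{0}"]) (use assms in auto)

lemma poly_nonzero_point:
  fixes p :: "'a::field_char_0 poly"
  assumes "p \<noteq> 0" "finite S"
  obtains t where "poly p t \<noteq> 0" "t \<notin> S"
  using poly_zero_off_finite[OF assms(2), of p] assms(1) by blast

text \<open>Polynomiality as a closure property of functions: for expressions built from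
  \<open>T\<close> it follows by \<open>pf_intros\<close>, and on a line such a function becomes a
  univariate \<open>poly\<close>.\<close>

inductive polyfun :: "('a::field ^ 'n::finite \<Rightarrow> 'a) \<Rightarrow> bool" where
  const: "polyfun (\<lambda>x. c)"
| coord: "polyfun (\<lambda>x. x $ i)"
| add: "polyfun f \<Longrightarrow> polyfun g \<Longrightarrow> polyfun (\<lambda>x. f x + g x)"
| mult: "polyfun f \<Longrightarrow> polyfun g \<Longrightarrow> polyfun (\<lambda>x. f x * g x)"

named_theorems pf_intros
declare polyfun.intros [pf_intros]

lemma polyfun_uminus [pf_intros]: "polyfun f \<Longrightarrow> polyfun (\<lambda>x. - f x)"
  using polyfun.mult[OF polyfun.const[of "-1"], of f] by simp

lemma polyfun_diff [pf_intros]: "polyfun f \<Longrightarrow> polyfun g \<Longrightarrow> polyfun (\<lambda>x. f x - g x)"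
  using polyfun.add[OF _ polyfun_uminus, of f g] by simp

lemma polyfun_power [pf_intros]: "polyfun f \<Longrightarrow> polyfun (\<lambda>x. f x ^ n)"
  by (induction n) (auto intro: polyfun.intros)

lemma polyfun_sum [pf_intros]: "(\<And>i. i \<in> I \<Longrightarrow> polyfun (f i)) \<Longrightarrow> polyfun (\<lambda>x. \<Sum>i\<in>I. f i x)"
  by (induction I rule: infinite_finite_induct) (auto intro: polyfun.intros)

lemma polyfun_prod [pf_intros]: "(\<And>i. i \<in> I \<Longrightarrow> polyfun (f i)) \<Longrightarrow> polyfun (\<lambda>x. \<Prod>i\<in>I. f i x)"
  by (induction I rule: infinite_finite_induct) (auto intro: polyfun.intros)

lemma polyfun_mp_eval [pf_intros]: "polyfun (\<lambda>x. mp_eval P (($) x))"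
  unfolding mp_eval_def by (intro pf_intros)

lemma polyfun_imp_mp_eval:
  assumes "polyfun f"
  shows "\<exists>P. \<forall>x. f x = mp_eval P (($) x)"
  using assms
proof induction
  case (const c) then show ?case by (intro exI[of _ "mconst c"]) simp
next
  case (coord i) then show ?case by (intro exI[of _ "mvar i"]) simp
next
  case (add f g) then show ?case by (metis mp_eval_add)
next
  case (mult f g) then show ?case by (metis mp_eval_mult)
qed

lemma polyfun_det: "(\<And>i j. polyfun (\<lambda>x. A x $ i $ j)) \<Longrightarrow> polyfun (\<lambda>x. det (A x))"
  unfolding det_def by (intro pf_intros)

lemma polyfun_line:
  assumes "polyfun f"
  obtains q where "\<And>t. f (x + t *s d) = poly q t"
proof -
  from assms have "\<exists>q. \<forall>t. f (x + t *s d) = poly q t"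
  proof induction
    case (const c) then show ?case by (intro exI[of _ "[:c:]"]) simp
  next
    case (coord i) then show ?case by (intro exI[of _ "[:x $ i, d $ i:]"]) simp
  next
    case (add f g) then show ?case by (metis poly_add)
  next
    case (mult f g) then show ?case by (metis poly_mult)
  qed
  with that show ?thesis by blast
qed

lemma polyfun_line0:
  assumes "polyfun f"
  obtains q where "\<And>t. f (t *s d) = poly q t"
  using polyfun_line[OF assms, of 0 d] by auto

text \<open>A line joins a point where \<open>f\<close> is nonzero to one where \<open>g\<close> is
  nonzero; on it both restrict to nonzero univariate polynomials with product zero.\<close>

lemma polyfun_domain:
  fixes f g :: "'a::field_char_0 ^ 'n::finite \<Rightarrow> 'a"
  assumes "polyfun f" "polyfun g" "\<And>x. f x * g x = 0"
  shows "(\<forall>x. f x = 0) \<or> (\<forall>x. g x = 0)"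
proof (rule ccontr)
  assume "\<not> ?thesis"
  then obtain a b where ab: "f a \<noteq> 0" "g b \<noteq> 0" by blast
  obtain p where p: "\<And>t. f (a + t *s (b - a)) = poly p t" using polyfun_line[OF assms(1)] by blast
  obtain q where q: "\<And>t. g (a + t *s (b - a)) = poly q t" using polyfun_line[OF assms(2)] by blast
  have "poly (p * q) t = 0" for t using assms(3) p q by (metis poly_mult)
  then have "p * q = 0" using poly_all_0_iff_0 by blast
  moreover have "p \<noteq> 0" using p[of 0] ab by auto
  moreover have "q \<noteq> 0" using q[of 1] ab by auto
  ultimately show False by simp
qed


subsection \<open>Linear functionals\<close>

definition lfun :: "('a::field ^ 'n::finite \<Rightarrow> 'a) \<Rightarrow> bool" where
  "lfun f \<longleftrightarrow> (\<forall>x y. f (x + y) = f x + f y) \<and> (\<forall>c x. f (c *s x) = c * f x)"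

lemma lfunI: "(\<And>x y. f (x + y) = f x + f y) \<Longrightarrow> (\<And>c x. f (c *s x) = c * f x) \<Longrightarrow> lfun f"
  by (simp add: lfun_def)

lemma lfun_simps:
  assumes "lfun f"
  shows "f (x + y) = f x + f y" "f (c *s x) = c * f x" "f 0 = 0" "f (- x) = - f x" "f (x - y) = f x - f y"
proof -
  show 1: "f (x + y) = f x + f y" for x y using assms by (simp add: lfun_def)
  show 2: "f (c *s x) = c * f x" for c x using assms by (simp add: lfun_def)
  show 3: "f 0 = 0" using 2[of 0 0] by simp
  show 4: "f (- x) = - f x" for x using 2[of "-1" x] by (simp add: vector_sneg_minus1[symmetric])
  show "f (x - y) = f x - f y" using 1[of x "- y"] 4 by simp
qed

lemma lfun_sum: "lfun f \<Longrightarrow> f (\<Sum>i\<in>I. g i) = (\<Sum>i\<in>I. f (g i))"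
  by (induction I rule: infinite_finite_induct) (auto simp: lfun_simps)

lemma lfun_expand:
  assumes "lfun f"
  shows "f x = (\<Sum>i\<in>UNIV. x $ i * f (axis i 1))"
  by (subst basis_expansion[of x, symmetric]) (simp only: lfun_sum[OF assms] lfun_simps[OF assms])

lemma polyfun_lfun: "lfun f \<Longrightarrow> polyfun f"
proof -
  assume "lfun f"
  then have "f = (\<lambda>x. \<Sum>i\<in>UNIV. x $ i * f (axis i 1))" using lfun_expand by blast
  moreover have "polyfun (\<lambda>x. \<Sum>i\<in>UNIV. x $ i * f (axis i 1))" by (intro pf_intros)
  ultimately show ?thesis by metis
qed


subsection \<open>Bases of five-dimensional space\<close>

lemma exhaust_5:
  fixes x :: 5
  shows "x = 1 \<or> x = 2 \<or> x = 3 \<or> x = 4 \<or> x = 5"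
proof (induct x)
  case (of_int z)
  then have "0 \<le> z" and "z < 5" by simp_all
  then have "z = 0 \<or> z = 1 \<or> z = 2 \<or> z = 3 \<or> z = 4" by arith
  then show ?case by auto
qed

lemma UNIV_5: "UNIV = {1, 2, 3, 4, 5::5}"
  using exhaust_5 by auto

lemma sum_5: "sum f (UNIV::5 set) = f 1 + f 2 + f 3 + f 4 + f 5"
  unfolding UNIV_5 by (simp add: ac_simps)

lemma exists_not_in_span:
  fixes S :: "('a::field ^ 5) set"
  assumes "finite S" "card S < 5"
  obtains b where "b \<notin> vec.span S"
proof -
  have "vec.dim (vec.span S) \<le> card S"
    using assms(1) by (simp add: vec.dim_le_card')
  moreover have "vec.dim (UNIV :: ('a ^ 5) set) = 5"
    by (simp add: vec_dim_card del: vec.dim_UNIV)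
  ultimately have "vec.span S \<noteq> UNIV"
    using assms(2) by (metis not_le)
  then show ?thesis using that by blast
qed

text \<open>Independence of a list and not of a set, so that repeated vectors count as dependent;
  the coefficients stay explicit.\<close>

definition indep5 :: "'a::field ^ 5 \<Rightarrow> 'a ^ 5 \<Rightarrow> 'a ^ 5 \<Rightarrow> 'a ^ 5 \<Rightarrow> 'a ^ 5 \<Rightarrow> bool" where
  "indep5 a b c d e \<longleftrightarrow> (\<forall>r s t u v. r *s a + s *s b + t *s c + u *s d + v *s e = 0 \<longrightarrow>
     r = 0 \<and> s = 0 \<and> t = 0 \<and> u = 0 \<and> v = 0)"

lemma indep5D:
  "indep5 a b c d e \<Longrightarrow> r *s a + s *s b + t *s c + u *s d + v *s e = 0 \<Longrightarrow>
     r = 0 \<and> s = 0 \<and> t = 0 \<and> u = 0 \<and> v = 0"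
  unfolding indep5_def by blast

lemma in_span_insertI:
  assumes "c \<noteq> 0" "x + c *s b = 0" "x \<in> vec.span S"
  shows "b \<in> vec.span S"
proof -
  have "c *s b = - x"
    using assms(2) by (simp add: add_eq_0_iff)
  moreover have "b = inverse c *s (c *s b)"
    using assms(1) by simp
  ultimately have "b = inverse c *s (- x)" by simp
  then show ?thesis using assms(3) by (simp only: vec.span_scale vec.span_neg)
qed

lemma indep5I:
  assumes "a \<noteq> 0" "b \<notin> vec.span {a}" "c \<notin> vec.span {a, b}" "d \<notin> vec.span {a, b, c}"
    "e \<notin> vec.span {a, b, c, d}"
  shows "indep5 a b c d e"
  unfolding indep5_def
proof (intro allI impI)
  fix r s t u v
  assume eq: "r *s a + s *s b + t *s c + u *s d + v *s e = 0"
  note sp = vec.span_add vec.span_scale vec.span_base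
  have "v = 0"
  proof (rule ccontr)
    assume "v \<noteq> 0"
    then have "e \<in> vec.span {a, b, c, d}" by (rule in_span_insertI[OF _ eq]) (intro sp insertI1 insertI2)
    with assms show False by blast
  qed
  with eq have eq: "r *s a + s *s b + t *s c + u *s d = 0" by simp
  have "u = 0"
  proof (rule ccontr)
    assume "u \<noteq> 0"
    then have "d \<in> vec.span {a, b, c}" by (rule in_span_insertI[OF _ eq]) (intro sp insertI1 insertI2)
    with assms show False by blast
  qed
  with eq have eq: "r *s a + s *s b + t *s c = 0" by simp
  have "t = 0"
  proof (rule ccontr)
    assume "t \<noteq> 0"
    then have "c \<in> vec.span {a, b}" by (rule in_span_insertI[OF _ eq]) (intro sp insertI1 insertI2)
    with assms show False by blast
  qed
  with eq have eq: "r *s a + s *s b = 0" by simp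
  have "s = 0"
  proof (rule ccontr)
    assume "s \<noteq> 0"
    then have "b \<in> vec.span {a}" by (rule in_span_insertI[OF _ eq]) (intro sp insertI1 insertI2)
    with assms show False by blast
  qed
  with eq have "r = 0" using assms(1) by (simp add: vec.scale_eq_0_iff)
  show "r = 0 \<and> s = 0 \<and> t = 0 \<and> u = 0 \<and> v = 0" 
    using \<open>r = 0\<close> \<open>s = 0\<close> \<open>t = 0\<close> \<open>u = 0\<close> \<open>v = 0\<close> by blast
qed

lemma indep5_expand:
  assumes "indep5 a b c d e"
  obtains r s t u v where "x = r *s a + s *s b + t *s c + u *s d + v *s e"
proof -
  define f where "f y = y $ 1 *s a + y $ 2 *s b + y $ 3 *s c + y $ 4 *s d + y $ 5 *s e"
    for y :: "'a ^ 5"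
  have lin: "Vector_Spaces.linear (*s) (*s) f"
    unfolding Vector_Spaces.linear_iff
    by (intro conjI allI vec.vector_space_axioms)
      (simp_all add: f_def vec.scale_left_distrib vec.scale_right_distrib)
  have "inj f"
    unfolding vec.linear_inj_iff_eq_0[OF lin]
  proof safe
    fix y assume "f y = 0"
    note z = indep5D[OF assms this[unfolded f_def]]
    have "y $ i = 0" for i using exhaust_5[of i] z by auto
    then show "y = 0" by (simp add: vec_eq_iff)
  qed
  from vec.linear_inj_imp_surj[OF lin this] obtain y where "x = f y" by blast
  then show ?thesis using that unfolding f_def by blast
qed


section \<open>Symmetric trilinear forms\<close>

definition pencil :: "'a::field ^ 'n ^ 'm \<Rightarrow> 'a ^ 'n ^ 'm \<Rightarrow> 'a \<Rightarrow> 'a ^ 'n ^ 'm" where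
  "pencil A B t = (\<chi> i j. A $ i $ j + t * B $ i $ j)"

locale sym_trilinear =
  fixes T :: "'a::{alg_closed_field, field_char_0} ^ 'n::finite \<Rightarrow> 'a ^ 'n \<Rightarrow> 'a ^ 'n \<Rightarrow> 'a"
  assumes add1: "T (x + y) z w = T x z w + T y z w"
    and scale1: "T (c *s x) z w = c * T x z w"
    and comm12: "T x y z = T y x z"
    and comm23: "T x y z = T x z y"
begin

lemma add2: "T z (x + y) w = T z x w + T z y w"
  by (metis add1 comm12)

lemma add3: "T z w (x + y) = T z w x + T z w y"
  by (metis add2 comm23)

lemma scale2: "T z (c *s x) w = c * T z x w"
  by (metis scale1 comm12)

lemma scale3: "T z w (c *s x) = c * T z w x"
  by (metis scale2 comm23)

lemma lfun1: "lfun (\<lambda>x. T x y z)" and lfun2: "lfun (\<lambda>y. T x y z)" and lfun3: "lfun (\<lambda>z. T x y z)"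
  by (auto intro!: lfunI add1 add2 add3 scale1 scale2 scale3)

lemmas T_simps = lfun_simps[OF lfun1] lfun_simps[OF lfun2] lfun_simps[OF lfun3]

lemmas T_ac = comm12 comm23

lemma polyfun_T [pf_intros]:
  assumes "\<And>c. polyfun (\<lambda>x. X x $ c)" "\<And>c. polyfun (\<lambda>x. Y x $ c)" "\<And>c. polyfun (\<lambda>x. Z x $ c)"
  shows "polyfun (\<lambda>x. T (X x) (Y x) (Z x))"
  by (subst lfun_expand[OF lfun1], subst lfun_expand[OF lfun2], subst lfun_expand[OF lfun3])
     (intro pf_intros assms)

abbreviation F :: "'a ^ 'n \<Rightarrow> 'a" where "F x \<equiv> T x x x"

text \<open>The Gram matrix of the bilinear form \<open>T x _ _\<close>, which is the Hessian matrix
  of \<open>F\<close> divided by 6.\<close>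

definition hess :: "'a ^ 'n \<Rightarrow> 'a ^ 'n ^ 'n" where
  "hess x = (\<chi> i j. T x (axis i 1) (axis j 1))"

lemma hess_mult: "(hess x *v v) $ i = T x (axis i 1) v"
  by (simp add: hess_def matrix_vector_mult_def lfun_expand[OF lfun3, of x _ v] mult.commute)

lemma hess_pair: "(\<Sum>i\<in>UNIV. w $ i * (hess x *v v) $ i) = T x w v"
  unfolding hess_mult by (rule lfun_expand[OF lfun2, symmetric])

lemma hess_kernel: "hess x *v v = 0 \<longleftrightarrow> (\<forall>w. T x v w = 0)"
proof
  assume *: "hess x *v v = 0"
  have "T x w v = 0" for w using hess_pair[of w x v] * by simp
  then show "\<forall>w. T x v w = 0" by (metis comm23)
next
  assume "\<forall>w. T x v w = 0"
  then have "T x (axis i 1) v = 0" for i by (metis comm23)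
  then show "hess x *v v = 0" by (simp add: vec_eq_iff hess_mult)
qed

lemma det_hess_0_iff: "det (hess x) = 0 \<longleftrightarrow> (\<exists>v. v \<noteq> 0 \<and> (\<forall>w. T x v w = 0))"
  using invertible_det_nz[of "hess x"] unfolding invertible_left_inverse matrix_left_invertible_ker hess_kernel[symmetric]
  by blast

lemma polyfun_det_hess: "polyfun (\<lambda>x. det (hess x))"
  unfolding hess_def by (intro polyfun_det) (simp, intro pf_intros)

lemma hess_line: "hess (x + t *s w) = pencil (hess x) (hess w) t"
  by (simp add: hess_def pencil_def vec_eq_iff T_simps)

lemma transpose_hess: "transpose (hess x) = hess x"
  by (simp add: transpose_def hess_def vec_eq_iff T_ac)

end


section \<open>Determinants of pencils of singular matrices\<close>

lemma det_nonzero_iff: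
  fixes M :: "'a::field ^ 'n::finite ^ 'n"
  shows "det M \<noteq> 0 \<longleftrightarrow> (\<forall>u. M *v u = 0 \<longrightarrow> u = 0)"
  using invertible_det_nz[of M] unfolding invertible_left_inverse matrix_left_invertible_ker by blast

lemma det_pencil_poly:
  fixes A B :: "'a::field ^ 'n::finite ^ 'n"
  obtains p where "\<And>t. det (pencil A B t) = poly p t"
proof
  show "det (pencil A B t) =
    poly (\<Sum>p | p permutes UNIV. of_int (sign p) * (\<Prod>i\<in>UNIV. [: A $ i $ p i, B $ i $ p i :])) t" for t
    by (simp add: det_def pencil_def poly_sum poly_prod)
qed

text \<open>The first order term is the trace of the adjugate of \<open>A\<close> times \<open>B\<close>, and the adjugate of \<open>A\<close>
  is a multiple of \<open>v v\<^sup>T\<close>.\<close>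

lemma det_pencil_kernel:
  fixes A :: "'a::field ^ 'n::finite ^ 'n"
  assumes sym: "transpose A = A" and ker: "A *v v = 0" and v: "v \<noteq> 0"
  obtains \<kappa> where "(\<forall>u. A *v u = 0 \<longrightarrow> u \<in> vec.span {v}) \<Longrightarrow> \<kappa> \<noteq> 0"
    "\<And>B. \<exists>p. \<forall>t. det (pencil A B t) = t * (\<kappa> * (\<Sum>i\<in>UNIV. v $ i * (B *v v) $ i)) + t\<^sup>2 * poly p t"
proof -
  have mult_axis: "(M *v axis k 1) $ i = M $ i $ k" for M :: "'a^'n^'n" and i k
  proof -
    have "(M *v axis k 1) $ i = (\<Sum>j\<in>UNIV. if j = k then M $ i $ k else 0)"
      unfolding matrix_vector_mult_def vec_lambda_beta by (intro sum.cong refl) (auto simp: axis_def)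
    then show ?thesis by simp
  qed
  from v obtain k where k: "v $ k \<noteq> 0" by (metis vec_eq_iff zero_index)
  \<comment> \<open>The identity with column \<open>k\<close> replaced by \<open>v\<close>: a basis
    change that moves the kernel vector to the \<open>k\<close>-th axis. The congruence
    \<open>C\<close> then makes row and column \<open>k\<close> of \<open>A\<close> zero.\<close>
  define P :: "'a^'n^'n" where "P = (\<chi> i j. if j = k then v $ i else if i = j then 1 else 0)"
  have Pk: "P *v axis k 1 = v"
    by (simp add: vec_eq_iff mult_axis) (simp add: P_def)
  have detP: "det P \<noteq> 0"
  proof -
    have "u = 0" if "P *v u = 0" for u
    proof -
      have eq: "(P *v u) $ i = v $ i * u $ k + (if i = k then 0 else u $ i)" for i
      proof -
        have "(P *v u) $ i = (\<Sum>j\<in>UNIV. P $ i $ j * u $ j)" by (simp add: matrix_vector_mult_def)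
        also have "\<dots> = (\<Sum>j\<in>UNIV. (if j = k then v $ i * u $ k else 0) + (if j = i then (if i = k then 0 else u $ i) else 0))"
          by (intro sum.cong refl) (auto simp: P_def)
        finally show ?thesis by (simp add: sum.distrib)
      qed
      have "u $ k = 0" using eq[of k] that k by simp
      then show ?thesis using eq that by (simp add: vec_eq_iff) (metis)
    qed
    then show ?thesis
      unfolding det_nonzero_iff by blast
  qed
  define C where "C B = transpose P ** B ** P" for B
  have C_entry: "C B $ k $ k = (\<Sum>i\<in>UNIV. v $ i * (B *v v) $ i)" for B
  proof -
    have "C B $ k $ k = (\<Sum>i\<in>UNIV. (transpose P $ k $ i) * (B ** P) $ i $ k)"
      unfolding C_def matrix_mul_assoc[symmetric]
      unfolding matrix_matrix_mult_def[of "transpose P"] by simp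
    also have "\<dots> = (\<Sum>i\<in>UNIV. v $ i * (B *v v) $ i)"
      by (intro sum.cong refl)
        (simp add: transpose_def P_def matrix_matrix_mult_def matrix_vector_mult_def)
    finally show ?thesis .
  qed
  have col: "C A $ i $ k = 0" for i
  proof -
    have "C A *v axis k 1 = 0"
      by (simp add: C_def matrix_vector_mul_assoc[symmetric] Pk ker)
    then show ?thesis using mult_axis[of "C A" k i] by simp
  qed
  have "transpose (C A) = C A"
    by (simp add: C_def matrix_transpose_mul sym matrix_mul_assoc)
  then have row: "C A $ k $ i = 0" for i
    using col[of i] by (metis transpose_def vec_lambda_beta)
  \<comment> \<open>With a unit row in place of row \<open>k\<close>, \<open>det A'\<close> is the
    complementary principal minor of \<open>C A\<close>; dividing by the square of
    \<open>det P\<close> undoes the congruence.\<close>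
  define A' where "A' = (\<chi> i. if i = k then axis k 1 else C A $ i)"
  define \<kappa> where "\<kappa> = det A' / (det P)\<^sup>2"
  show ?thesis
  proof
    assume ker1: "\<forall>u. A *v u = 0 \<longrightarrow> u \<in> vec.span {v}"
    have "u = 0" if u: "A' *v u = 0" for u
    proof -
      have "(A' *v u) $ k = u $ k"
        by (simp add: A'_def matrix_vector_mult_def axis_def if_distrib[of "\<lambda>x. x * _"] cong: if_cong)
      then have uk: "u $ k = 0" using u by simp
      have "(C A *v u) $ i = 0" for i
      proof (cases "i = k")
        case True then show ?thesis by (simp add: matrix_vector_mult_def row)
      next
        case False
        then have "(C A *v u) $ i = (A' *v u) $ i" by (simp add: A'_def matrix_vector_mult_def)
        then show ?thesis using u by simp
      qed
      then have "C A *v u = 0" by (simp add: vec_eq_iff)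
      then have "transpose P *v (A *v (P *v u)) = 0"
        by (simp add: C_def matrix_vector_mul_assoc matrix_mul_assoc)
      moreover have "det (transpose P) \<noteq> 0" using detP by simp
      ultimately have "A *v (P *v u) = 0"
        unfolding det_nonzero_iff by blast
      with ker1 obtain c where "P *v u = c *s v" by (auto simp: vec.span_singleton)
      then have "P *v (u - c *s axis k 1) = 0"
        by (simp add: vec.diff vec.scale Pk)
      then have "u - c *s axis k 1 = 0"
        using detP unfolding det_nonzero_iff by blast
      then show "u = 0" using uk by (simp add: vec_eq_iff axis_def)
    qed
    then have "det A' \<noteq> 0"
      unfolding det_nonzero_iff by blast
    then show "\<kappa> \<noteq> 0" using detP by (simp add: \<kappa>_def)
  next
    fix B
    define S where "S = (\<Sum>i\<in>UNIV. v $ i * (B *v v) $ i)"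
    have CAB: "C (pencil A B t) = pencil (C A) (C B) t" for t
      by (simp add: C_def pencil_def vec_eq_iff matrix_matrix_mult_def sum_distrib_left sum_distrib_right
        sum.distrib algebra_simps)
    obtain p where p: "\<And>t. det (pencil (\<chi> i. if i = k then C B $ k else C A $ i)
         (\<chi> i. if i = k then 0 else C B $ i) t) = poly p t"
      using det_pencil_poly by blast
    \<comment> \<open>Row \<open>k\<close> of \<open>C A\<close> is zero, so row \<open>k\<close> of
      the pencil is \<open>t\<close> times row \<open>k\<close> of \<open>C B\<close>. This accounts
      for the factor \<open>t\<close>, and \<open>poly p 0\<close> is the first order term.\<close>
    have det_eq: "det (C (pencil A B t)) = t * poly p t" for t
    proof -
      have "C (pencil A B t) = (\<chi> i. if i = k then t *s C B $ k else C A $ i + t *s C B $ i)"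
        unfolding CAB by (simp add: vec_eq_iff row pencil_def)
      then have "det (C (pencil A B t)) = t * det (\<chi> i. if i = k then C B $ k else C A $ i + t *s C B $ i)"
        by (simp only: det_row_mul)
      also have "(\<chi> i. if i = k then C B $ k else C A $ i + t *s C B $ i) =
          pencil (\<chi> i. if i = k then C B $ k else C A $ i) (\<chi> i. if i = k then 0 else C B $ i) t"
        by (simp add: vec_eq_iff pencil_def)
      finally show ?thesis by (simp only: p)
    qed
    have p0: "poly p 0 = S * det A'"
    proof -
      have "poly p 0 = det (\<chi> i. if i = k then C B $ k else C A $ i)"
        using p[of 0] by (simp add: pencil_def vec_lambda_eta)
      \<comment> \<open>Row \<open>k\<close> is split into its diagonal entry and a row that is zero
        in column \<open>k\<close>; the second part contributes nothing because column
        \<open>k\<close> of \<open>C A\<close> is zero too.\<close>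
      also have "\<dots> = det (\<chi> i. if i = k then S *s axis k 1 + (C B $ k - S *s axis k 1) else C A $ i)"
        by (intro arg_cong[of _ _ det]) (simp add: vec_eq_iff)
      also have "\<dots> = S * det A' + det (\<chi> i. if i = k then C B $ k - S *s axis k 1 else C A $ i)"
        unfolding det_row_add det_row_mul A'_def ..
      also have "det (\<chi> i. if i = k then C B $ k - S *s axis k 1 else C A $ i) = 0"
        by (rule det_zero_column(2)[of k])
           (simp add: column_def vec_eq_iff col C_entry S_def)
      finally show ?thesis by simp
    qed
    obtain a q where q: "p = pCons a q" by (cases p)
    have "det (pencil A B t) = t * (\<kappa> * S) + t\<^sup>2 * poly (smult (1 / (det P)\<^sup>2) q) t" for t
    proof -
      have "poly p t = poly p 0 + t * poly q t" by (simp add: q)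
      moreover have "det (C (pencil A B t)) = (det P)\<^sup>2 * det (pencil A B t)"
        by (simp add: C_def det_mul power2_eq_square)
      ultimately show ?thesis using det_eq[of t] p0 detP
        by (simp add: \<kappa>_def field_simps power2_eq_square)
    qed
    then show "\<exists>p. \<forall>t. det (pencil A B t) = t * (\<kappa> * (\<Sum>i\<in>UNIV. v $ i * (B *v v) $ i)) + t\<^sup>2 * poly p t"
      unfolding S_def by blast
  qed
qed

section \<open>Functions vanishing on a cubic hypersurface\<close>

lemma alg_closed_sqrt:
  obtains s :: "'a::alg_closed_field" where "s\<^sup>2 = x"
  using nth_root_exists[of 2 x] by auto

text \<open>Up to the factor -27, \<open>4 * B ^ 3 + c\<^sup>2\<close> is the discriminant. Dividing
  out one root \<open>r\<close> leaves a quadratic with discriminant \<open>d\<^sup>2\<close>, and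
  the product of the differences of the three roots is
  \<open>d * (3 * r - d) * (3 * r + d) / 4\<close>.\<close>

lemma depressed_cubic_roots:
  fixes B c :: "'a::{alg_closed_field, field_char_0}"
  assumes "4 * B ^ 3 + c\<^sup>2 \<noteq> 0"
  obtains r s t where "r \<noteq> s" "r \<noteq> t" "s \<noteq> t"
    "\<And>u. u \<in> {r, s, t} \<Longrightarrow> u ^ 3 + 3 * B * u + c = 0"
proof -
  have "\<exists>r. poly [:c, 3 * B, 0, 1:] r = 0"
    by (rule alg_closed_imp_poly_has_root) simp
  then obtain r where r: "r ^ 3 + 3 * B * r + c = 0"
    by (auto simp: algebra_simps power3_eq_cube)
  obtain d where d: "d\<^sup>2 = - 3 * r\<^sup>2 - 12 * B" using alg_closed_sqrt .
  have B12: "12 * B = - (d\<^sup>2 + 3 * r\<^sup>2)" using d by algebra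
  then have B: "B = - (d\<^sup>2 + 3 * r\<^sup>2) / 12" by (simp add: field_simps)
  have c: "c = - (r ^ 3) + (d\<^sup>2 + 3 * r\<^sup>2) / 4 * r"
  proof -
    have "4 * c = - 4 * r ^ 3 + (d\<^sup>2 + 3 * r\<^sup>2) * r" using r B12 by algebra
    then show ?thesis by (simp add: field_simps)
  qed
  have disc: "4 * B ^ 3 + c\<^sup>2 = - (d * (3 * r - d) * (3 * r + d))\<^sup>2 / 432"
    unfolding B c by (simp add: field_simps power2_eq_square power3_eq_cube)
  have nz: "d \<noteq> 0" "3 * r \<noteq> d" "3 * r \<noteq> - d"
    using assms unfolding disc by (auto simp: eq_neg_iff_add_eq_0)
  show ?thesis
  proof (rule that[of r "(- r + d) / 2" "(- r - d) / 2"])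
    show "r \<noteq> (- r + d) / 2" "r \<noteq> (- r - d) / 2" "(- r + d) / 2 \<noteq> (- r - d) / 2"
      using nz by (auto simp: field_simps eq_neg_iff_add_eq_0 add.commute)
    show "u ^ 3 + 3 * B * u + c = 0" if "u \<in> {r, (- r + d) / 2, (- r - d) / 2}" for u
    proof -
      have "4 * (u ^ 3 + 3 * B * u + c) = (u - r) * ((2 * u + r)\<^sup>2 - d\<^sup>2)"
        unfolding B c by (simp add: field_simps power2_eq_square power3_eq_cube)
      moreover have "u = r \<or> 2 * u + r = d \<or> 2 * u + r = - d"
        using that by (auto simp: field_simps eq_neg_iff_add_eq_0)
      ultimately have "4 * (u ^ 3 + 3 * B * u + c) = 0" by (auto simp del: distrib_left_numeral)
      then show ?thesis unfolding mult_eq_0_iff by simp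
    qed
  qed
qed

lemma quadratic_three_roots:
  fixes a b c :: "'a::field"
  assumes "r \<noteq> s" "r \<noteq> t" "s \<noteq> t" "\<And>u. u \<in> {r, s, t} \<Longrightarrow> a + b * u + c * u\<^sup>2 = 0"
  shows "a = 0" "b = 0" "c = 0"
proof -
  have e: "a + b * r + c * r\<^sup>2 = 0" "a + b * s + c * s\<^sup>2 = 0" "a + b * t + c * t\<^sup>2 = 0"
    using assms(4) by auto
  have "(r - s) * (b + c * (r + s)) = 0" using e(1,2) by algebra
  then have 1: "b + c * (r + s) = 0" using assms(1) by simp
  have "(r - t) * (b + c * (r + t)) = 0" using e(1,3) by algebra
  then have 2: "b + c * (r + t) = 0" using assms(2) by simp
  have "c * (s - t) = 0" using 1 2 by algebra
  then show c: "c = 0" using assms(3) by simp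
  show b: "b = 0" using 1 c by simp
  show "a = 0" using e(1) b c by simp
qed

context sym_trilinear
begin

text \<open>For \<open>F p = 1\<close> this projects along \<open>p\<close> onto the hyperplane
  \<open>T p p y = 0\<close>. From a point \<open>y\<close> of that hyperplane in direction
  \<open>p\<close>, \<open>F\<close> is a monic cubic without quadratic term, and
  \<open>disc\<close> is its discriminant up to a constant factor.\<close>

definition proj :: "'a ^ 'n \<Rightarrow> 'a ^ 'n \<Rightarrow> 'a ^ 'n" where
  "proj p x = x - T p p x *s p"

definition disc :: "'a ^ 'n \<Rightarrow> 'a ^ 'n \<Rightarrow> 'a" where
  "disc p x = 4 * T p (proj p x) (proj p x) ^ 3 + (F (proj p x))\<^sup>2"

text \<open>The condition \<open>q 0 = 0\<close> excludes nonzero constants \<open>q\<close>, so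
  that both factors are nonunits; \<open>l = 0\<close> makes the zero form count as
  reducible.\<close>

definition linear_factor :: bool where
  "linear_factor \<longleftrightarrow> (\<exists>l q. lfun l \<and> polyfun q \<and> q 0 = 0 \<and> (\<forall>x. F x = l x * q x))"

lemma F_line: "F (y + t *s z) = F y + 3 * t * T y y z + 3 * t\<^sup>2 * T y z z + t ^ 3 * F z"
  by (simp add: T_simps T_ac) (simp add: algebra_simps power2_eq_square power3_eq_cube)

lemma polyfun_proj [pf_intros]: "polyfun (\<lambda>x. proj p x $ i)"
  unfolding proj_def vector_minus_component vector_smult_component by (intro pf_intros)

lemma proj_add: "F p = 1 \<Longrightarrow> proj p (x + t *s p) = proj p x"
  by (simp add: proj_def T_simps vec_eq_iff algebra_simps)

lemma tau_proj: "F p = 1 \<Longrightarrow> T p p (proj p x) = 0"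
  by (simp add: proj_def T_simps)

lemma proj_id: "T p p x = 0 \<Longrightarrow> proj p x = x"
  by (simp add: proj_def)

lemma F_proj:
  assumes "F p = 1"
  shows "F x = T p p x ^ 3 + 3 * T p (proj p x) (proj p x) * T p p x + F (proj p x)"
proof -
  have "x = proj p x + T p p x *s p" by (simp add: proj_def)
  then have "F x = F (proj p x + T p p x *s p)" by simp
  also have "\<dots> = F (proj p x) + 3 * T p p x * T (proj p x) (proj p x) p +
      3 * (T p p x)\<^sup>2 * T (proj p x) p p + T p p x ^ 3 * F p"
    by (rule F_line)
  also have "T (proj p x) p p = 0" using tau_proj[OF assms, of x] by (metis comm12 comm23)
  also have "T (proj p x) (proj p x) p = T p (proj p x) (proj p x)" by (metis comm12 comm23)
  finally show ?thesis using assms by simp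
qed

text \<open>Division by \<open>F\<close>, seen as a monic cubic in \<open>T p p x\<close> with
  coefficients constant along \<open>p\<close>. Quotient and remainder are built along the rules of
  \<open>polyfun\<close>; only a product has to be reduced.\<close>

lemma remainder:
  assumes "F p = 1" "polyfun G"
  shows "\<exists>S R0 R1 R2. polyfun S \<and> (\<forall>R\<in>{R0, R1, R2}. polyfun R \<and> (\<forall>x t. R (x + t *s p) = R x)) \<and>
    (\<forall>x. G x = F x * S x + R0 x + R1 x * T p p x + R2 x * (T p p x)\<^sup>2)"
  using assms(2)
proof induction
  case (const c)
  show ?case by (rule exI[of _ "\<lambda>_. 0"], rule exI[of _ "\<lambda>_. c"], (rule exI[of _ "\<lambda>_. 0"])+)
     (auto intro: pf_intros)
next
  case (coord i)
  show ?case
    by (rule exI[of _ "\<lambda>_. 0"], rule exI[of _ "\<lambda>x. proj p x $ i"], rule exI[of _ "\<lambda>_. p $ i"],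
        rule exI[of _ "\<lambda>_. 0"])
      (auto intro: pf_intros simp: proj_add[OF assms(1)], simp add: proj_def)
next
  case (add f g)
  then obtain S R0 R1 R2 S' R0' R1' R2' where
    f: "polyfun S" "\<forall>R\<in>{R0, R1, R2}. polyfun R \<and> (\<forall>x t. R (x + t *s p) = R x)"
    "\<forall>x. f x = F x * S x + R0 x + R1 x * T p p x + R2 x * (T p p x)\<^sup>2" and
    g: "polyfun S'" "\<forall>R\<in>{R0', R1', R2'}. polyfun R \<and> (\<forall>x t. R (x + t *s p) = R x)"
    "\<forall>x. g x = F x * S' x + R0' x + R1' x * T p p x + R2' x * (T p p x)\<^sup>2"
    by metis
  have pf: "polyfun R0" "polyfun R1" "polyfun R2" "polyfun R0'" "polyfun R1'" "polyfun R2'"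
    and inv: "R0 (x + t *s p) = R0 x" "R1 (x + t *s p) = R1 x" "R2 (x + t *s p) = R2 x"
    "R0' (x + t *s p) = R0' x" "R1' (x + t *s p) = R1' x" "R2' (x + t *s p) = R2' x" for x t
    using f(2) g(2) by simp_all
  have "polyfun (\<lambda>x. S x + S' x)" by (intro pf_intros f(1) g(1))
  moreover have "\<forall>R\<in>{\<lambda>x. R0 x + R0' x, \<lambda>x. R1 x + R1' x, \<lambda>x. R2 x + R2' x}.
      polyfun R \<and> (\<forall>x t. R (x + t *s p) = R x)"
    by (simp add: inv) (intro conjI pf_intros pf)
  moreover have "\<forall>x. f x + g x = F x * (S x + S' x) + (R0 x + R0' x) + (R1 x + R1' x) * T p p x
      + (R2 x + R2' x) * (T p p x)\<^sup>2"
    using f(3) g(3) by (simp add: algebra_simps)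
  ultimately show ?case by blast
next
  case (mult f g)
  then obtain S R0 R1 R2 S' R0' R1' R2' where
    f: "polyfun S" "\<forall>R\<in>{R0, R1, R2}. polyfun R \<and> (\<forall>x t. R (x + t *s p) = R x)"
    "\<forall>x. f x = F x * S x + R0 x + R1 x * T p p x + R2 x * (T p p x)\<^sup>2" and
    g: "polyfun S'" "\<forall>R\<in>{R0', R1', R2'}. polyfun R \<and> (\<forall>x t. R (x + t *s p) = R x)"
    "\<forall>x. g x = F x * S' x + R0' x + R1' x * T p p x + R2' x * (T p p x)\<^sup>2"
    by metis
  define B where "B x = T p (proj p x) (proj p x)" for x
  define C where "C x = F (proj p x)" for x
  \<comment> \<open>\<open>A3\<close> and \<open>A4\<close> are the coefficients of the third and
    fourth power of \<open>T p p x\<close> in the product of the remainders. Both powers are removed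
    by \<open>T p p x ^ 3 = F x - 3 * B x * T p p x - C x\<close>.\<close>
  define A3 where "A3 x = R1 x * R2' x + R2 x * R1' x" for x
  define A4 where "A4 x = R2 x * R2' x" for x
  have inv: "B (x + t *s p) = B x" "C (x + t *s p) = C x" "A3 (x + t *s p) = A3 x" "A4 (x + t *s p) = A4 x"
    "R0 (x + t *s p) = R0 x" "R1 (x + t *s p) = R1 x" "R2 (x + t *s p) = R2 x"
    "R0' (x + t *s p) = R0' x" "R1' (x + t *s p) = R1' x" "R2' (x + t *s p) = R2' x" for x t
    using f(2) g(2) by (simp_all add: B_def C_def A3_def A4_def proj_add[OF assms(1)])
  have pf0: "polyfun R0" "polyfun R1" "polyfun R2" "polyfun R0'" "polyfun R1'" "polyfun R2'"
    using f(2) g(2) by simp_all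
  have pf: "polyfun B" "polyfun C" "polyfun A3" "polyfun A4"
    unfolding B_def C_def A3_def A4_def by (intro pf_intros pf0)+
  have F: "F x = T p p x ^ 3 + 3 * B x * T p p x + C x" for x
    unfolding B_def C_def by (rule F_proj[OF assms(1)])
  define S'' where "S'' x = S x * g x + (R0 x + R1 x * T p p x + R2 x * (T p p x)\<^sup>2) * S' x + A3 x + A4 x * T p p x" for x
  define Q0 where "Q0 x = R0 x * R0' x - C x * A3 x" for x
  define Q1 where "Q1 x = R0 x * R1' x + R1 x * R0' x - 3 * B x * A3 x - C x * A4 x" for x
  define Q2 where "Q2 x = R0 x * R2' x + R1 x * R1' x + R2 x * R0' x - 3 * B x * A4 x" for x
  have "polyfun S''" "polyfun Q0" "polyfun Q1" "polyfun Q2"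
    unfolding S''_def Q0_def Q1_def Q2_def by (intro pf_intros pf pf0 f(1) g(1) mult.hyps)+
  moreover have "Q0 (x + t *s p) = Q0 x" "Q1 (x + t *s p) = Q1 x" "Q2 (x + t *s p) = Q2 x" for x t
    unfolding Q0_def Q1_def Q2_def inv by simp_all
  moreover have "f x * g x = F x * S'' x + Q0 x + Q1 x * T p p x + Q2 x * (T p p x)\<^sup>2" for x
  proof -
    have f3: "f x = F x * S x + R0 x + R1 x * T p p x + R2 x * (T p p x)\<^sup>2" using f(3) by blast
    have g3: "g x = F x * S' x + R0' x + R1' x * T p p x + R2' x * (T p p x)\<^sup>2" using g(3) by blast
    show ?thesis
      unfolding S''_def Q0_def Q1_def Q2_def A3_def A4_def
      using f3 g3 F[of x] by algebra
  qed
  ultimately show ?case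
    by (intro exI[of _ S''] exI[of _ Q0] exI[of _ Q1] exI[of _ Q2]) auto
qed

lemma polyfun_disc: "polyfun (disc p)"
  unfolding disc_def[abs_def] by (intro pf_intros)

text \<open>On a line in direction \<open>p\<close> with nonzero \<open>disc\<close>, the remainder
  has degree at most two and three distinct zeros. So its coefficients vanish wherever
  \<open>disc\<close> does not, hence everywhere. Since \<open>G\<close> is only tested where
  \<open>disc\<close> is nonzero, the lemma also serves for statements about general points.\<close>

lemma vanishing_imp_multiple:
  assumes p: "F p = 1" and ne: "\<exists>x. disc p x \<noteq> 0" and G: "polyfun G"
    and van: "\<And>x. F x = 0 \<Longrightarrow> disc p x \<noteq> 0 \<Longrightarrow> G x = 0"
  obtains S where "polyfun S" "\<And>x. G x = F x * S x"
proof -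
  obtain S R0 R1 R2 where S: "polyfun S" and R: "\<forall>R\<in>{R0, R1, R2}. polyfun R \<and> (\<forall>x t. R (x + t *s p) = R x)"
    and eq: "\<forall>x. G x = F x * S x + R0 x + R1 x * T p p x + R2 x * (T p p x)\<^sup>2"
    using remainder[OF p G] by blast
  have z: "R0 x = 0 \<and> R1 x = 0 \<and> R2 x = 0" if x: "disc p x \<noteq> 0" for x
  proof -
    let ?y = "proj p x"
    obtain r s t where rst: "r \<noteq> s" "r \<noteq> t" "s \<noteq> t" and
      roots: "\<And>u. u \<in> {r, s, t} \<Longrightarrow> u ^ 3 + 3 * T p ?y ?y * u + F ?y = 0"
      using depressed_cubic_roots[OF x[unfolded disc_def]] by blast
    have "R0 x + R1 x * u + R2 x * u\<^sup>2 = 0" if u: "u \<in> {r, s, t}" for u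
    proof -
      let ?z = "?y + u *s p"
      have pz: "proj p ?z = ?y" using proj_add[OF p] proj_id[OF tau_proj[OF p]] by simp
      have tz: "T p p ?z = u" using tau_proj[OF p] p by (simp add: T_simps)
      have "F ?z = 0" unfolding F_proj[OF p, of ?z] pz tz using roots[OF u] by simp
      moreover have "disc p ?z \<noteq> 0" using x unfolding disc_def pz .
      ultimately have "G ?z = 0" by (rule van)
      moreover have RR: "R ?z = R x" if "R \<in> {R0, R1, R2}" for R
      proof -
        have "?z = x + (u - T p p x) *s p" by (simp add: proj_def vec_eq_iff algebra_simps)
        then show ?thesis using R that by metis
      qed
      ultimately show ?thesis using eq[rule_format, of ?z] \<open>F ?z = 0\<close> tz RR[of R0] RR[of R1] RR[of R2]
        by (simp del: vec.scale_left_diff_distrib)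
    qed
    from quadratic_three_roots[OF rst this] show ?thesis by blast
  qed
  have RR: "R x = 0" if "R \<in> {R0, R1, R2}" for R x
    using polyfun_domain[of R "disc p"] polyfun_disc R that z ne by (metis empty_iff insert_iff mult_eq_0_iff)
  have "G x = F x * S x" for x using eq RR[of R0 x] RR[of R1 x] RR[of R2 x] by simp
  with S that show ?thesis by blast
qed

text \<open>If every line in direction \<open>p\<close> had a multiple root, then
  \<open>4 * b ^ 3 = - c\<^sup>2\<close> on the hyperplane \<open>T p p y = 0\<close>, with
  \<open>b y = T p y y\<close> and \<open>c y = F y\<close>. This forces
  \<open>b = - m\<^sup>2\<close> with \<open>m\<close> linear and \<open>c\<close> to be plus or
  minus \<open>2 * m ^ 3\<close>, and the cubic splits.\<close>

lemma disc_nonzero: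
  assumes p: "F p = 1" and irr: "\<not> linear_factor"
  shows "\<exists>x. disc p x \<noteq> 0"
proof (rule ccontr)
  assume "\<not> ?thesis"
  then have disc0: "4 * T p (proj p x) (proj p x) ^ 3 + (F (proj p x))\<^sup>2 = 0" for x
    by (simp add: disc_def)
  have disc0': "4 * T p y y ^ 3 + (F y)\<^sup>2 = 0" if "T p p y = 0" for y
    using disc0[of y] proj_id[OF that] by simp
  have isotropic: "T p y z = 0" if y: "T p p y = 0" and z: "T p p z = 0" and y0: "T p y y = 0" for y z
  proof -
    \<comment> \<open>The discriminant identity at \<open>y + e *s z\<close> as a polynomial in
      \<open>e\<close>, with \<open>T p y y = 0\<close> inserted. Its coefficients of
      \<open>e ^ 0\<close>, \<open>e ^ 2\<close> and \<open>e ^ 3\<close> give in turn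
      \<open>F y = 0\<close>, \<open>T y y z = 0\<close> and \<open>T p y z = 0\<close>.\<close>
    define P where "P = [: (F y)\<^sup>2, 6 * F y * T y y z, 9 * (T y y z)\<^sup>2 + 6 * F y * T y z z,
      32 * T p y z ^ 3 + 2 * F y * F z + 18 * T y y z * T y z z,
      48 * (T p y z)\<^sup>2 * T p z z + 9 * (T y z z)\<^sup>2 + 6 * T y y z * F z,
      24 * T p y z * (T p z z)\<^sup>2 + 6 * T y z z * F z, 4 * T p z z ^ 3 + (F z)\<^sup>2 :]"
    have "poly P e = 0" for e
    proof -
      have "T p p (y + e *s z) = 0" using y z by (simp add: T_simps)
      from disc0'[OF this] have "4 * T p (y + e *s z) (y + e *s z) ^ 3 + (F (y + e *s z))\<^sup>2 = 0" .
      moreover have "T p (y + e *s z) (y + e *s z) = 2 * e * T p y z + e\<^sup>2 * T p z z"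
        using y0 comm23[of p y z] by (simp add: T_simps algebra_simps power2_eq_square)
      ultimately show ?thesis
        unfolding F_line P_def by simp algebra
    qed
    then have "P = 0" using poly_all_0_iff_0 by blast
    then have e: "(F y)\<^sup>2 = 0" "9 * (T y y z)\<^sup>2 + 6 * F y * T y z z = 0"
      "32 * T p y z ^ 3 + 2 * F y * F z + 18 * T y y z * T y z z = 0" by (auto simp: P_def)
    from e(1) have "F y = 0" by simp
    with e(2) have "T y y z = 0" by simp
    with e(3) \<open>F y = 0\<close> show ?thesis by simp
  qed
  \<comment> \<open>The form has rank at most one: if \<open>T p z z\<close> is nonzero, some
    \<open>y + s *s z\<close> is isotropic, hence orthogonal to \<open>z\<close> by
    \<open>isotropic\<close>, and this makes \<open>r\<close> vanish.\<close>
  have sq: "(T p y z)\<^sup>2 = T p y y * T p z z" if y: "T p p y = 0" and z: "T p p z = 0" for y z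
  proof (cases "T p z z = 0")
    case True
    from isotropic[OF z y True] show ?thesis using True by (simp add: comm23)
  next
    case False
    obtain r where r: "r\<^sup>2 = (T p y z)\<^sup>2 - T p y y * T p z z" using alg_closed_sqrt .
    define s where "s = (- T p y z + r) / T p z z"
    have "T p (y + s *s z) (y + s *s z) = T p y y + 2 * s * T p y z + s\<^sup>2 * T p z z"
      using comm23[of p y z] by (simp add: T_simps algebra_simps power2_eq_square)
    also have "\<dots> = 0"
    proof -
      have "T p z z * s = - T p y z + r" using False by (simp add: s_def)
      then have "T p z z * (T p y y + 2 * s * T p y z + s\<^sup>2 * T p z z) = 0" using r by algebra
      then show ?thesis using False by simp
    qed
    finally have *: "T p (y + s *s z) (y + s *s z) = 0" .
    have "T p (y + s *s z) z = 0"
      by (rule isotropic[OF _ z *]) (simp add: T_simps y z)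
    then have "r = 0" using False by (simp add: T_simps s_def)
    then show ?thesis using r by simp
  qed
  show False
  proof (cases "\<forall>x. T p (proj p x) (proj p x) = 0")
    case True
    then have "F x = T p p x * (T p p x)\<^sup>2" for x
      using disc0[of x] F_proj[OF p, of x] by (simp add: power2_eq_square power3_eq_cube)
    then have linear_factor
      unfolding linear_factor_def
      by (intro exI[of _ "\<lambda>x. T p p x"] exI[of _ "\<lambda>x. (T p p x)\<^sup>2"])
        (auto intro!: pf_intros lfun3 simp: T_simps)
    with irr show False ..
  next
    case False
    then obtain z where z: "T p p z = 0" "T p z z \<noteq> 0" using tau_proj[OF p] by blast
    obtain \<mu> where \<mu>: "\<mu>\<^sup>2 = - T p z z" using alg_closed_sqrt .
    with z have \<mu>0: "\<mu> \<noteq> 0" by auto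
    define m where "m x = T p (proj p x) z / \<mu>" for x
    have m2: "T p (proj p x) (proj p x) = - (m x)\<^sup>2" for x
    proof -
      have "T p (proj p x) (proj p x) * T p z z = (T p (proj p x) z)\<^sup>2"
        using sq[OF tau_proj[OF p] z(1), of x] by simp
      also have "\<dots> = (m x * \<mu>)\<^sup>2" using \<mu>0 by (simp add: m_def)
      also have "\<dots> = - (m x)\<^sup>2 * T p z z" using \<mu> by (simp add: power_mult_distrib)
      finally have "(T p (proj p x) (proj p x) + (m x)\<^sup>2) * T p z z = 0" by (simp add: ring_distribs)
      then show ?thesis using z(2) by (simp add: eq_neg_iff_add_eq_0)
    qed
    have lm: "lfun m"
      by (rule lfunI) (simp_all add: m_def proj_def T_simps add_divide_distrib diff_divide_distrib algebra_simps)
    have "(F (proj p x) - 2 * m x ^ 3) * (F (proj p x) + 2 * m x ^ 3) = 0" for x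
      using disc0[of x] unfolding m2 by algebra
    then have "(\<forall>x. F (proj p x) - 2 * m x ^ 3 = 0) \<or> (\<forall>x. F (proj p x) + 2 * m x ^ 3 = 0)"
      by (intro polyfun_domain pf_intros polyfun_lfun[OF lm])
    then obtain \<epsilon> where \<epsilon>: "\<epsilon>\<^sup>2 = 1" "\<And>x. F (proj p x) = 2 * \<epsilon> * m x ^ 3"
    proof
      assume "\<forall>x. F (proj p x) - 2 * m x ^ 3 = 0"
      then show ?thesis by (intro that[of 1]) simp_all
    next
      assume "\<forall>x. F (proj p x) + 2 * m x ^ 3 = 0"
      then show ?thesis by (intro that[of "-1"]) (simp_all add: eq_neg_iff_add_eq_0)
    qed
    have "F x = (T p p x + 2 * \<epsilon> * m x) * (T p p x - \<epsilon> * m x)\<^sup>2" for x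
      using F_proj[OF p, of x] \<epsilon>(1) unfolding \<epsilon>(2) m2 by algebra
    moreover have "lfun (\<lambda>x. T p p x + 2 * \<epsilon> * m x)"
      by (rule lfunI) (simp_all add: lfun_simps[OF lm] T_simps algebra_simps)
    moreover have "polyfun (\<lambda>x. (T p p x - \<epsilon> * m x)\<^sup>2)"
      by (intro pf_intros polyfun_lfun[OF lm])
    moreover have "(T p p 0 - \<epsilon> * m 0)\<^sup>2 = 0" by (simp add: lfun_simps[OF lm] T_simps)
    ultimately have linear_factor unfolding linear_factor_def by blast
    with irr show False ..
  qed
qed

end

section \<open>Cubics with Hessian vanishing only on the hypersurface\<close>

lemma det_scale:
  fixes A :: "'a::comm_ring_1 ^ 'n::finite ^ 'n"
  shows "det (\<chi> i j. t * A $ i $ j) = t ^ CARD('n) * det A"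
  by (simp add: det_def prod.distrib sum_distrib_left mult_ac)

lemma indep5_coords:
  assumes ind: "indep5 a b c d e"
  obtains k1 k2 k3 k4 k5 where "lfun k1" "lfun k2" "lfun k3" "lfun k4" "lfun k5"
    "\<And>x. x = k1 x *s a + k2 x *s b + k3 x *s c + k4 x *s d + k5 x *s e"
proof -
  have "\<forall>x. \<exists>k. x = k 1 *s a + k 2 *s b + k 3 *s c + k 4 *s d + k (5::nat) *s e"
  proof
    fix x
    obtain r s t u v where "x = r *s a + s *s b + t *s c + u *s d + v *s e"
      using indep5_expand[OF ind] .
    then show "\<exists>k. x = k 1 *s a + k 2 *s b + k 3 *s c + k 4 *s d + k (5::nat) *s e"
      by (intro exI[of _ "\<lambda>n. if n = 1 then r else if n = 2 then s else if n = 3 then t else if n = 4 then u else v"]) simp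
  qed
  then obtain k where k: "\<And>x. x = k x 1 *s a + k x 2 *s b + k x 3 *s c + k x 4 *s d + k x (5::nat) *s e"
    by metis
  have add: "k (x + y) n = k x n + k y n" if "n \<in> {1, 2, 3, 4, 5}" for x y n
  proof -
    have "(k (x + y) 1 - k x 1 - k y 1) *s a + (k (x + y) 2 - k x 2 - k y 2) *s b +
      (k (x + y) 3 - k x 3 - k y 3) *s c + (k (x + y) 4 - k x 4 - k y 4) *s d +
      (k (x + y) 5 - k x 5 - k y 5) *s e =
      (k (x + y) 1 *s a + k (x + y) 2 *s b + k (x + y) 3 *s c + k (x + y) 4 *s d + k (x + y) 5 *s e) -
      (k x 1 *s a + k x 2 *s b + k x 3 *s c + k x 4 *s d + k x 5 *s e) -
      (k y 1 *s a + k y 2 *s b + k y 3 *s c + k y 4 *s d + k y 5 *s e)"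
      by (simp add: vec.scale_left_diff_distrib)
    also have "\<dots> = 0" by (simp only: k[symmetric]) simp
    finally show ?thesis using indep5D[OF ind]
      using that by (fastforce simp: algebra_simps)
  qed
  have scale: "k (r *s x) n = r * k x n" if "n \<in> {1, 2, 3, 4, 5}" for x r n
  proof -
    have "(k (r *s x) 1 - r * k x 1) *s a + (k (r *s x) 2 - r * k x 2) *s b +
      (k (r *s x) 3 - r * k x 3) *s c + (k (r *s x) 4 - r * k x 4) *s d +
      (k (r *s x) 5 - r * k x 5) *s e =
      (k (r *s x) 1 *s a + k (r *s x) 2 *s b + k (r *s x) 3 *s c + k (r *s x) 4 *s d + k (r *s x) 5 *s e) -
      r *s (k x 1 *s a + k x 2 *s b + k x 3 *s c + k x 4 *s d + k x 5 *s e)"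
      by (simp add: vec.scale_left_diff_distrib vec.scale_right_distrib)
    also have "\<dots> = 0" by (simp only: k[symmetric]) simp
    finally show ?thesis using indep5D[OF ind]
      using that by fastforce
  qed
  show ?thesis
    by (rule that[of "\<lambda>x. k x 1" "\<lambda>x. k x 2" "\<lambda>x. k x 3" "\<lambda>x. k x 4" "\<lambda>x. k x 5"])
      (simp_all only: lfun_def, auto simp: add scale simp del: One_nat_def, rule k)
qed

context sym_trilinear
begin

lemma T_perm:
  assumes "T a b c = k"
  shows "T a b c = k" "T a c b = k" "T b a c = k" "T b c a = k" "T c a b = k" "T c b a = k"
  using assms comm12 comm23 by metis+

lemma det_hess_scale: "det (hess (t *s x)) = t ^ CARD('n) * det (hess x)"
proof -
  have "hess (t *s x) = (\<chi> i j. t * hess x $ i $ j)"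
    by (simp add: hess_def T_simps vec_eq_iff)
  then show ?thesis by (simp only: det_scale)
qed

text \<open>If the derivative \<open>3 * T x x p\<close> in direction \<open>p\<close> vanished as
  well, \<open>x\<close> would be a double root on its line.\<close>

lemma disc_nonzero_smooth:
  assumes "F p = 1" "F x = 0" "disc p x \<noteq> 0"
  shows "T x x p \<noteq> 0"
proof
  assume z: "T x x p = 0"
  define y where "y = proj p x"
  define \<tau> where "\<tau> = T p p x"
  have x: "x = y + \<tau> *s p" by (simp add: y_def \<tau>_def proj_def)
  have t: "T p p y = 0" using tau_proj[OF assms(1)] by (simp add: y_def)
  have "T x x p = T p y y + \<tau>\<^sup>2"
    unfolding x using T_perm[OF t] comm12[of p y y] comm23[of y p y] assms(1)
    by (simp add: T_simps power2_eq_square)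
  with z have B: "T p y y = - \<tau>\<^sup>2" by (simp add: eq_neg_iff_add_eq_0)
  have "F x = \<tau> ^ 3 + 3 * T p y y * \<tau> + F y"
    using F_proj[OF assms(1), of x] by (simp add: y_def \<tau>_def)
  with assms(2) B have "F y = 2 * \<tau> ^ 3" by algebra
  then have "disc p x = 0" unfolding disc_def y_def[symmetric] using B by algebra
  with assms(3) show False ..
qed

text \<open>At a general point of the hypersurface the derivative of the Hessian determinant is a nonzero
  multiple of the derivative of \<open>F\<close>.\<close>

lemma generic_kernel:
  assumes small: "CARD('n) < 6"
    and p: "F p = 1" and irr: "\<not> linear_factor"
    and van: "\<And>x. F x = 0 \<Longrightarrow> det (hess x) = 0"
    and ne: "det (hess y) \<noteq> 0"
  obtains x v c where "v \<noteq> 0" "\<And>w. T x v w = 0" "c \<noteq> 0" "\<And>w. T v v w = c * T x x w"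
    "T x x p \<noteq> 0" "\<And>u. \<forall>w. T x u w = 0 \<Longrightarrow> u \<in> vec.span {v}"
proof -
  note ndisc = disc_nonzero[OF p irr]
  obtain S where S: "polyfun S" and DS: "\<And>x. det (hess x) = F x * S x"
    using vanishing_imp_multiple[OF p ndisc polyfun_det_hess van] by blast
  \<comment> \<open>If \<open>S\<close> vanished at all general points of the hypersurface, the
    Hessian determinant would be divisible by the square of \<open>F\<close>. On the ray through
    \<open>y\<close> this means a factor \<open>t ^ 6\<close>, but there the determinant is a
    nonzero multiple of \<open>t ^ CARD('n)\<close>.\<close>
  obtain x where x: "F x = 0" "disc p x \<noteq> 0" "S x \<noteq> 0"
  proof (rule ccontr)
    assume "\<not> thesis"
    then have "\<And>x. F x = 0 \<Longrightarrow> disc p x \<noteq> 0 \<Longrightarrow> S x = 0" using that by blast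
    from vanishing_imp_multiple[OF p ndisc S this]
    obtain S2 where S2: "polyfun S2" "\<And>x. S x = F x * S2 x" by blast
    obtain q where q: "\<And>t. S2 (t *s y) = poly q t" using polyfun_line0[OF S2(1)] by blast
    have "poly (monom (det (hess y)) CARD('n)) t = poly (monom ((F y)\<^sup>2) 6 * q) t" for t
    proof -
      have "t ^ CARD('n) * det (hess y) = F (t *s y) * (F (t *s y) * S2 (t *s y))"
        using DS[of "t *s y"] S2(2) det_hess_scale by metis
      also have "F (t *s y) = t ^ 3 * F y" by (simp add: T_simps power3_eq_cube)
      finally show ?thesis by (simp add: q poly_monom power2_eq_square algebra_simps flip: power_add)
    qed
    then have "monom (det (hess y)) CARD('n) = monom ((F y)\<^sup>2) 6 * q"
      using poly_eq_poly_eq_iff by blast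
    then have "coeff (monom (det (hess y)) CARD('n)) CARD('n) = coeff (monom ((F y)\<^sup>2) 6 * q) CARD('n)"
      by simp
    then show False using small ne by (simp add: coeff_monom_mult)
  qed
  have smooth: "T x x p \<noteq> 0" by (rule disc_nonzero_smooth[OF p x(1,2)])
  \<comment> \<open>The terms linear in \<open>t\<close> of the Hessian determinant and of
    \<open>F * S\<close> along \<open>x + t *s w\<close> are compared. As \<open>S x\<close> and
    \<open>T x x p\<close> are nonzero, so is \<open>\<kappa>\<close>.\<close>
  have key: "\<exists>c. c \<noteq> 0 \<and> (\<forall>w. T v v w = c * T x x w)" if v: "v \<noteq> 0" "\<And>w. T x v w = 0" for v
  proof -
    have ker: "hess x *v v = 0" using v hess_kernel by blast
    obtain \<kappa> where \<kappa>: "\<And>B. \<exists>p. \<forall>t. det (pencil (hess x) B t) =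
        t * (\<kappa> * (\<Sum>i\<in>UNIV. v $ i * (B *v v) $ i)) + t\<^sup>2 * poly p t"
      using det_pencil_kernel[OF transpose_hess ker v(1)] by metis
    have eq: "\<kappa> * T v v w = 3 * S x * T x x w" for w
    proof -
      obtain q where q: "\<And>t. det (pencil (hess x) (hess w) t) = t * (\<kappa> * T w v v) + t\<^sup>2 * poly q t"
        using \<kappa>[of "hess w"] unfolding hess_pair by blast
      obtain s where s: "\<And>t. S (x + t *s w) = poly s t" using polyfun_line[OF S] by blast
      have "poly ([:0, \<kappa> * T w v v:] + [:0, 0, 1:] * q) t =
          poly ([: 0, 3 * T x x w, 3 * T x w w, F w :] * s) t" for t
        using DS[of "x + t *s w"] q[of t] s[of t] x(1) unfolding hess_line F_line
        by (simp add: algebra_simps power2_eq_square power3_eq_cube)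
      then have "[:0, \<kappa> * T w v v:] + [:0, 0, 1:] * q = [: 0, 3 * T x x w, 3 * T x w w, F w :] * s"
        using poly_eq_poly_eq_iff by blast
      then have "coeff ([:0, \<kappa> * T w v v:] + [:0, 0, 1:] * q) 1 =
          coeff ([: 0, 3 * T x x w, 3 * T x w w, F w :] * s) 1" by simp
      then have "\<kappa> * T w v v = 3 * T x x w * poly s 0"
        by (simp add: coeff_mult poly_0_coeff_0)
      moreover have "poly s 0 = S x" using s[of 0] by simp
      moreover have "T w v v = T v v w" by (metis comm12 comm23)
      ultimately show ?thesis by (simp add: mult_ac)
    qed
    have "\<kappa> \<noteq> 0" using eq[of p] x(3) smooth by auto
    then have "T v v w = 3 * S x / \<kappa> * T x x w" for w
      using eq[of w] by (simp add: field_simps)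
    then show ?thesis using x(3) \<open>\<kappa> \<noteq> 0\<close> by (intro exI[of _ "3 * S x / \<kappa>"]) auto
  qed
  have "det (hess x) = 0" using van x(1) .
  then obtain v where v: "v \<noteq> 0" "\<And>w. T x v w = 0" using det_hess_0_iff by blast
  obtain c where c: "c \<noteq> 0" "\<And>w. T v v w = c * T x x w" using key[OF v] by blast
  \<comment> \<open>With two independent kernel vectors \<open>u\<close> and \<open>v\<close>, the
    quadratic equation \<open>T (u + s *s v) (u + s *s v) p = 0\<close> has a solution
    \<open>s\<close>; by \<open>key\<close> and \<open>T x x p \<noteq> 0\<close> this is
    impossible.\<close>
  have one_dim: "u \<in> vec.span {v}" if u: "\<forall>w. T x u w = 0" for u
  proof (rule ccontr)
    assume nu: "u \<notin> vec.span {v}"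
    let ?a = "T v v p"
    have a: "?a \<noteq> 0" using c smooth by simp
    obtain r where r: "r\<^sup>2 = (T u v p)\<^sup>2 - ?a * T u u p" using alg_closed_sqrt .
    define s where "s = (- T u v p + r) / ?a"
    have nz: "u + s *s v \<noteq> 0"
    proof
      assume "u + s *s v = 0"
      then have "u = (- s) *s v" by (simp add: eq_neg_iff_add_eq_0)
      then have "u \<in> vec.span {v}" by (metis vec.span_base vec.span_scale singletonI)
      then show False using nu by simp
    qed
    have "T (u + s *s v) (u + s *s v) p = T u u p + 2 * s * T u v p + s\<^sup>2 * ?a"
      using comm12[of v u] by (simp add: T_simps algebra_simps power2_eq_square)
    also have "\<dots> = 0"
    proof -
      have "?a * s = - T u v p + r" using a by (simp add: s_def)
      then have "?a * (T u u p + 2 * s * T u v p + s\<^sup>2 * ?a) = 0" using r by algebra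
      then show ?thesis using a by simp
    qed
    finally have "T (u + s *s v) (u + s *s v) p = 0" .
    moreover have "T x (u + s *s v) w = 0" for w using u v by (simp add: T_simps)
    ultimately show False using key[OF nz] smooth by auto
  qed
  show ?thesis by (rule that[OF v c smooth one_dim])
qed

text \<open>The mixed term \<open>T x v _\<close> vanishes, so
  \<open>T (x + s *s v) (x + s *s v) _\<close> is \<open>(1 + s\<^sup>2 * c) * T x x _\<close>. The
  two solutions of \<open>1 + s\<^sup>2 * c = 0\<close> give the singular points, with
  \<open>x\<close> as half their sum and \<open>v\<close> along their difference.\<close>

lemma secant_pair:
  assumes "CARD('n) < 6" "F p = 1" "\<not> linear_factor"
    and "\<And>x. F x = 0 \<Longrightarrow> det (hess x) = 0"
    and "det (hess y) \<noteq> 0"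
  obtains P Q where "\<And>w. T P P w = 0" "\<And>w. T Q Q w = 0" "T P Q p \<noteq> 0"
    "\<And>u. \<forall>w. T (P + Q) u w = 0 \<Longrightarrow> u \<in> vec.span {P - Q}"
proof -
  obtain x v c where v: "v \<noteq> 0" "\<And>w. T x v w = 0" and c: "c \<noteq> 0" "\<And>w. T v v w = c * T x x w"
    and smooth: "T x x p \<noteq> 0" and ker: "\<And>u. \<forall>w. T x u w = 0 \<Longrightarrow> u \<in> vec.span {v}"
    by (rule generic_kernel[OF assms(1-3) _ assms(5)], erule assms(4)) (rule that)
  obtain s where s: "s\<^sup>2 = - 1 / c" using alg_closed_sqrt .
  then have s0: "s \<noteq> 0" using c(1) by auto
  have sc: "s * s * c = - 1" using s c(1) by (simp add: field_simps power2_eq_square)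
  show ?thesis
  proof (rule that[of "x + s *s v" "x - s *s v"])
    show "T (x + s *s v) (x + s *s v) w = 0" for w
    proof -
      have "T (x + s *s v) (x + s *s v) w = T x x w + s * s * T v v w"
        using v(2)[of w] comm12[of v x w] by (simp add: T_simps algebra_simps)
      also have "\<dots> = (1 + s * s * c) * T x x w" using c(2) by (simp add: algebra_simps)
      finally show ?thesis using sc by simp
    qed
    show "T (x - s *s v) (x - s *s v) w = 0" for w
    proof -
      have "T (x - s *s v) (x - s *s v) w = T x x w + s * s * T v v w"
        using v(2)[of w] comm12[of v x w] by (simp add: T_simps algebra_simps)
      also have "\<dots> = (1 + s * s * c) * T x x w" using c(2) by (simp add: algebra_simps)
      finally show ?thesis using sc by simp
    qed
    have "T (x + s *s v) (x - s *s v) p = T x x p - s * s * T v v p"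
      using v(2)[of p] comm12[of v x p] by (simp add: T_simps algebra_simps)
    also have "\<dots> = (1 - s * s * c) * T x x p" using c(2) by (simp add: algebra_simps)
    finally show "T (x + s *s v) (x - s *s v) p \<noteq> 0" using sc smooth by simp
    show "u \<in> vec.span {x + s *s v - (x - s *s v)}" if u: "\<forall>w. T (x + s *s v + (x - s *s v)) u w = 0" for u
    proof -
      have "T x u w = 0" for w
      proof -
        have "x + s *s v + (x - s *s v) = 2 *s x" by (simp add: vec_eq_iff)
        then have "T (x + s *s v + (x - s *s v)) u w = 2 * T x u w" by (simp only: scale1)
        then show ?thesis using u by simp
      qed
      then obtain k where "u = k *s v" using ker by (auto simp: vec.span_singleton)
      then have "u = (k / (2 * s)) *s (x + s *s v - (x - s *s v))"
        using s0 by (simp add: vec_eq_iff field_simps)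
      then show ?thesis by (metis vec.span_base vec.span_scale singletonI)
    qed
  qed
qed

end

text \<open>The determinant of the symmetric matrix with diagonal \<open>a, b, c\<close> and entries
  \<open>d, e, f\<close> in positions 12, 13, 23; this is the order of the Veronese
  coordinates.\<close>

definition det3 :: "'a::comm_ring_1 \<Rightarrow> 'a \<Rightarrow> 'a \<Rightarrow> 'a \<Rightarrow> 'a \<Rightarrow> 'a \<Rightarrow> 'a" where
  "det3 a b c d e f = a * b * c + 2 * d * e * f - a * f\<^sup>2 - b * e\<^sup>2 - c * d\<^sup>2"

definition (in sym_trilinear) determinantal :: bool where
  "determinantal \<longleftrightarrow> (\<exists>m1 m2 m3 m4 m5 m6. lfun m1 \<and> lfun m2 \<and> lfun m3 \<and> lfun m4 \<and> lfun m5 \<and> lfun m6 \<and>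
     (\<forall>x. F x = det3 (m1 x) (m2 x) (m3 x) (m4 x) (m5 x) (m6 x)))"

text \<open>Cancellation of a nonzero polynomial in two variables, which are encoded as the first
  two coordinates of a vector to fit \<open>polyfun\<close>.\<close>

lemma polyfun_poly2:
  "polyfun (\<lambda>x :: 'a::field_char_0 ^ 5. f (x $ 1) (x $ 2)) \<Longrightarrow> polyfun (\<lambda>x :: 'a ^ 5. g (x $ 1) (x $ 2)) \<Longrightarrow>
   (\<And>a b. f a b * g a b = 0) \<Longrightarrow> f a0 b0 \<noteq> 0 \<Longrightarrow> g a b = 0"
proof -
  assume f: "polyfun (\<lambda>x :: 'a ^ 5. f (x $ 1) (x $ 2))" and g: "polyfun (\<lambda>x :: 'a ^ 5. g (x $ 1) (x $ 2))"
    and z: "\<And>a b. f a b * g a b = 0" and ne: "f a0 b0 \<noteq> 0"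
  define pt :: "'a \<Rightarrow> 'a \<Rightarrow> 'a ^ 5" where "pt a b = (\<chi> i. if i = 1 then a else b)" for a b
  have pt: "pt a b $ 1 = a" "pt a b $ 2 = b" for a b
    by (simp_all add: pt_def)
  have "(\<forall>x :: 'a ^ 5. f (x $ 1) (x $ 2) = 0) \<or> (\<forall>x :: 'a ^ 5. g (x $ 1) (x $ 2) = 0)"
    by (rule polyfun_domain[OF f g]) (rule z)
  moreover have "f (pt a0 b0 $ (1::5)) (pt a0 b0 $ (2::5)) \<noteq> 0" using ne pt by metis
  ultimately have "g (pt a b $ (1::5)) (pt a b $ (2::5)) = 0" by metis
  then show ?thesis using pt by metis
qed

section \<open>Frames adapted to two singular points\<close>

text \<open>The hypersurface is the secant variety of its singular locus: \<open>P\<close> and \<open>Q\<close> are general points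
  of the singular locus.\<close>

locale secant_frame = sym_trilinear T
  for T :: "'a::{alg_closed_field, field_char_0} ^ 5 \<Rightarrow> 'a ^ 5 \<Rightarrow> 'a ^ 5 \<Rightarrow> 'a" +
  fixes P Q E g1 g2
  assumes PP: "T P P w = 0" and QQ: "T Q Q w = 0" and PQE: "T P Q E = 1 / 2"
    and PEE: "T P E E = 0" and QEE: "T Q E E = 0"
    and PQg: "T P Q g1 = 0" "T P Q g2 = 0"
    and PEg: "T P E g1 = 0" "T P E g2 = 0"
    and QEg: "T Q E g1 = 0" "T Q E g2 = 0"
    and basis: "indep5 P Q E g1 g2"
    and ker_PQ: "\<forall>w. T (P + Q) u w = 0 \<Longrightarrow> u \<in> vec.span {P - Q}"
    and van: "F x = 0 \<Longrightarrow> det (hess x) = 0"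
    and irr: "\<not> linear_factor"
begin

definition inW :: "'a ^ 5 \<Rightarrow> bool" where
  "inW w \<longleftrightarrow> (\<exists>a b. w = a *s g1 + b *s g2)"

lemma inW_g: "inW g1" "inW g2"
  unfolding inW_def by (rule exI[of _ 1], rule exI[of _ 0], simp)
    (rule exI[of _ 0], rule exI[of _ 1], simp)

lemma inW_add: "inW x \<Longrightarrow> inW y \<Longrightarrow> inW (x + y)"
  unfolding inW_def
  by (elim exE, rename_tac a a' b b', rule_tac x = "a + a'" in exI, rule_tac x = "b + b'" in exI)
    (simp add: vec.scale_left_distrib)

lemma inW_scale: "inW x \<Longrightarrow> inW (c *s x)"
  unfolding inW_def by (metis vec.scale_right_distrib vec.scale_scale)

lemma inW_diff: "inW x \<Longrightarrow> inW y \<Longrightarrow> inW (x - y)"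
  using inW_add[of x "(-1) *s y"] inW_scale[of y "-1"] by simp

lemma W_zero:
  assumes "inW w"
  shows "T P Q w = 0" "T P E w = 0" "T Q E w = 0"
  using assms by (auto simp: inW_def T_simps PQg PEg QEg)

lemmas frame_simps = T_perm[OF PP] T_perm[OF QQ] T_perm[OF PQE] T_perm[OF PEE] T_perm[OF QEE]

text \<open>As \<open>P\<close> and \<open>Q\<close> are singular points, \<open>F\<close> has
  degree at most one in \<open>r\<close> and in \<open>s\<close>; the other conditions on the frame
  remove all terms in \<open>r\<close> or \<open>s\<close> except those shown.\<close>

lemma F_frame:
  assumes "inW w"
  shows "F (r *s P + s *s Q + t *s E + w) =
    3 * (r * s * t + r * T P w w + s * T Q w w) + F (t *s E + w)"
  using comm12[of w P w] comm23[of w w P] comm12[of w Q w] comm23[of w w Q]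
  by (simp add: T_simps frame_simps T_perm[OF W_zero(1)[OF assms]] T_perm[OF W_zero(2)[OF assms]]
    T_perm[OF W_zero(3)[OF assms]]) (simp add: algebra_simps)

text \<open>For \<open>t = 1\<close> the formula of \<open>F_frame\<close> completes to a product: a
  third of \<open>F\<close> is \<open>(r + T Q w w) * (s + T P w w) - h w\<close>. Over a fixed
  \<open>w\<close> the hypersurface is thus a hyperbola, degenerate where
  \<open>h w = 0\<close>.\<close>

definition h :: "'a ^ 5 \<Rightarrow> 'a" where
  "h w = T P w w * T Q w w - F (E + w) / 3"

text \<open>\<open>h1\<close> is the derivative of \<open>h\<close>, and \<open>h2\<close> is half of the second derivative.\<close>

definition h1 :: "'a ^ 5 \<Rightarrow> 'a ^ 5 \<Rightarrow> 'a" where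
  "h1 w z = 2 * T P w z * T Q w w + 2 * T P w w * T Q w z - T (E + w) (E + w) z"

definition h2 :: "'a ^ 5 \<Rightarrow> 'a ^ 5 \<Rightarrow> 'a ^ 5 \<Rightarrow> 'a" where
  "h2 w y z = T P y z * T Q w w + 2 * T P w y * T Q w z + 2 * T P w z * T Q w y + T P w w * T Q y z - T (E + w) y z"

text \<open>The hyperbola over \<open>w\<close> is parametrized by \<open>u = r + T Q w w\<close>,
  the other factor being \<open>h w / u\<close>. The Hessian has a kernel vector at each of its
  points; eliminating the components along \<open>P\<close>, \<open>Q\<close> and
  \<open>E + w\<close> leaves a nonzero vector \<open>z\<close> in the plane of \<open>g1\<close>
  and \<open>g2\<close>, in the kernel of a symmetric form that depends on \<open>u\<close>
  explicitly.\<close>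

lemma degenerate:
  assumes w: "inW w" and h0: "h w \<noteq> 0" and u: "u \<noteq> 0"
  obtains z where "inW z" "z \<noteq> 0"
    "\<And>\<omega>. inW \<omega> \<Longrightarrow> u * T P z \<omega> + h w / u * T Q z \<omega> + (h1 w z * h1 w \<omega> / (4 * h w) - h2 w z \<omega>) = 0"
proof -
  define k where "k = h w / u"
  have ku: "k * u = h w" using u by (simp add: k_def)
  define r where "r = u - T Q w w"
  define s where "s = k - T P w w"
  define y where "y = r *s P + s *s Q + 1 *s E + w"
  have "F y = 0"
  proof -
    have "3 * (k * u) = 3 * (T P w w * T Q w w) - F (E + w)"
      unfolding ku h_def by (simp add: field_simps)
    then show ?thesis unfolding y_def F_frame[OF w] r_def s_def by simp algebra
  qed
  then have "det (hess y) = 0" by (rule van)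
  then obtain x where x: "x \<noteq> 0" "\<And>w. T y x w = 0" using det_hess_0_iff by blast
  obtain a b c d e where "x = a *s P + b *s Q + c *s E + d *s g1 + e *s g2"
    using indep5_expand[OF basis] .
  then obtain z0 where xz: "x = a *s P + b *s Q + c *s E + z0" and z0: "inW z0"
    by (auto simp: inW_def add.assoc)
  \<comment> \<open>The kernel vector is rewritten with \<open>E + w\<close> in place of
    \<open>E\<close>; this makes its coefficient \<open>c\<close> a multiple of
    \<open>h1 w z\<close>.\<close>
  define z where "z = z0 - c *s w"
  have z: "inW z" unfolding z_def by (intro inW_diff inW_scale z0 w)
  have z0z: "z0 = z + c *s w" by (simp add: z_def)
  note W0 = W_zero[OF w] W_zero[OF z]
  note ws = frame_simps T_perm[OF W0(1)] T_perm[OF W0(2)] T_perm[OF W0(3)]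
     T_perm[OF W0(4)] T_perm[OF W0(5)] T_perm[OF W0(6)]
  have eP: "s * c + b + 2 * (T P w z + c * T P w w) = 0"
  proof -
    have "T y x P = s * c / 2 + b / 2 + T P w z + c * T P w w"
      using T_perm[of P w z, OF refl] T_perm[of P w w, OF refl]
      unfolding y_def xz z0z by (simp add: T_simps ws)
    with x(2)[of P] show ?thesis by (simp add: field_simps)
  qed
  have eQ: "r * c + a + 2 * (T Q w z + c * T Q w w) = 0"
  proof -
    have "T y x Q = r * c / 2 + a / 2 + T Q w z + c * T Q w w"
      using T_perm[of Q w z, OF refl] T_perm[of Q w w, OF refl]
      unfolding y_def xz z0z by (simp add: T_simps ws)
    with x(2)[of Q] show ?thesis by (simp add: field_simps)
  qed
  have eE: "(r * b + s * a) / 2 + c * F E + T E E z + 2 * c * T E E w + T E w z + c * T E w w = 0"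
  proof -
    have "T y x E = (r * b + s * a) / 2 + c * F E + T E E z + 2 * c * T E E w + T E w z + c * T E w w"
      using T_perm[of E E w, OF refl] T_perm[of E E z, OF refl] T_perm[of E w z, OF refl]
        T_perm[of E w w, OF refl]
      unfolding y_def xz z0z by (simp add: T_simps ws field_simps)
    with x(2)[of E] show ?thesis by simp
  qed
  have eW: "r * (T P z \<omega> + c * T P w \<omega>) + s * (T Q z \<omega> + c * T Q w \<omega>) + a * T P w \<omega> + b * T Q w \<omega> +
      c * T E E \<omega> + 2 * c * T E w \<omega> + T E z \<omega> + T w z \<omega> + c * T w w \<omega> = 0" if om: "inW \<omega>" for \<omega>
  proof -
    note W1 = W_zero[OF om]
    have "T y x \<omega> = r * (T P z \<omega> + c * T P w \<omega>) + s * (T Q z \<omega> + c * T Q w \<omega>) + a * T P w \<omega> + b * T Q w \<omega> +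
      c * T E E \<omega> + 2 * c * T E w \<omega> + T E z \<omega> + T w z \<omega> + c * T w w \<omega>"
      using comm12[of w P \<omega>] comm12[of w Q \<omega>] comm12[of w E \<omega>]
      unfolding y_def xz z0z
      by (simp add: T_simps ws T_perm[OF W1(1)] T_perm[OF W1(2)] T_perm[OF W1(3)] algebra_simps)
    with x(2)[of \<omega>] show ?thesis by simp
  qed
  have hw: "3 * h w = 3 * T P w w * T Q w w - (F E + 3 * T E E w + 3 * T E w w + F w)"
    using T_perm[of E E w, OF refl] T_perm[of E w w, OF refl] by (simp add: h_def T_simps field_simps)
  have h1: "h1 w \<omega> = 2 * T P w \<omega> * T Q w w + 2 * T P w w * T Q w \<omega> - T E E \<omega> - 2 * T E w \<omega> - T w w \<omega>" for \<omega>
    using comm12[of w E \<omega>] by (simp add: h1_def T_simps)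
  have h2: "h2 w z \<omega> = T P z \<omega> * T Q w w + 2 * T P w z * T Q w \<omega> + 2 * T P w \<omega> * T Q w z + T P w w * T Q z \<omega> -
     T E z \<omega> - T w z \<omega>" for \<omega>
    by (simp add: h2_def T_simps)
  \<comment> \<open>The kernel equation paired with \<open>E + w\<close>, that is \<open>eE\<close>
    plus \<open>eW\<close> at \<open>w\<close>, after \<open>a\<close> and \<open>b\<close> are
    eliminated by \<open>eP\<close> and \<open>eQ\<close>.\<close>
  have c: "4 * c * h w + h1 w z = 0"
  proof -
    have "6 * (4 * c * h w + h1 w z) = 0"
      using eP eQ eE eW[OF w] ku hw h1[of z] comm12[of w z w] comm23[of w z w] comm23[of P w z] comm23[of Q w z]
        comm23[of E w z]
      unfolding r_def s_def
      by (simp add: field_simps) algebra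
    then show ?thesis by (simp only: mult_eq_0_iff) simp
  qed
  show ?thesis
  proof (rule that[OF z])
    show "z \<noteq> 0"
    proof
      assume z00: "z = 0"
      then have "h1 w z = 0" by (simp add: h1_def T_simps)
      with c h0 have c0: "c = 0" by simp
      with eP eQ z00 have "a = 0" "b = 0" by (simp_all add: T_simps)
      with c0 z00 z0z xz x(1) show False by simp
    qed
    fix \<omega> assume om: "inW \<omega>"
    have "- (c * h1 w \<omega>) + u * T P z \<omega> + k * T Q z \<omega> - h2 w z \<omega> = 0"
      using eW[OF om] eP eQ h1[of \<omega>] h2[of \<omega>] unfolding r_def s_def by algebra
    moreover have "- (c * h1 w \<omega>) = h1 w z * h1 w \<omega> / (4 * h w)"
    proof -
      have "c = - h1 w z / (4 * h w)" using c h0 by (simp add: field_simps add_eq_0_iff)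
      then show ?thesis by simp
    qed
    ultimately show "u * T P z \<omega> + h w / u * T Q z \<omega> + (h1 w z * h1 w \<omega> / (4 * h w) - h2 w z \<omega>) = 0"
      unfolding k_def[symmetric] by (simp add: algebra_simps)
  qed
qed

definition G :: "'a ^ 5 \<Rightarrow> 'a ^ 5 \<Rightarrow> 'a ^ 5 \<Rightarrow> 'a" where
  "G w y z = h1 w y * h1 w z / (4 * h w) - h2 w y z"

lemma G_sym: "G w y z = G w z y"
  using comm23[of P y z] comm23[of Q y z] comm23[of "E + w" y z]
  by (simp add: G_def h2_def algebra_simps)

text \<open>The form of \<open>degenerate\<close> is singular for all nonzero \<open>u\<close>, so
  the determinant of \<open>u\<close> times its matrix is the zero polynomial in \<open>u\<close>.
  The equations are its coefficients of \<open>u ^ 4\<close>, \<open>u ^ 3\<close>, \<open>u\<close>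
  and 1, divided by powers of \<open>h w\<close>.\<close>

lemma degenerate_coeffs:
  assumes w: "inW w" and h0: "h w \<noteq> 0"
  shows "T P g1 g1 * T P g2 g2 = (T P g1 g2)\<^sup>2"
    and "T P g1 g1 * G w g2 g2 + G w g1 g1 * T P g2 g2 = 2 * T P g1 g2 * G w g1 g2"
    and "T Q g1 g1 * G w g2 g2 + G w g1 g1 * T Q g2 g2 = 2 * T Q g1 g2 * G w g1 g2"
    and "T Q g1 g1 * T Q g2 g2 = (T Q g1 g2)\<^sup>2"
proof -
  let ?p1 = "T P g1 g1" and ?p2 = "T P g1 g2" and ?p3 = "T P g2 g2"
  let ?q1 = "T Q g1 g1" and ?q2 = "T Q g1 g2" and ?q3 = "T Q g2 g2"
  let ?G1 = "G w g1 g1" and ?G2 = "G w g1 g2" and ?G3 = "G w g2 g2"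
  define R1 where "R1 = [: h w * ?q1, ?G1, ?p1 :]"
  define R2 where "R2 = [: h w * ?q2, ?G2, ?p2 :]"
  define R3 where "R3 = [: h w * ?q3, ?G3, ?p3 :]"
  have "poly (R1 * R3 - R2 * R2) u = 0" if u: "u \<noteq> 0" for u
  proof -
    obtain z where z: "inW z" "z \<noteq> 0" and
      M: "\<And>\<omega>. inW \<omega> \<Longrightarrow> u * T P z \<omega> + h w / u * T Q z \<omega> + G w z \<omega> = 0"
      using degenerate[OF w h0 u] unfolding G_def by blast
    obtain a b where ab: "z = a *s g1 + b *s g2" using z(1) unfolding inW_def by blast
    have Glin: "G w z \<omega> = a * G w g1 \<omega> + b * G w g2 \<omega>" for \<omega>
    proof -
      have "h1 w z = a * h1 w g1 + b * h1 w g2"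
        by (simp add: ab h1_def lfun_simps[OF lfun3] algebra_simps)
      moreover have "h2 w z \<omega> = a * h2 w g1 \<omega> + b * h2 w g2 \<omega>"
        by (simp add: ab h2_def lfun_simps[OF lfun2] lfun_simps[OF lfun3] algebra_simps)
      ultimately show ?thesis by (simp add: G_def add_divide_distrib algebra_simps)
    qed
    have M': "a * poly (if \<omega> = g1 then R1 else R2) u + b * poly (if \<omega> = g1 then R2 else R3) u = 0"
      if "\<omega> \<in> {g1, g2}" "\<omega> = g1 \<or> g1 \<noteq> g2" for \<omega>
    proof -
      have "u * (u * T P z \<omega> + h w / u * T Q z \<omega> + G w z \<omega>) = 0"
        using M[of \<omega>] that inW_g by auto
      then have "u * u * T P z \<omega> + h w * T Q z \<omega> + u * G w z \<omega> = 0"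
        using u by (simp add: algebra_simps)
      then show ?thesis
        using that comm23[of P g1 g2] comm23[of Q g1 g2] G_sym[of w g1 g2] unfolding Glin
        by (auto simp: R1_def R2_def R3_def ab T_simps algebra_simps)
    qed
    have "g1 \<noteq> g2"
    proof
      assume "g1 = g2"
      then have "0 *s P + 0 *s Q + 0 *s E + 1 *s g1 + (-1) *s g2 = 0" by simp
      from indep5D[OF basis this] show False by simp
    qed
    then have e: "a * poly R1 u + b * poly R2 u = 0" "a * poly R2 u + b * poly R3 u = 0"
      using M'[of g1] M'[of g2] by auto
    have "a \<noteq> 0 \<or> b \<noteq> 0" using z(2) ab by auto
    moreover have "a * (poly R1 u * poly R3 u - poly R2 u * poly R2 u) = 0" using e by algebra
    moreover have "b * (poly R1 u * poly R3 u - poly R2 u * poly R2 u) = 0" using e by algebra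
    ultimately show ?thesis by auto
  qed
  then have "R1 * R3 - R2 * R2 = 0" by (rule poly_zero_off_0)
  moreover have "R1 * R3 - R2 * R2 = [: (h w)\<^sup>2 * (?q1 * ?q3 - ?q2\<^sup>2), h w * (?q1 * ?G3 + ?G1 * ?q3 - 2 * ?q2 * ?G2),
     h w * (?q1 * ?p3 + ?q3 * ?p1 - 2 * ?p2 * ?q2) + ?G1 * ?G3 - ?G2\<^sup>2,
     ?p1 * ?G3 + ?G1 * ?p3 - 2 * ?p2 * ?G2, ?p1 * ?p3 - ?p2\<^sup>2 :]"
    by (simp add: R1_def R2_def R3_def algebra_simps power2_eq_square)
  ultimately show "?p1 * ?p3 = ?p2\<^sup>2" "?p1 * ?G3 + ?G1 * ?p3 = 2 * ?p2 * ?G2"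
    "?q1 * ?G3 + ?G1 * ?q3 = 2 * ?q2 * ?G2" "?q1 * ?q3 = ?q2\<^sup>2"
    using h0 by auto
qed

text \<open>If \<open>h\<close> vanished on the plane, so would its homogeneous parts. The quartic
  part makes one of the two quadratic forms zero, the others remove \<open>F (t *s E + w)\<close>,
  and then \<open>F\<close> is divisible by a coordinate.\<close>

lemma h_nonzero: "\<exists>w. inW w \<and> h w \<noteq> 0"
proof (rule ccontr)
  assume "\<not> ?thesis"
  then have h0: "h w = 0" if "inW w" for w using that by blast
  have z: "T P w w * T Q w w = 0 \<and> F (t *s E + w) = 0" if w: "inW w" for w t
  proof -
    have "poly [: F E, 3 * T E E w, 3 * T E w w, F w, - 3 * (T P w w * T Q w w) :] t = 0" for t
      using h0[OF inW_scale[OF w, of t]] T_perm[of E E w, OF refl] T_perm[of E w w, OF refl]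
      by (simp add: h_def T_simps field_simps)
    then have "[: F E, 3 * T E E w, 3 * T E w w, F w, - 3 * (T P w w * T Q w w) :] = 0"
      using poly_all_0_iff_0 by blast
    then have "F E = 0" "T E E w = 0" "T E w w = 0" "F w = 0" "T P w w * T Q w w = 0"
      by auto
    then show ?thesis using T_perm[of E E w] T_perm[of E w w] by (simp add: T_simps)
  qed
  obtain k1 k2 k3 k4 k5 where k: "lfun k1" "lfun k2" "lfun k3" "lfun k4" "lfun k5"
    and ex: "\<And>x. x = k1 x *s P + k2 x *s Q + k3 x *s E + k4 x *s g1 + k5 x *s g2"
    using indep5_coords[OF basis] by blast
  define \<rho> where "\<rho> x = k4 x *s g1 + k5 x *s g2" for x
  have \<rho>: "inW (\<rho> x)" for x unfolding \<rho>_def inW_def by blast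
  note pk = k[THEN polyfun_lfun]
  have p\<rho>: "polyfun (\<lambda>x. \<rho> x $ i)" for i
    unfolding \<rho>_def vector_add_component vector_smult_component by (intro pf_intros pk)
  have F: "F x = 3 * (k1 x * k2 x * k3 x + k1 x * T P (\<rho> x) (\<rho> x) + k2 x * T Q (\<rho> x) (\<rho> x))" for x
  proof -
    have "x = k1 x *s P + k2 x *s Q + k3 x *s E + \<rho> x" using ex[of x] by (simp add: \<rho>_def add.assoc)
    then have "F x = F (k1 x *s P + k2 x *s Q + k3 x *s E + \<rho> x)" by simp
    then show ?thesis unfolding F_frame[OF \<rho>] using z[OF \<rho>] by simp
  qed
  have "(\<forall>x. T P (\<rho> x) (\<rho> x) = 0) \<or> (\<forall>x. T Q (\<rho> x) (\<rho> x) = 0)"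
    by (rule polyfun_domain) (use z[OF \<rho>] in \<open>auto intro!: pf_intros p\<rho>\<close>)
  then have linear_factor
  proof
    assume *: "\<forall>x. T P (\<rho> x) (\<rho> x) = 0"
    show ?thesis unfolding linear_factor_def
    proof (rule exI[of _ k2], rule exI[of _ "\<lambda>x. 3 * (k1 x * k3 x + T Q (\<rho> x) (\<rho> x))"], intro conjI allI k)
      show "polyfun (\<lambda>x. 3 * (k1 x * k3 x + T Q (\<rho> x) (\<rho> x)))" by (intro pf_intros p\<rho> pk)
    qed (use * F k in \<open>simp_all add: \<rho>_def lfun_simps T_simps algebra_simps\<close>)
  next
    assume *: "\<forall>x. T Q (\<rho> x) (\<rho> x) = 0"
    show ?thesis unfolding linear_factor_def
    proof (rule exI[of _ k1], rule exI[of _ "\<lambda>x. 3 * (k2 x * k3 x + T P (\<rho> x) (\<rho> x))"], intro conjI allI k)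
      show "polyfun (\<lambda>x. 3 * (k2 x * k3 x + T P (\<rho> x) (\<rho> x)))" by (intro pf_intros p\<rho> pk)
    qed (use * F k in \<open>simp_all add: \<rho>_def lfun_simps T_simps algebra_simps\<close>)
  qed
  with irr show False ..
qed

end

lemma polyfun_divide: "polyfun f \<Longrightarrow> polyfun (\<lambda>x. f x / c)"
  unfolding divide_inverse by (intro pf_intros)

lemma (in sym_trilinear) determinantalI:
  assumes "lfun m1" "lfun m2" "lfun m3" "lfun m4" "lfun m5" "lfun m6"
    "\<And>x. F x = det3 (m1 x) (m2 x) (m3 x) (m4 x) (m5 x) (m6 x)"
  shows determinantal
  unfolding determinantal_def using assms by blast

context secant_frame
begin

lemma indep5_W:
  assumes "inW a" "inW b" "\<And>u v. u *s a + v *s b = 0 \<Longrightarrow> u = 0 \<and> v = 0"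
  shows "indep5 P Q E a b"
  unfolding indep5_def
proof (intro allI impI)
  fix r s t u v
  assume eq: "r *s P + s *s Q + t *s E + u *s a + v *s b = 0"
  have "inW (u *s a + v *s b)" by (intro inW_add inW_scale assms)
  then obtain x y where xy: "u *s a + v *s b = x *s g1 + y *s g2" unfolding inW_def by blast
  with eq have "r *s P + s *s Q + t *s E + x *s g1 + y *s g2 = 0" by (simp add: add.assoc)
  from indep5D[OF basis this] have z: "r = 0" "s = 0" "t = 0" "u *s a + v *s b = 0" using xy by auto
  with assms(3)[OF z(4)] show "r = 0 \<and> s = 0 \<and> t = 0 \<and> u = 0 \<and> v = 0" by simp
qed

text \<open>A radical vector would lie in the kernel of the Hessian at \<open>P + Q\<close>, which
  is contained in the span of \<open>P - Q\<close> and meets the plane of \<open>g1\<close> and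
  \<open>g2\<close> only in 0.\<close>

lemma P_plus_Q_nondegenerate:
  assumes "inW z" "z \<noteq> 0"
  shows "\<exists>\<omega>. inW \<omega> \<and> T P z \<omega> + T Q z \<omega> \<noteq> 0"
proof (rule ccontr)
  assume "\<not> ?thesis"
  then have *: "T P z \<omega> + T Q z \<omega> = 0" if "inW \<omega>" for \<omega> using that by blast
  have "T (P + Q) z w = 0" for w
  proof -
    obtain r s t u v where w: "w = r *s P + s *s Q + t *s E + u *s g1 + v *s g2"
      using indep5_expand[OF basis] .
    show ?thesis
      using *[OF inW_g(1)] *[OF inW_g(2)] T_perm[OF W_zero(1)[OF assms(1)]] T_perm[OF W_zero(2)[OF assms(1)]]
         T_perm[OF W_zero(3)[OF assms(1)]]
      by (simp add: w T_simps frame_simps flip: distrib_left)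
  qed
  then have "z \<in> vec.span {P - Q}" using ker_PQ by blast
  then obtain k where k: "z = k *s (P - Q)" by (auto simp: vec.span_singleton)
  obtain a b where "z = a *s g1 + b *s g2" using assms(1) unfolding inW_def by blast
  with k have "k *s P + (- k) *s Q + 0 *s E + (- a) *s g1 + (- b) *s g2 = 0"
    by (simp add: vec.scale_right_diff_distrib) (simp add: algebra_simps)
  from indep5D[OF basis this] k assms(2) show False by simp
qed

lemma radical_vector:
  assumes "T R g1 g1 * T R g2 g2 = (T R g1 g2)\<^sup>2"
  obtains e where "inW e" "e \<noteq> 0" "\<And>\<omega>. inW \<omega> \<Longrightarrow> T R e \<omega> = 0"
proof -
  have ind: "a = 0 \<and> b = 0" if "a *s g1 + b *s g2 = 0" for a b
    using indep5D[OF basis, of 0 0 0 a b] that by simp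
  have W: "inW (a *s g1 + b *s g2)" for a b unfolding inW_def by blast
  show ?thesis
  proof (cases "T R g1 g1 = 0 \<and> T R g1 g2 = 0")
    case True
    show ?thesis
    proof (rule that[of "1 *s g1 + 0 *s g2"])
      show "1 *s g1 + 0 *s g2 \<noteq> 0" using ind[of 1 0] by auto
      show "T R (1 *s g1 + 0 *s g2) \<omega> = 0" if "inW \<omega>" for \<omega>
        using that True by (auto simp: inW_def T_simps)
    qed (rule W)
  next
    case False
    let ?e = "T R g1 g2 *s g1 + (- T R g1 g1) *s g2"
    show ?thesis
    proof (rule that[of ?e])
      show "?e \<noteq> 0" using ind[of "T R g1 g2" "- T R g1 g1"] False by auto
      show "T R ?e \<omega> = 0" if "inW \<omega>" for \<omega>
        using that assms comm23[of R g1 g2] by (auto simp: inW_def T_simps power2_eq_square algebra_simps)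
    qed (rule W)
  qed
qed

end

section \<open>Normal form of the two quadratic forms and the determinant\<close>

locale normal_frame = secant_frame +
  assumes P_values: "T P g1 g1 = 0" "T P g1 g2 = 0" "T P g2 g2 = - 1"
    and Q_values: "T Q g1 g1 = - 1" "T Q g1 g2 = 0" "T Q g2 g2 = 0"

text \<open>Both quadratic forms are degenerate on the plane while their sum is not. So their
  radical vectors \<open>e\<close> and \<open>f\<close> are independent, and each form is nonzero on
  the radical vector of the other. The values are scaled to -1 to fit the signs in
  \<open>det3\<close>.\<close>

lemma (in secant_frame) normal_frame_exists:
  obtains g1' g2' where "normal_frame T P Q E g1' g2'"
proof -
  obtain w where w: "inW w" "h w \<noteq> 0" using h_nonzero by blast
  obtain e where e: "inW e" "e \<noteq> 0" and eP: "\<And>\<omega>. inW \<omega> \<Longrightarrow> T P e \<omega> = 0"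
    using radical_vector[OF degenerate_coeffs(1)[OF w]] by blast
  obtain f where f: "inW f" "f \<noteq> 0" and fQ: "\<And>\<omega>. inW \<omega> \<Longrightarrow> T Q f \<omega> = 0"
    using radical_vector[OF degenerate_coeffs(4)[OF w]] by blast
  have ef: "u = 0 \<and> v = 0" if uv: "u *s e + v *s f = 0" for u v
  proof -
    have "u = 0"
    proof (rule ccontr)
      assume "u \<noteq> 0"
      obtain \<omega> where om: "inW \<omega>" "T P e \<omega> + T Q e \<omega> \<noteq> 0"
        using P_plus_Q_nondegenerate[OF e] by blast
      have "u * T Q e \<omega> + v * T Q f \<omega> = T Q (u *s e + v *s f) \<omega>" by (simp add: T_simps)
      then have "u * T Q e \<omega> = 0" using uv fQ[OF om(1)] by (simp add: T_simps)
      with \<open>u \<noteq> 0\<close> om eP show False by simp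
    qed
    with uv f(2) show ?thesis by simp
  qed
  have span: "\<exists>a b. \<omega> = a *s e + b *s f" if om: "inW \<omega>" for \<omega>
  proof -
    obtain r s t a b where "\<omega> = r *s P + s *s Q + t *s E + a *s e + b *s f"
      using indep5_expand[OF indep5_W[OF e(1) f(1) ef]] .
    moreover obtain x y where xy: "\<omega> - (a *s e + b *s f) = x *s g1 + y *s g2"
      using inW_diff[OF om inW_add[OF inW_scale[OF e(1)] inW_scale[OF f(1)]]] unfolding inW_def by blast
    ultimately have "r *s P + s *s Q + t *s E + (- x) *s g1 + (- y) *s g2 = 0"
      by (simp add: algebra_simps)
    from indep5D[OF basis this] xy have "\<omega> = a *s e + b *s f" by simp
    then show ?thesis by blast
  qed
  have ee: "T Q e e \<noteq> 0"
  proof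
    assume z: "T Q e e = 0"
    obtain \<omega> where om: "inW \<omega>" "T P e \<omega> + T Q e \<omega> \<noteq> 0"
      using P_plus_Q_nondegenerate[OF e] by blast
    obtain a b where "\<omega> = a *s e + b *s f" using span[OF om(1)] by blast
    then show False using om(2) eP[OF om(1)] z fQ[OF e(1)] comm23[of Q e f] by (simp add: T_simps)
  qed
  have ff: "T P f f \<noteq> 0"
  proof
    assume z: "T P f f = 0"
    obtain \<omega> where om: "inW \<omega>" "T P f \<omega> + T Q f \<omega> \<noteq> 0"
      using P_plus_Q_nondegenerate[OF f] by blast
    obtain a b where "\<omega> = a *s e + b *s f" using span[OF om(1)] by blast
    then show False using om(2) fQ[OF om(1)] z eP[OF f(1)] comm23[of P e f] by (simp add: T_simps)
  qed
  obtain \<sigma> where s: "\<sigma>\<^sup>2 = - 1 / T Q e e" using alg_closed_sqrt .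
  obtain \<tau> where t: "\<tau>\<^sup>2 = - 1 / T P f f" using alg_closed_sqrt .
  have st: "\<sigma> \<noteq> 0" "\<tau> \<noteq> 0" using s t ee ff by auto
  have We: "inW (\<sigma> *s e)" and Wf: "inW (\<tau> *s f)" by (intro inW_scale e f)+
  have "normal_frame T P Q E (\<sigma> *s e) (\<tau> *s f)"
  proof
    show "indep5 P Q E (\<sigma> *s e) (\<tau> *s f)"
    proof (rule indep5_W[OF We Wf])
      fix u v assume "u *s (\<sigma> *s e) + v *s (\<tau> *s f) = 0"
      with ef[of "u * \<sigma>" "v * \<tau>"] st show "u = 0 \<and> v = 0" by simp
    qed
    show "T Q (\<sigma> *s e) (\<sigma> *s e) = - 1" "T P (\<tau> *s f) (\<tau> *s f) = - 1"
      using s t ee ff by (simp_all add: T_simps power2_eq_square field_simps)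
    show "T P (\<sigma> *s e) (\<sigma> *s e) = 0" "T P (\<sigma> *s e) (\<tau> *s f) = 0"
      "T Q (\<sigma> *s e) (\<tau> *s f) = 0" "T Q (\<tau> *s f) (\<tau> *s f) = 0"
      using eP[OF e(1)] eP[OF f(1)] fQ[OF e(1)] fQ[OF f(1)] comm23[of Q e f] by (simp_all add: T_simps)
  qed (use PP QQ PQE PEE QEE W_zero[OF We] W_zero[OF Wf] ker_PQ van irr in auto)
  then show ?thesis by (rule that)
qed

text \<open>The hypothesis is \<open>4 * h * h2 = h1\<^sup>2\<close> for the derivatives in
  \<open>a\<close>. The coefficient of \<open>a ^ 4\<close> gives \<open>c111 = 0\<close>, so
  \<open>h\<close> is quadratic in \<open>a\<close>; the coefficient of \<open>a ^ 0\<close> says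
  that its discriminant vanishes, and comparing powers of \<open>b\<close> gives the rest.\<close>

lemma square_coefficients:
  fixes e0 :: "'a::field_char_0"
  assumes eq: "\<And>a b. 4 * (a\<^sup>2 * b\<^sup>2 - e0 / 3 - e1 * a - e2 * b - f11 * a\<^sup>2 - 2 * f12 * a * b - f22 * b\<^sup>2
      - c111 * a ^ 3 / 3 - c112 * a\<^sup>2 * b - c122 * a * b\<^sup>2 - c222 * b ^ 3 / 3) *
      (b\<^sup>2 - f11 - c111 * a - c112 * b) =
    (2 * a * b\<^sup>2 - e1 - 2 * f11 * a - 2 * f12 * b - c111 * a\<^sup>2 - 2 * c112 * a * b - c122 * b\<^sup>2)\<^sup>2"
  shows "c111 = 0" "c222 = 0" "4 * f22 = - (c122\<^sup>2)" "e2 = f22 * c112 - f12 * c122"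
    "4 * e0 = 12 * e2 * c112 + 12 * f22 * f11 - 12 * f12\<^sup>2 - 6 * e1 * c122"
proof -
  define d0 d1 d2 where d_def: "d0 = e0 / 3" "d1 = c111 / 3" "d2 = c222 / 3"
  have d: "e0 = 3 * d0" "c111 = 3 * d1" "c222 = 3 * d2" by (simp_all add: d_def)
  have p: "smult 4 ([: - d0 - e2 * b - f22 * b\<^sup>2 - d2 * b ^ 3, - (e1 + 2 * f12 * b + c122 * b\<^sup>2),
      b\<^sup>2 - f11 - c112 * b, - d1 :] * [: b\<^sup>2 - f11 - c112 * b, - 3 * d1 :]) -
    [: - (e1 + 2 * f12 * b + c122 * b\<^sup>2), 2 * (b\<^sup>2 - f11 - c112 * b), - 3 * d1 :] ^ 2 = 0" (is "?p b = 0") for b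
  proof -
    have "poly (?p b) a = 0" for a
      using eq[of a b] unfolding d by (simp add: algebra_simps power2_eq_square power3_eq_cube)
    then show ?thesis using poly_all_0_iff_0 by blast
  qed
  have "coeff (?p 0) 4 = 0" unfolding p by simp
  then have "d1 * d1 = 0" by (simp add: power2_eq_square numeral_eq_Suc)
  then show "c111 = 0" by (simp add: d)
  have q0: "4 * (- d0 - e2 * b - f22 * b\<^sup>2 - d2 * b ^ 3) * (b\<^sup>2 - f11 - c112 * b) -
      (e1 + 2 * f12 * b + c122 * b\<^sup>2)\<^sup>2 = 0" for b
  proof -
    have "coeff (?p b) 0 = 0" unfolding p by simp
    then show ?thesis by (simp add: power2_eq_square algebra_simps)
  qed
  let ?q = "smult 4 ([: - d0, - e2, - f22, - d2 :] * [: - f11, - c112, 1 :]) - [: e1, 2 * f12, c122 :] ^ 2"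
  have "poly ?q b = 0" for b
    using q0[of b] by (simp add: algebra_simps power2_eq_square power3_eq_cube)
  then have q: "?q = 0" using poly_all_0_iff_0 by blast
  have c5: "coeff ?q 5 = 0" and c4: "coeff ?q 4 = 0" and c3: "coeff ?q 3 = 0" and c2: "coeff ?q 2 = 0"
    unfolding q by simp_all
  have c222: "d2 = 0" using c5 by (simp add: power2_eq_square numeral_eq_Suc)
  then show "c222 = 0" by (simp add: d)
  show f22: "4 * f22 = - (c122\<^sup>2)" using c4 c222
    by (simp add: power2_eq_square numeral_eq_Suc add_eq_0_iff eq_neg_iff_add_eq_0)
  have "4 * e2 = 4 * (f22 * c112 - f12 * c122)" using c3 c222
    by (simp add: power2_eq_square numeral_eq_Suc algebra_simps)
  then show "e2 = f22 * c112 - f12 * c122" by (simp only: mult_cancel_left) simp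
  have "4 * d0 = 4 * c112 * e2 + 4 * f11 * f22 - 4 * f12\<^sup>2 - 2 * c122 * e1" using c2 c222
    by (simp add: power2_eq_square numeral_eq_Suc algebra_simps)
  then show "4 * e0 = 12 * e2 * c112 + 12 * f22 * f11 - 12 * f12\<^sup>2 - 6 * e1 * c122"
    unfolding d by algebra
qed

context normal_frame
begin

definition pt :: "'a \<Rightarrow> 'a \<Rightarrow> 'a ^ 5" where
  "pt a b = a *s g1 + b *s g2"

lemma inW_pt: "inW (pt a b)"
  unfolding pt_def inW_def by blast

abbreviation (input) "e0 \<equiv> F E"
abbreviation (input) "e1 \<equiv> T E E g1"
abbreviation (input) "e2 \<equiv> T E E g2"
abbreviation (input) "f11 \<equiv> T E g1 g1"
abbreviation (input) "f12 \<equiv> T E g1 g2"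
abbreviation (input) "f22 \<equiv> T E g2 g2"
abbreviation (input) "c111 \<equiv> F g1"
abbreviation (input) "c112 \<equiv> T g1 g1 g2"
abbreviation (input) "c122 \<equiv> T g1 g2 g2"
abbreviation (input) "c222 \<equiv> F g2"

lemmas c_perms = T_perm[of E E g1, OF refl] T_perm[of E E g2, OF refl] T_perm[of E g1 g1, OF refl]
  T_perm[of E g1 g2, OF refl] T_perm[of E g2 g2, OF refl] T_perm[of g1 g1 g2, OF refl]
  T_perm[of g1 g2 g2, OF refl]

lemmas value_simps = T_perm[OF P_values(1)] T_perm[OF P_values(2)] T_perm[OF P_values(3)]
  T_perm[OF Q_values(1)] T_perm[OF Q_values(2)] T_perm[OF Q_values(3)]

lemma F_E_pt: "F (t *s E + pt a b) = e0 * t ^ 3 + 3 * t\<^sup>2 * (e1 * a + e2 * b)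
    + 3 * t * (f11 * a\<^sup>2 + 2 * f12 * a * b + f22 * b\<^sup>2)
    + c111 * a ^ 3 + 3 * c112 * a\<^sup>2 * b + 3 * c122 * a * b\<^sup>2 + c222 * b ^ 3"
  unfolding pt_def using c_perms by (simp add: T_simps) (simp add: algebra_simps power2_eq_square power3_eq_cube)

lemma h_pt: "h (pt a b) = a\<^sup>2 * b\<^sup>2 - e0 / 3 - e1 * a - e2 * b - f11 * a\<^sup>2 - 2 * f12 * a * b - f22 * b\<^sup>2
      - c111 * a ^ 3 / 3 - c112 * a\<^sup>2 * b - c122 * a * b\<^sup>2 - c222 * b ^ 3 / 3"
proof -
  have "T P (pt a b) (pt a b) = - (b\<^sup>2)" "T Q (pt a b) (pt a b) = - (a\<^sup>2)"
    unfolding pt_def by (simp_all add: T_simps value_simps power2_eq_square)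
  then show ?thesis
    unfolding h_def using F_E_pt[of 1 a b] by (simp add: field_simps)
qed

lemma h1_pt:
  "h1 (pt a b) g1 = 2 * a * b\<^sup>2 - e1 - 2 * f11 * a - 2 * f12 * b - c111 * a\<^sup>2 - 2 * c112 * a * b - c122 * b\<^sup>2"
  "h1 (pt a b) g2 = 2 * a\<^sup>2 * b - e2 - 2 * f22 * b - 2 * f12 * a - c222 * b\<^sup>2 - 2 * c122 * a * b - c112 * a\<^sup>2"
  unfolding h1_def pt_def using c_perms
  by (simp_all add: T_simps value_simps) (simp_all add: algebra_simps power2_eq_square)

lemma h2_pt:
  "h2 (pt a b) g1 g1 = b\<^sup>2 - f11 - c111 * a - c112 * b"
  "h2 (pt a b) g2 g2 = a\<^sup>2 - f22 - c222 * b - c122 * a"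
  unfolding h2_def pt_def using c_perms
  by (simp_all add: T_simps value_simps) (simp_all add: algebra_simps power2_eq_square)

text \<open>In the normal frame the mixed equations of \<open>degenerate_coeffs\<close> reduce to
  \<open>G w i i = 0\<close> where \<open>h w\<close> is nonzero; cancelling the nonzero polynomial
  \<open>h\<close> extends the identity to all points.\<close>

lemma square_law:
  assumes "i \<in> {g1, g2}"
  shows "4 * h (pt a b) * h2 (pt a b) i i = (h1 (pt a b) i)\<^sup>2"
proof -
  have *: "h (pt a b) * (4 * h (pt a b) * h2 (pt a b) i i - (h1 (pt a b) i)\<^sup>2) = 0" for a b
  proof (cases "h (pt a b) = 0")
    case False
    have "G (pt a b) g1 g1 = 0" "G (pt a b) g2 g2 = 0"
      using degenerate_coeffs(2)[OF inW_pt False] degenerate_coeffs(3)[OF inW_pt False]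
      by (simp_all add: P_values Q_values)
    then have "G (pt a b) i i = 0" using assms by auto
    then show ?thesis using False by (simp add: G_def field_simps power2_eq_square)
  qed simp
  obtain w where w: "inW w" "h w \<noteq> 0" using h_nonzero by blast
  then obtain a0 b0 where ab: "h (pt a0 b0) \<noteq> 0" unfolding inW_def pt_def by blast
  have "4 * h (pt a b) * h2 (pt a b) i i - (h1 (pt a b) i)\<^sup>2 = 0"
  proof (rule polyfun_poly2[where f = "\<lambda>a b. h (pt a b)" and a = a and b = b and a0 = a0 and b0 = b0 and
        g = "\<lambda>a b. 4 * h (pt a b) * h2 (pt a b) i i - (h1 (pt a b) i)\<^sup>2", OF _ _ * ab])
    show "polyfun (\<lambda>x. h (pt (x $ 1) (x $ 2)))" unfolding h_pt by (intro pf_intros polyfun_divide)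
    show "polyfun (\<lambda>x. 4 * h (pt (x $ 1) (x $ 2)) * h2 (pt (x $ 1) (x $ 2)) i i - (h1 (pt (x $ 1) (x $ 2)) i)\<^sup>2)"
      using assms
    proof (elim insertE emptyE)
      assume i: "i = g1"
      show ?thesis unfolding i h_pt h1_pt h2_pt by (intro pf_intros polyfun_divide)
    next
      assume i: "i = g2"
      show ?thesis unfolding i h_pt h1_pt h2_pt by (intro pf_intros polyfun_divide)
    qed
  qed
  then show ?thesis by simp
qed

lemma determinantal: determinantal
proof -
  have "4 * (a\<^sup>2 * b\<^sup>2 - e0 / 3 - e1 * a - e2 * b - f11 * a\<^sup>2 - 2 * f12 * a * b - f22 * b\<^sup>2
      - c111 * a ^ 3 / 3 - c112 * a\<^sup>2 * b - c122 * a * b\<^sup>2 - c222 * b ^ 3 / 3) *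
      (b\<^sup>2 - f11 - c111 * a - c112 * b) =
    (2 * a * b\<^sup>2 - e1 - 2 * f11 * a - 2 * f12 * b - c111 * a\<^sup>2 - 2 * c112 * a * b - c122 * b\<^sup>2)\<^sup>2" for a b
    using square_law[of g1 a b] unfolding h_pt h1_pt h2_pt by simp
  note A = square_coefficients[of e0 e1 e2 f11 f12 f22 c111 c112 c122 c222, OF this]
  have "4 * (a\<^sup>2 * b\<^sup>2 - e0 / 3 - e2 * a - e1 * b - f22 * a\<^sup>2 - 2 * f12 * a * b - f11 * b\<^sup>2
      - c222 * a ^ 3 / 3 - c122 * a\<^sup>2 * b - c112 * a * b\<^sup>2 - c111 * b ^ 3 / 3) *
      (b\<^sup>2 - f22 - c222 * a - c122 * b) =
    (2 * a * b\<^sup>2 - e2 - 2 * f22 * a - 2 * f12 * b - c222 * a\<^sup>2 - 2 * c122 * a * b - c112 * b\<^sup>2)\<^sup>2" for a b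
    using square_law[of g2 b a] unfolding h_pt h1_pt h2_pt by (simp add: algebra_simps)
  note B = square_coefficients[of e0 e2 e1 f22 f12 f11 c222 c122 c112 c111, OF this]
  \<comment> \<open>With these constants the equations for the coefficients say
    \<open>h (pt a b) = (a * b - l)\<^sup>2\<close>, where
    \<open>l = \<alpha> * a + \<gamma> * b + \<beta>\<close>.\<close>
  define \<alpha> where "\<alpha> = c112 / 2"
  define \<gamma> where "\<gamma> = c122 / 2"
  define \<beta> where "\<beta> = f12 + \<alpha> * \<gamma>"
  have c: "c112 = 2 * \<alpha>" "c122 = 2 * \<gamma>" "f12 = \<beta> - \<alpha> * \<gamma>" by (simp_all add: \<alpha>_def \<gamma>_def \<beta>_def)
  have "4 * f11 = 4 * - (\<alpha>\<^sup>2)" "4 * f22 = 4 * - (\<gamma>\<^sup>2)"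
    using A(3) B(3) unfolding c by (simp_all add: power2_eq_square)
  then have f: "f11 = - (\<alpha>\<^sup>2)" "f22 = - (\<gamma>\<^sup>2)" by (simp_all only: mult_cancel_left) simp_all
  have e12: "e1 = - 2 * \<alpha> * \<beta>" "e2 = - 2 * \<gamma> * \<beta>"
    using A(4) B(4) unfolding c f by (simp_all add: power2_eq_square algebra_simps)
  have "4 * e0 = 4 * (- 3 * \<beta>\<^sup>2)"
    using A(5) unfolding c f e12 by (simp add: power2_eq_square algebra_simps)
  then have e0: "e0 = - 3 * \<beta>\<^sup>2" by (simp only: mult_cancel_left) simp
  obtain k1 k2 k3 k4 k5 where k: "lfun k1" "lfun k2" "lfun k3" "lfun k4" "lfun k5"
    and ex: "\<And>x. x = k1 x *s P + k2 x *s Q + k3 x *s E + k4 x *s g1 + k5 x *s g2"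
    using indep5_coords[OF basis] by blast
  define l where "l x = \<alpha> * k4 x + \<gamma> * k5 x + \<beta> * k3 x" for x
  have ll: "lfun l" by (rule lfunI) (simp_all add: l_def lfun_simps k algebra_simps)
  \<comment> \<open>For \<open>k3 x = 1\<close> the equation reads
    \<open>(r - a\<^sup>2) * (s - b\<^sup>2) - (a * b - l)\<^sup>2\<close>. This is the 2 x 2
    determinant that remains of the symmetric matrix with diagonal \<open>r, 1, s\<close> and
    entries \<open>a, l, b\<close> after clearing the row and column of the 1.\<close>
  have F: "F x = 3 * det3 (k1 x) (k3 x) (k2 x) (k4 x) (l x) (k5 x)" for x
  proof -
    have "x = k1 x *s P + k2 x *s Q + k3 x *s E + pt (k4 x) (k5 x)" using ex[of x] by (simp add: pt_def add.assoc)
    then have "F x = F (k1 x *s P + k2 x *s Q + k3 x *s E + pt (k4 x) (k5 x))" by simp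
    also have "\<dots> = 3 * (k1 x * k2 x * k3 x - k1 x * (k5 x)\<^sup>2 - k2 x * (k4 x)\<^sup>2) + F (k3 x *s E + pt (k4 x) (k5 x))"
    proof -
      have "T P (pt (k4 x) (k5 x)) (pt (k4 x) (k5 x)) = - ((k5 x)\<^sup>2)"
        "T Q (pt (k4 x) (k5 x)) (pt (k4 x) (k5 x)) = - ((k4 x)\<^sup>2)"
        unfolding pt_def by (simp_all add: T_simps value_simps power2_eq_square)
      then show ?thesis unfolding F_frame[OF inW_pt] by simp
    qed
    finally show ?thesis
      unfolding F_E_pt A(1,2) c f e12 e0 det3_def l_def
      by (simp add: algebra_simps power2_eq_square power3_eq_cube)
  qed
  \<comment> \<open>A cube root of 3 scales all six entries, because \<open>det3\<close> has degree
    three.\<close>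
  obtain \<kappa> :: 'a where \<kappa>: "\<kappa> ^ 3 = 3" using nth_root_exists[of 3 3] by auto
  have "F x = det3 (\<kappa> * k1 x) (\<kappa> * k3 x) (\<kappa> * k2 x) (\<kappa> * k4 x) (\<kappa> * l x) (\<kappa> * k5 x)" for x
    unfolding F \<kappa>[symmetric] det3_def by (simp add: algebra_simps power2_eq_square power3_eq_cube)
  note F\<kappa> = this
  have sc: "lfun (\<lambda>x. \<kappa> * m x)" if "lfun m" for m
    by (rule lfunI) (simp_all add: lfun_simps[OF that] algebra_simps)
  show ?thesis
    by (rule determinantalI[OF sc[OF k(1)] sc[OF k(3)] sc[OF k(2)] sc[OF k(4)] sc[OF ll] sc[OF k(5)] F\<kappa>])
qed

end

lemma determinantal_if_hessian_nonzero:
  fixes T :: "'a::{alg_closed_field, field_char_0} ^ 5 \<Rightarrow> 'a ^ 5 \<Rightarrow> 'a ^ 5 \<Rightarrow> 'a"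
  assumes "sym_trilinear T"
  assumes p: "T p p p = 1" and irr: "\<not> sym_trilinear.linear_factor T"
    and van: "\<And>x. T x x x = 0 \<Longrightarrow> det (sym_trilinear.hess T x) = 0"
    and ne: "det (sym_trilinear.hess T y) \<noteq> 0"
  shows "sym_trilinear.determinantal T"
proof -
  interpret sym_trilinear T by fact
  have card: "CARD(5) < 6" by simp
  obtain P Q where PP: "\<And>w. T P P w = 0" and QQ: "\<And>w. T Q Q w = 0" and PQp: "T P Q p \<noteq> 0"
    and ker: "\<And>u. \<forall>w. T (P + Q) u w = 0 \<Longrightarrow> u \<in> vec.span {P - Q}"
    by (rule secant_pair[OF card p irr _ ne], erule van) (rule that)
  note pq = T_perm[OF PP] T_perm[OF QQ]
  define E0 where "E0 = (1 / (2 * T P Q p)) *s p"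
  have PQE0: "T P Q E0 = 1 / 2" using PQp by (simp add: E0_def T_simps)
  \<comment> \<open>Since \<open>T P Q E0 = 1 / 2\<close>, subtracting these multiples of
    \<open>P\<close> and \<open>Q\<close> cancels \<open>T Q E E\<close> and \<open>T P E E\<close>
    exactly.\<close>
  define E where "E = E0 + (- T Q E0 E0) *s P + (- T P E0 E0) *s Q"
  have PQE: "T P Q E = 1 / 2" by (simp add: E_def T_simps pq PQE0)
  have PEE: "T P E E = 0"
    unfolding E_def by (simp add: T_simps pq T_perm[OF PQE0])
  have QEE: "T Q E E = 0"
    unfolding E_def by (simp add: T_simps pq T_perm[OF PQE0])
  have P0: "P \<noteq> 0" using PQE by (auto simp: T_simps)
  have Q: "Q \<notin> vec.span {P}"
  proof
    assume "Q \<in> vec.span {P}"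
    then obtain k where "Q = k *s P" by (auto simp: vec.span_singleton)
    then have "T P Q E = 0" by (simp add: T_simps pq)
    with PQE show False by simp
  qed
  have E: "E \<notin> vec.span {P, Q}"
  proof
    assume "E \<in> vec.span {P, Q}"
    then obtain k l where "E = k *s P + l *s Q"
      by (auto simp: vec.span_breakdown_eq vec.span_singleton algebra_simps)
    then have "T P Q E = 0" by (simp add: T_simps pq)
    with PQE show False by simp
  qed
  have "card {P, Q, E} < 5" "finite {P, Q, E}" by (auto simp: card_insert_if)
  then obtain f1 where f1: "f1 \<notin> vec.span {P, Q, E}" using exists_not_in_span by blast
  have "card {P, Q, E, f1} < 5" "finite {P, Q, E, f1}" by (auto simp: card_insert_if)
  then obtain f2 where f2: "f2 \<notin> vec.span {P, Q, E, f1}" using exists_not_in_span by blast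
  have basis0: "indep5 P Q E f1 f2" by (rule indep5I[OF P0 Q E f1 f2])
  \<comment> \<open>Projection to the vectors that pair to zero with \<open>P Q\<close>,
    \<open>P E\<close> and \<open>Q E\<close>; the factors 2 compensate
    \<open>T P Q E = 1 / 2\<close>.\<close>
  define \<rho> where "\<rho> f = f - (2 * T P Q f) *s E - (2 * T P E f) *s Q - (2 * T Q E f) *s P" for f
  have rho: "T P Q (\<rho> f) = 0" "T P E (\<rho> f) = 0" "T Q E (\<rho> f) = 0" for f
    unfolding \<rho>_def by (simp_all add: T_simps pq T_perm[OF PQE] T_perm[OF PEE] T_perm[OF QEE])
  have basis: "indep5 P Q E (\<rho> f1) (\<rho> f2)"
    unfolding indep5_def
  proof (intro allI impI)
    fix r s t u v
    assume "r *s P + s *s Q + t *s E + u *s \<rho> f1 + v *s \<rho> f2 = 0"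
    then have "(r - u * (2 * T Q E f1) - v * (2 * T Q E f2)) *s P + (s - u * (2 * T P E f1) - v * (2 * T P E f2)) *s Q +
      (t - u * (2 * T P Q f1) - v * (2 * T P Q f2)) *s E + u *s f1 + v *s f2 = 0"
      by (simp add: \<rho>_def vec.scale_right_diff_distrib vec.scale_left_diff_distrib algebra_simps)
    from indep5D[OF basis0 this] show "r = 0 \<and> s = 0 \<and> t = 0 \<and> u = 0 \<and> v = 0" by auto
  qed
  interpret secant_frame T P Q E "\<rho> f1" "\<rho> f2"
    by unfold_locales (simp_all add: PP QQ PQE PEE QEE rho basis van irr ker)
  obtain g1 g2 where "normal_frame T P Q E g1 g2" by (rule normal_frame_exists)
  then show ?thesis by (rule normal_frame.determinantal)
qed

section \<open>Cubics with identically vanishing Hessian\<close>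

lemma poly_product_nonzero_point:
  fixes p q :: "'a::field_char_0 poly"
  assumes "poly p 0 \<noteq> 0" "q \<noteq> 0"
  obtains t where "t \<noteq> 0" "poly p t \<noteq> 0" "poly q t \<noteq> 0"
proof -
  have "p * q \<noteq> 0" using assms by auto
  then obtain t where "poly (p * q) t \<noteq> 0" "t \<notin> {0}" using poly_nonzero_point[of "p * q" "{0}"] by blast
  then show ?thesis using that by auto
qed

context sym_trilinear
begin

lemma lfun_axis: "lfun \<phi> \<Longrightarrow> (\<Sum>i\<in>UNIV. w $ i * \<phi> (axis i 1)) = \<phi> w"
  using lfun_expand by metis

text \<open>Squares of linear forms are added to fill up part of the kernel:
  \<open>det_pencil_kernel\<close> gives a nonzero \<open>\<kappa>\<close> only for corank one, and
  this reduces larger coranks to that case.\<close>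

definition perturbed_hess :: "('a ^ 'n \<Rightarrow> 'a) set \<Rightarrow> 'a ^ 'n \<Rightarrow> 'a ^ 'n ^ 'n" where
  "perturbed_hess \<Phi> x = (\<chi> i j. hess x $ i $ j + (\<Sum>\<phi>\<in>\<Phi>. \<phi> (axis i 1) * \<phi> (axis j 1)))"

lemma perturbed_hess_pair:
  assumes "\<forall>\<phi>\<in>\<Phi>. lfun \<phi>"
  shows "(\<Sum>i\<in>UNIV. w $ i * (perturbed_hess \<Phi> x *v u) $ i) = T x w u + (\<Sum>\<phi>\<in>\<Phi>. \<phi> w * \<phi> u)"
proof -
  have "(perturbed_hess \<Phi> x *v u) $ i = (hess x *v u) $ i + (\<Sum>\<phi>\<in>\<Phi>. \<phi> (axis i 1) * \<phi> u)" for i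
  proof -
    have "(\<Sum>j\<in>UNIV. (\<Sum>\<phi>\<in>\<Phi>. \<phi> (axis i 1) * \<phi> (axis j 1)) * u $ j) =
        (\<Sum>\<phi>\<in>\<Phi>. \<phi> (axis i 1) * (\<Sum>j\<in>UNIV. u $ j * \<phi> (axis j 1)))"
      unfolding sum_distrib_right sum_distrib_left by (subst sum.swap) (simp add: mult_ac)
    also have "\<dots> = (\<Sum>\<phi>\<in>\<Phi>. \<phi> (axis i 1) * \<phi> u)"
      by (intro sum.cong refl) (use assms in \<open>simp add: lfun_axis\<close>)
    finally show ?thesis
      by (simp add: perturbed_hess_def matrix_vector_mult_def ring_distribs sum.distrib)
  qed
  then have "(\<Sum>i\<in>UNIV. w $ i * (perturbed_hess \<Phi> x *v u) $ i) =
      T x w u + (\<Sum>i\<in>UNIV. \<Sum>\<phi>\<in>\<Phi>. w $ i * (\<phi> (axis i 1) * \<phi> u))"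
    by (simp add: ring_distribs sum.distrib hess_pair sum_distrib_left)
  also have "(\<Sum>i\<in>UNIV. \<Sum>\<phi>\<in>\<Phi>. w $ i * (\<phi> (axis i 1) * \<phi> u)) =
      (\<Sum>\<phi>\<in>\<Phi>. (\<Sum>i\<in>UNIV. w $ i * \<phi> (axis i 1)) * \<phi> u)"
    unfolding sum_distrib_right by (subst sum.swap) (simp add: mult_ac)
  also have "\<dots> = (\<Sum>\<phi>\<in>\<Phi>. \<phi> w * \<phi> u)"
    by (intro sum.cong refl) (use assms in \<open>simp add: lfun_axis\<close>)
  finally show ?thesis .
qed

lemma perturbed_hess_kernel:
  assumes "\<forall>\<phi>\<in>\<Phi>. lfun \<phi>"
  shows "perturbed_hess \<Phi> x *v u = 0 \<longleftrightarrow> (\<forall>w. T x w u + (\<Sum>\<phi>\<in>\<Phi>. \<phi> w * \<phi> u) = 0)"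
proof
  assume "perturbed_hess \<Phi> x *v u = 0"
  then show "\<forall>w. T x w u + (\<Sum>\<phi>\<in>\<Phi>. \<phi> w * \<phi> u) = 0"
    using perturbed_hess_pair[OF assms, of _ x u] by simp
next
  assume *: "\<forall>w. T x w u + (\<Sum>\<phi>\<in>\<Phi>. \<phi> w * \<phi> u) = 0"
  have "(perturbed_hess \<Phi> x *v u) $ k = 0" for k
  proof -
    have "(\<Sum>i\<in>UNIV. axis k 1 $ i * (perturbed_hess \<Phi> x *v u) $ i) = (perturbed_hess \<Phi> x *v u) $ k"
      by (simp add: axis_def if_distrib[of "\<lambda>x. x * _"] cong: if_cong)
    then show ?thesis using perturbed_hess_pair[OF assms, of "axis k 1" x u] * by simp
  qed
  then show "perturbed_hess \<Phi> x *v u = 0" by (simp add: vec_eq_iff)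
qed

lemma perturbed_hess_line: "perturbed_hess \<Phi> (x + t *s w) = pencil (perturbed_hess \<Phi> x) (hess w) t"
  unfolding perturbed_hess_def hess_line by (simp add: pencil_def vec_eq_iff)

definition ker_at :: "'a ^ 'n \<Rightarrow> ('a ^ 'n) set" where
  "ker_at x = {u. \<forall>w. T x u w = 0}"

lemma subspace_ker_at: "vec.subspace (ker_at x)"
  by (auto simp: ker_at_def vec.subspace_def T_simps)

text \<open>A version of the Gordan-Noether theorem: a kernel vector at a point where the Hessian has
  maximal rank is a singular point of the cubic.\<close>

lemma kernel_vector_singular:
  assumes x: "F x \<noteq> 0" and min: "\<And>y. F y \<noteq> 0 \<Longrightarrow> vec.dim (ker_at x) \<le> vec.dim (ker_at y)"
    and v: "v \<in> ker_at x"
  shows "T v v w = 0"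
proof (rule ccontr)
  assume ne: "T v v w \<noteq> 0"
  then have v0: "v \<noteq> 0" by (auto simp: T_simps)
  \<comment> \<open>A basis of the kernel that contains \<open>v\<close>. Its dual forms, without
    the one of \<open>v\<close>, perturb the Hessian so that exactly the span of \<open>v\<close>
    remains as kernel.\<close>
  obtain B where B: "v \<in> B" "B \<subseteq> ker_at x" "vec.independent B" "ker_at x \<subseteq> vec.span B"
    using vec.maximal_independent_subset_extend[of "{v}" "ker_at x"] v v0 by auto
  have finB: "finite B" using B(3) by (rule vec.finiteI_independent)
  have card: "card B = vec.dim (ker_at x)" using B by (intro vec.basis_card_eq_dim) auto
  define B' where "B' = vec.extend_basis B"
  have B': "B \<subseteq> B'" "vec.independent B'" "vec.span B' = UNIV"
    using B(3) by (simp_all add: B'_def vec.extend_basis_superset vec.independent_extend_basis)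
  define \<phi> where "\<phi> b u = vec.representation B' u b" for b u
  have lf: "lfun (\<phi> b)" for b
    using B'(2,3) by (intro lfunI) (simp_all add: \<phi>_def vec.representation_add vec.representation_scale)
  have \<phi>b: "\<phi> b c = (if c = b then 1 else 0)" if "c \<in> B" for b c
    using vec.representation_basis[OF B'(2), of c] that B'(1) by (auto simp: \<phi>_def)
  define \<Phi> where "\<Phi> = \<phi> ` (B - {v})"
  have inj: "inj_on \<phi> (B - {v})"
  proof (rule inj_onI)
    fix b c assume bc: "b \<in> B - {v}" "c \<in> B - {v}" "\<phi> b = \<phi> c"
    from \<phi>b[of b b] \<phi>b[of b c] bc show "b = c" by (auto split: if_splits)
  qed
  have lf\<Phi>: "\<forall>f\<in>\<Phi>. lfun f" by (auto simp: \<Phi>_def lf)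
  have sum\<Phi>: "(\<Sum>f\<in>\<Phi>. f y * f z) = (\<Sum>b\<in>B - {v}. \<phi> b y * \<phi> b z)" for y z
    unfolding \<Phi>_def using inj by (simp add: sum.reindex)
  have \<phi>v: "\<phi> b v = 0" if "b \<in> B - {v}" for b using \<phi>b[OF B(1), of b] that by auto
  let ?A = "perturbed_hess \<Phi> x"
  have sym: "transpose ?A = ?A"
    by (simp add: transpose_def perturbed_hess_def vec_eq_iff hess_def mult.commute comm23)
  have Av: "?A *v v = 0"
    unfolding perturbed_hess_kernel[OF lf\<Phi>] sum\<Phi> using v by (simp add: \<phi>v ker_at_def comm23[of x _ v])
  have ker: "u \<in> vec.span {v}" if u: "?A *v u = 0" for u
  proof -
    have *: "T x y u + (\<Sum>b\<in>B - {v}. \<phi> b y * \<phi> b u) = 0" for y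
      using u unfolding perturbed_hess_kernel[OF lf\<Phi>] sum\<Phi> by blast
    have \<phi>0: "\<phi> b u = 0" if b: "b \<in> B - {v}" for b
    proof -
      have "T x b u = 0" using b B(2) by (auto simp: ker_at_def)
      moreover have "(\<Sum>c\<in>B - {v}. \<phi> c b * \<phi> c u) = (\<Sum>c\<in>B - {v}. if c = b then \<phi> b u else 0)"
        by (intro sum.cong refl) (use b \<phi>b[of b] in auto)
      ultimately show ?thesis using *[of b] b finB by simp
    qed
    then have "T x u y = 0" for y using *[of y] comm23[of x u y] by simp
    then have "u \<in> vec.span B" using B(4) by (auto simp: ker_at_def)
    then have "u \<in> vec.span B'" using vec.span_mono[OF B'(1)] by blast
    have "u = (\<Sum>b\<in>B. vec.representation B u b *s b)"
      using vec.sum_representation_eq[OF B(3) \<open>u \<in> vec.span B\<close> finB subset_refl] by simp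
    also have "\<dots> = (\<Sum>b\<in>B. \<phi> b u *s b)"
      using vec.representation_extend[OF B'(2) \<open>u \<in> vec.span B\<close> B'(1)] by (simp add: \<phi>_def)
    also have "\<dots> = (\<Sum>b\<in>{v}. \<phi> b u *s b)"
      using B(1) finB by (intro sum.mono_neutral_right) (auto simp: \<phi>0)
    finally have "u = \<phi> v u *s v" by simp
    then show ?thesis by (metis vec.span_base vec.span_scale singletonI)
  qed
  obtain \<kappa> where \<kappa>: "\<kappa> \<noteq> 0" and "\<exists>p. \<forall>t. det (pencil ?A (hess w) t) =
      t * (\<kappa> * (\<Sum>i\<in>UNIV. v $ i * (hess w *v v) $ i)) + t\<^sup>2 * poly p t"
    using det_pencil_kernel[OF sym Av v0] ker by metis
  then obtain p where p: "\<And>t. det (pencil ?A (hess w) t) = t * (\<kappa> * T w v v) + t\<^sup>2 * poly p t"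
    unfolding hess_pair by blast
  have "[:0, \<kappa> * T w v v:] + [:0, 0, 1:] * p \<noteq> 0"
  proof
    assume "[:0, \<kappa> * T w v v:] + [:0, 0, 1:] * p = 0"
    then have "coeff ([:0, \<kappa> * T w v v:] + [:0, 0, 1:] * p) 1 = 0" by simp
    then have "\<kappa> * T w v v = 0" by (simp add: coeff_mult)
    with \<kappa> ne show False by (metis comm12 comm23 mult_eq_0_iff)
  qed
  moreover have "poly [:F x, 3 * T x x w, 3 * T x w w, F w:] 0 \<noteq> 0" using x by simp
  \<comment> \<open>With \<open>T v v w\<close> nonzero, the perturbed determinant has a nonzero
    first order term, so it is nonzero at some point \<open>x + t *s w\<close> outside the
    hypersurface.\<close>
  ultimately obtain t where t: "poly [:F x, 3 * T x x w, 3 * T x w w, F w:] t \<noteq> 0"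
    "poly ([:0, \<kappa> * T w v v:] + [:0, 0, 1:] * p) t \<noteq> 0"
    using poly_product_nonzero_point by metis
  define y where "y = x + t *s w"
  have "F y \<noteq> 0" using t(1) unfolding y_def F_line
    by (simp add: algebra_simps power2_eq_square power3_eq_cube)
  have "det (perturbed_hess \<Phi> y) \<noteq> 0"
    using t(2) p[of t] unfolding y_def perturbed_hess_line by (simp add: power2_eq_square algebra_simps)
  then have nonsing: "u = 0" if "\<forall>w. T y w u + (\<Sum>b\<in>B - {v}. \<phi> b w * \<phi> b u) = 0" for u
    using that unfolding det_nonzero_iff perturbed_hess_kernel[OF lf\<Phi>] sum\<Phi> by blast
  \<comment> \<open>At \<open>y\<close> the forms dual to \<open>B - {v}\<close> are jointly
    injective on the kernel of the Hessian, so this kernel is smaller than the one at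
    \<open>x\<close>.\<close>
  define g where "g u = (\<Sum>b\<in>B - {v}. \<phi> b u *s b)" for u
  have lin: "Vector_Spaces.linear (*s) (*s) g"
    unfolding Vector_Spaces.linear_iff
    by (intro conjI allI vec.vector_space_axioms)
      (simp_all add: g_def lfun_simps[OF lf] vec.scale_left_distrib sum.distrib vec.scale_sum_right)
  have "inj_on g (ker_at y)"
  proof (rule inj_onI)
    fix a b assume ab: "a \<in> ker_at y" "b \<in> ker_at y" "g a = g b"
    have ker: "a - b \<in> ker_at y" using ab by (simp add: ker_at_def T_simps)
    have "(\<Sum>c\<in>B - {v}. \<phi> c (a - b) *s c) = 0"
      using ab(3) by (simp add: g_def lfun_simps[OF lf] vec.scale_left_diff_distrib sum_subtractf)
    then have "\<phi> c (a - b) = 0" if "c \<in> B - {v}" for c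
      using vec.independentD[OF B(3), of "B - {v}" "\<lambda>c. \<phi> c (a - b)" c] finB that by auto
    then have "a - b = 0" using ker by (intro nonsing) (simp add: ker_at_def comm23[of y _ "a - b"])
    then show "a = b" by simp
  qed
  then have "vec.dim (ker_at y) = vec.dim (g ` ker_at y)"
    using vec.dim_image_eq[OF lin, of "ker_at y"] subspace_ker_at by (simp add: vec.span_eq_iff[THEN iffD2])
  also have "\<dots> \<le> card (B - {v})"
  proof (rule vec.dim_le_card)
    show "g ` ker_at y \<subseteq> vec.span (B - {v})"
      unfolding g_def by (rule image_subsetI) (intro vec.span_sum vec.span_scale vec.span_base)
  qed (simp add: finB)
  also have "\<dots> < card B" using B(1) finB by (intro psubset_card_mono) auto
  finally show False using min[OF \<open>F y \<noteq> 0\<close>] card by simp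
qed

end

section \<open>Kernel vectors and their quadrics when the Hessian vanishes identically\<close>

locale zero_hessian_cubic = sym_trilinear T
  for T :: "'a::{alg_closed_field, field_char_0} ^ 5 \<Rightarrow> 'a ^ 5 \<Rightarrow> 'a ^ 5 \<Rightarrow> 'a" +
  assumes no_vertex: "v \<noteq> 0 \<Longrightarrow> \<exists>y z. T v y z \<noteq> 0"
    and singular: "det (hess y) = 0"
begin

lemma kernel_vectorE:
  obtains u where "u \<noteq> 0" "\<And>w. T y u w = 0"
  using singular[of y] det_hess_0_iff by blast

lemma isotropic_polar:
  assumes "\<And>z. C z \<Longrightarrow> T v z z = 0" "C a" "C b" "C (a + b)"
  shows "T v a b = 0"
proof -
  have "T v (a + b) (a + b) = T v a a + 2 * T v a b + T v b b"
    using comm23[of v a b] by (simp add: T_simps)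
  then show ?thesis using assms by simp
qed

text \<open>All first derivatives vanish on the plane of \<open>a, b, c\<close>, so \<open>F\<close>
  is a quadratic form in \<open>k4\<close>, \<open>k5\<close> with linear coefficients; such a form
  is a symmetric determinant with a zero corner.\<close>

lemma determinantal_if_double_plane:
  assumes ind: "indep5 a b c d e"
    and z: "\<And>w. T a a w = 0" "\<And>w. T a b w = 0" "\<And>w. T a c w = 0" "\<And>w. T b b w = 0"
      "\<And>w. T b c w = 0" "\<And>w. T c c w = 0"
  shows determinantal
proof -
  obtain k1 k2 k3 k4 k5 where k: "lfun k1" "lfun k2" "lfun k3" "lfun k4" "lfun k5"
    and ex: "\<And>x. x = k1 x *s a + k2 x *s b + k3 x *s c + k4 x *s d + k5 x *s e"
    using indep5_coords[OF ind] by blast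
  \<comment> \<open>The factor 3 is the multiplicity of a plane coordinate in the expansion of the
    cubic; it gives \<open>F x = T z z (L x)\<close> for
    \<open>z = k4 x *s d + k5 x *s e\<close>.\<close>
  define L where "L x = k1 x *s (3 *s a) + k2 x *s (3 *s b) + k3 x *s (3 *s c) + k4 x *s d + k5 x *s e" for x
  note zs = T_perm[OF z(1)] T_perm[OF z(2)] T_perm[OF z(3)] T_perm[OF z(4)] T_perm[OF z(5)] T_perm[OF z(6)]
  have lf: "lfun (\<lambda>x. T y z (L x))" for y z
    by (rule lfunI) (simp_all add: L_def lfun_simps k T_simps algebra_simps)
  have lfn: "lfun (\<lambda>x. - T y z (L x))" for y z
    using lf[of y z] by (auto simp: lfun_def)
  have "F x = det3 0 (- T e e (L x)) (- T d d (L x)) (k4 x) (k5 x) (T d e (L x))" for x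
  proof -
    have "F x = F (k1 x *s a + k2 x *s b + k3 x *s c + k4 x *s d + k5 x *s e)" using ex[of x] by simp
    then show ?thesis
      using T_perm[of a d d, OF refl] T_perm[of a d e, OF refl] T_perm[of a e e, OF refl]
        T_perm[of b d d, OF refl] T_perm[of b d e, OF refl] T_perm[of b e e, OF refl]
        T_perm[of c d d, OF refl] T_perm[of c d e, OF refl] T_perm[of c e e, OF refl]
        T_perm[of d d e, OF refl] T_perm[of d e e, OF refl]
      by (simp add: det3_def L_def T_simps zs) (simp add: algebra_simps power2_eq_square)
  qed
  moreover have "lfun (\<lambda>_. 0)" by (simp add: lfun_def)
  ultimately show ?thesis
    by (intro determinantalI[of "\<lambda>_. 0" "\<lambda>x. - T e e (L x)" "\<lambda>x. - T d d (L x)" k4 k5 "\<lambda>x. T d e (L x)"]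
      lf lfn k)
qed

text \<open>If \<open>v\<close> and \<open>v'\<close> were independent, all their combinations would
  be singular points, and \<open>T v\<close>, \<open>T v'\<close> would be binary quadratic forms in
  the coordinates of \<open>e\<close> and \<open>f\<close>. They are independent because there is no
  vertex, so their Jacobian is not zero; where it is nonzero, the Hessian is invertible at a
  suitable \<open>y\<close>.\<close>

lemma corank_one:
  assumes x: "F x \<noteq> 0" and min: "\<And>y. F y \<noteq> 0 \<Longrightarrow> vec.dim (ker_at x) \<le> vec.dim (ker_at y)"
    and v: "v \<noteq> 0" "v \<in> ker_at x" and v': "v' \<in> ker_at x"
  shows "v' \<in> vec.span {v}"
proof (rule ccontr)
  assume indv: "v' \<notin> vec.span {v}"
  note sub = subspace_ker_at[of x]
  note KS = kernel_vector_singular[OF x min]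
  have vv: "T v v w = 0" and v'v': "T v' v' w = 0" for w using KS v v' by blast+
  have vv': "T v v' w = 0" for w
  proof -
    have "T w v v' = 0"
      by (rule isotropic_polar[of "\<lambda>z. z \<in> ker_at x"])
        (use KS v v' vec.subspace_add[OF sub] in \<open>auto simp: comm12[of w] comm23[of _ w]\<close>)
    then show ?thesis by (metis comm12 comm23)
  qed
  have xv: "T x v w = 0" "T x v' w = 0" for w using v v' by (auto simp: ker_at_def)
  note zs = T_perm[OF vv] T_perm[OF v'v'] T_perm[OF vv'] T_perm[OF xv(1)] T_perm[OF xv(2)]
  have nx: "x \<notin> vec.span {v, v'}"
  proof
    assume "x \<in> vec.span {v, v'}"
    moreover have "vec.span {v, v'} \<subseteq> ker_at x"
      by (rule vec.span_minimal[OF _ sub]) (use v v' in auto)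
    ultimately have "x \<in> ker_at x" by blast
    then show False using x by (simp add: ker_at_def)
  qed
  have "card {v, v', x} < 5" "finite {v, v', x}" by (auto simp: card_insert_if)
  then obtain e where e: "e \<notin> vec.span {v, v', x}" using exists_not_in_span by blast
  have "card {v, v', x, e} < 5" "finite {v, v', x, e}" by (auto simp: card_insert_if)
  then obtain f where f: "f \<notin> vec.span {v, v', x, e}" using exists_not_in_span by blast
  have ind: "indep5 v v' x e f" by (rule indep5I[OF v(1) indv nx e f])
  define a b c where abc: "a = T v e e" "b = T v e f" "c = T v f f"
  define a' b' c' where abc': "a' = T v' e e" "b' = T v' e f" "c' = T v' f f"
  have dep: False if "\<alpha> * a + \<beta> * a' = 0" "\<alpha> * b + \<beta> * b' = 0" "\<alpha> * c + \<beta> * c' = 0" "\<alpha> \<noteq> 0 \<or> \<beta> \<noteq> 0" for \<alpha> \<beta>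
  proof -
    have "T (\<alpha> *s v + \<beta> *s v') y z = 0" for y z
    proof -
      obtain r1 r2 r3 r4 r5 where y: "y = r1 *s v + r2 *s v' + r3 *s x + r4 *s e + r5 *s f"
        using indep5_expand[OF ind] .
      obtain s1 s2 s3 s4 s5 where z: "z = s1 *s v + s2 *s v' + s3 *s x + s4 *s e + s5 *s f"
        using indep5_expand[OF ind] .
      have "T (\<alpha> *s v + \<beta> *s v') y z = r4 * s4 * (\<alpha> * a + \<beta> * a') + (r4 * s5 + r5 * s4) * (\<alpha> * b + \<beta> * b')
          + r5 * s5 * (\<alpha> * c + \<beta> * c')"
        using comm23[of v e f] comm23[of v' e f]
        unfolding y z abc abc' by (simp add: T_simps zs) (simp add: algebra_simps)
      then show ?thesis using that by simp
    qed
    then have "\<alpha> *s v + \<beta> *s v' = 0" using no_vertex by blast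
    then have "\<alpha> *s v + \<beta> *s v' + 0 *s x + 0 *s e + 0 *s f = 0" by simp
    from indep5D[OF ind this] that(4) show False by simp
  qed
  have minors: "a * b' - b * a' \<noteq> 0 \<or> b * c' - c * b' \<noteq> 0 \<or> a * c' - c * a' \<noteq> 0"
  proof (rule ccontr)
    assume "\<not> ?thesis"
    then have m: "a * b' = b * a'" "b * c' = c * b'" "a * c' = c * a'" by auto
    show False
    proof (cases "a = 0 \<and> b = 0 \<and> c = 0")
      case True then show False using dep[of 1 0] by simp
    next
      case False
      then consider "a \<noteq> 0" | "b \<noteq> 0" | "c \<noteq> 0" by blast
      then show False
      proof cases
        case 1 then show False using dep[of "- a'" a] m by (simp add: mult.commute)
      next
        case 2 then show False using dep[of "- b'" b] m by (simp add: mult.commute)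
      next
        case 3 then show False using dep[of "- c'" c] m by (simp add: mult.commute)
      qed
    qed
  qed
  \<comment> \<open>The expression is the Jacobian of the two binary forms up to a constant, with
    the three minors as coefficients. A nonzero binary quadratic form is nonzero at (1, 0), (0, 1)
    or (1, 1).\<close>
  obtain p q where pq: "(a * p + b * q) * (b' * p + c' * q) - (b * p + c * q) * (a' * p + b' * q) \<noteq> 0"
  proof (cases "a * b' - b * a' = 0")
    case False then show ?thesis using that[of 1 0] by simp
  next
    case ab: True
    show ?thesis
    proof (cases "b * c' - c * b' = 0")
      case False then show ?thesis using that[of 0 1] by simp
    next
      case True
      then have "(a + b) * (b' + c') - (b + c) * (a' + b') \<noteq> 0" using ab minors by (simp add: algebra_simps)
      then show ?thesis using that[of 1 1] by simp
    qed
  qed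
  \<comment> \<open>Chosen to make \<open>T y x x = 1\<close>, which forces the component
    \<open>r3\<close> of a kernel vector to vanish.\<close>
  define s where "s = (1 - T x x (p *s e + q *s f)) / F x"
  define y where "y = p *s e + q *s f + s *s x"
  have yxx: "T y x x = 1"
    using x T_perm[of x x e, OF refl] T_perm[of x x f, OF refl] by (simp add: y_def s_def T_simps)
  have ye: "T y v e = a * p + b * q" "T y v f = b * p + c * q" "T y v' e = a' * p + b' * q" "T y v' f = b' * p + c' * q"
    using T_perm[of v e e, OF refl] T_perm[of v e f, OF refl] T_perm[of v f f, OF refl]
      T_perm[of v' e e, OF refl] T_perm[of v' e f, OF refl] T_perm[of v' f f, OF refl]
    unfolding y_def abc abc' by (simp_all add: T_simps zs)
  obtain u where u: "u \<noteq> 0" "\<And>w. T y u w = 0" using kernel_vectorE by blast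
  obtain r1 r2 r3 r4 r5 where ur: "u = r1 *s v + r2 *s v' + r3 *s x + r4 *s e + r5 *s f"
    using indep5_expand[OF ind] .
  let ?J = "(a * p + b * q) * (b' * p + c' * q) - (b * p + c * q) * (a' * p + b' * q)"
  have e1: "r4 * (a * p + b * q) + r5 * (b * p + c * q) = 0"
    using u(2)[of v] comm23[of y e v] comm23[of y f v] unfolding ur by (simp add: T_simps zs ye)
  have e2: "r4 * (a' * p + b' * q) + r5 * (b' * p + c' * q) = 0"
    using u(2)[of v'] comm23[of y e v'] comm23[of y f v'] unfolding ur by (simp add: T_simps zs ye)
  have "?J * r4 = 0" "?J * r5 = 0" using e1 e2 by algebra+
  then have r45: "r4 = 0" "r5 = 0" using pq by (simp_all only: mult_eq_0_iff) simp_all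
  have "r3 = 0" using u(2)[of x] r45 yxx unfolding ur by (simp add: T_simps zs)
  with r45 have e3: "r1 * (a * p + b * q) + r2 * (a' * p + b' * q) = 0" "r1 * (b * p + c * q) + r2 * (b' * p + c' * q) = 0"
    using u(2)[of e] u(2)[of f] unfolding ur by (simp_all add: T_simps ye)
  then have "?J * r1 = 0" "?J * r2 = 0" by algebra+
  then have "r1 = 0" "r2 = 0" using pq by (simp_all only: mult_eq_0_iff) simp_all
  with r45 \<open>r3 = 0\<close> u(1) ur show False by simp
qed

end

context zero_hessian_cubic
begin

definition simple_kernel :: "'a ^ 5 \<Rightarrow> 'a ^ 5 \<Rightarrow> bool" where
  "simple_kernel x v \<longleftrightarrow> F x \<noteq> 0 \<and> v \<noteq> 0 \<and> (\<forall>w. T x v w = 0) \<and>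
     (\<forall>u. (\<forall>w. T x u w = 0) \<longrightarrow> u \<in> vec.span {v})"

text \<open>The Hessian determinant vanishes along every line through \<open>x\<close>, and for
  corank one its first order term is a nonzero multiple of \<open>T v v w\<close>.\<close>

lemma simple_kernel_singular:
  assumes "simple_kernel x v"
  shows "T v v w = 0"
proof -
  have v: "v \<noteq> 0" "hess x *v v = 0" and ker: "\<forall>u. hess x *v u = 0 \<longrightarrow> u \<in> vec.span {v}"
    using assms unfolding simple_kernel_def hess_kernel by blast+
  obtain \<kappa> where \<kappa>0: "(\<forall>u. hess x *v u = 0 \<longrightarrow> u \<in> vec.span {v}) \<Longrightarrow> \<kappa> \<noteq> 0"
    and \<kappa>1: "\<And>B. \<exists>p. \<forall>t. det (pencil (hess x) B t) =
      t * (\<kappa> * (\<Sum>i\<in>UNIV. v $ i * (B *v v) $ i)) + t\<^sup>2 * poly p t"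
    by (rule det_pencil_kernel[OF transpose_hess v(2,1)], rule that)
  have \<kappa>: "\<kappa> \<noteq> 0" using \<kappa>0 ker by simp
  from \<kappa>1[of "hess w"] obtain p where p: "\<And>t. det (pencil (hess x) (hess w) t) = t * (\<kappa> * T w v v) + t\<^sup>2 * poly p t"
    unfolding hess_pair by blast
  have "poly ([:0, \<kappa> * T w v v:] + [:0, 0, 1:] * p) t = 0" for t
    using p[of t] singular[of "x + t *s w"] unfolding hess_line by (simp add: power2_eq_square algebra_simps)
  then have "[:0, \<kappa> * T w v v:] + [:0, 0, 1:] * p = 0" using poly_all_0_iff_0 by blast
  then have "coeff ([:0, \<kappa> * T w v v:] + [:0, 0, 1:] * p) 1 = 0" by simp
  then have "\<kappa> * T w v v = 0" by (simp add: coeff_mult)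
  with \<kappa> show ?thesis by (metis comm12 comm23 mult_eq_0_iff)
qed

text \<open>Three orthonormal vectors for \<open>T v\<close> form a basis together with
  \<open>v\<close> and \<open>x\<close>. Adding \<open>s *s v\<close> to a suitable \<open>y\<close>
  adds \<open>s\<close> times the identity on \<open>f, g\<close>, so the determinant that decides
  about a kernel vector is a monic quadratic in \<open>s\<close> and is nonzero for some
  \<open>s\<close>.\<close>

lemma no_rank_three:
  assumes sk: "simple_kernel x v"
    and q: "T v e e = 1" "T v f f = 1" "T v g g = 1" "T v e f = 0" "T v e g = 0" "T v f g = 0"
  shows False
proof -
  have xv: "T x v w = 0" for w using sk by (simp add: simple_kernel_def)
  note vv = simple_kernel_singular[OF sk]
  note zs = T_perm[OF xv] T_perm[OF vv] T_perm[OF q(1)] T_perm[OF q(2)] T_perm[OF q(3)] T_perm[OF q(4)]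
    T_perm[OF q(5)] T_perm[OF q(6)]
  have ind: "indep5 v x e f g"
    unfolding indep5_def
  proof (intro allI impI)
    fix r s t u w
    assume eq: "r *s v + s *s x + t *s e + u *s f + w *s g = 0"
    have "T v z (r *s v + s *s x + t *s e + u *s f + w *s g) = 0" for z unfolding eq by (simp add: T_simps)
    from this[of e] this[of f] this[of g] have tuw: "t = 0" "u = 0" "w = 0" by (simp_all add: T_simps zs)
    have "T x x (r *s v + s *s x + t *s e + u *s f + w *s g) = 0" unfolding eq by (simp add: T_simps)
    then have "s = 0" using sk by (simp add: tuw T_simps zs simple_kernel_def)
    then show "r = 0 \<and> s = 0 \<and> t = 0 \<and> u = 0 \<and> w = 0"
      using eq tuw sk by (simp add: simple_kernel_def)
  qed
  define \<tau> where "\<tau> = (1 - T x x e) / F x"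
  define y where "y = e + \<tau> *s x"
  have F0: "F x \<noteq> 0" using sk by (simp add: simple_kernel_def)
  have yxx: "T y x x = 1"
    using F0 T_perm[of x x e, OF refl] by (simp add: y_def \<tau>_def T_simps)
  define a b c d k where abc: "a = T y x f" "b = T y x g" "c = T y f f" "d = T y f g" "k = T y g g"
  \<comment> \<open>As a polynomial in \<open>s\<close>, the determinant of the symmetric 3 x 3
    matrix with diagonal \<open>1, s + c, s + k\<close> and entries \<open>a, b, d\<close>.\<close>
  define S where "S = [: c * k - d\<^sup>2 - a * (a * k - b * d) + b * (a * d - b * c), c + k - a\<^sup>2 - b\<^sup>2, 1 :]"
  have "S \<noteq> 0" by (simp add: S_def)
  then obtain s where s: "poly S s \<noteq> 0" using poly_all_0_iff_0 by blast
  let ?y = "s *s v + y"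
  obtain u where u: "u \<noteq> 0" "\<And>w. T ?y u w = 0" using kernel_vectorE by blast
  obtain u0 u1 u2 u3 u4 where ur: "u = u0 *s v + u1 *s x + u2 *s e + u3 *s f + u4 *s g"
    using indep5_expand[OF ind] .
  have yv: "T y v e = 1" "T y v f = 0" "T y v g = 0" "T y v x = 0" "T y v v = 0"
    unfolding y_def by (simp_all add: T_simps zs)
  note yvs = T_perm[OF yv(1)] T_perm[OF yv(2)] T_perm[OF yv(3)] T_perm[OF yv(4)] T_perm[OF yv(5)]
  have u2: "u2 = 0" using u(2)[of v] unfolding ur by (simp add: T_simps zs yvs)
  have e1: "u1 + u3 * a + u4 * b = 0"
    using u(2)[of x] u2 yxx comm23[of y f x] comm23[of y g x] unfolding ur abc by (simp add: T_simps zs yvs)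
  have e3: "u1 * a + u3 * (s + c) + u4 * d = 0"
    using u(2)[of f] u2 comm23[of y g f] unfolding ur abc by (simp add: T_simps zs yvs algebra_simps)
  have e4: "u1 * b + u3 * d + u4 * (s + k) = 0"
    using u(2)[of g] u2 unfolding ur abc by (simp add: T_simps zs yvs algebra_simps)
  have "poly S s * u1 = 0" "poly S s * u3 = 0" "poly S s * u4 = 0"
    using e1 e3 e4 unfolding S_def by (simp_all add: power2_eq_square) algebra+
  then have u134: "u1 = 0" "u3 = 0" "u4 = 0" using s by simp_all
  have "u0 = 0" using u(2)[of e] u2 u134 unfolding ur by (simp add: T_simps zs yvs)
  then show False using u(1) u2 u134 ur by simp
qed

text \<open>Here \<open>T v\<close> is a hyperbolic plane on \<open>f, g\<close> plus a radical
  containing \<open>e\<close>. At \<open>s *s v + y\<close> the determinant deciding about a kernel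
  vector has \<open>- 2 * y2 * y3 * \<Delta> y\<close> as coefficient of \<open>s\<close>; as the
  Hessian is singular everywhere, \<open>\<Delta>\<close> vanishes. Then \<open>T y x e\<close> is
  proportional to \<open>T y x x\<close> as a form in \<open>y\<close>, and \<open>e\<close> minus a
  multiple of \<open>x\<close> lies in the kernel at \<open>x\<close>, against independence.\<close>

lemma no_rank_two:
  assumes sk: "simple_kernel x v"
    and q: "T v f f = 0" "T v g g = 0" "T v f g = 1"
    and rad: "\<And>e w. T v f e = 0 \<Longrightarrow> T v g e = 0 \<Longrightarrow> T v e w = 0"
  shows False
proof -
  have xv: "T x v w = 0" for w using sk by (simp add: simple_kernel_def)
  have F0: "F x \<noteq> 0" using sk by (simp add: simple_kernel_def)
  note vv = simple_kernel_singular[OF sk]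
  note zs0 = T_perm[OF xv] T_perm[OF vv] T_perm[OF q(1)] T_perm[OF q(2)] T_perm[OF q(3)]
  have "card {v, x, f, g} < 5" "finite {v, x, f, g}" by (auto simp: card_insert_if)
  then obtain e0 where e0: "e0 \<notin> vec.span {v, x, f, g}" using exists_not_in_span by blast
  define e where "e = e0 - T v g e0 *s f - T v f e0 *s g"
  have ef: "T v f e = 0" "T v g e = 0" unfolding e_def by (simp_all add: T_simps zs0)
  have er: "T v e w = 0" for w using rad ef .
  note zs = zs0 T_perm[OF er]
  have ind: "indep5 v x f g e"
    unfolding indep5_def
  proof (intro allI impI)
    fix r s t u w
    assume eq: "r *s v + s *s x + t *s f + u *s g + w *s e = 0"
    have "T v z (r *s v + s *s x + t *s f + u *s g + w *s e) = 0" for z unfolding eq by (simp add: T_simps)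
    from this[of f] this[of g] have tu: "t = 0" "u = 0" by (simp_all add: T_simps zs)
    have w: "w = 0"
    proof (rule ccontr)
      assume w: "w \<noteq> 0"
      have "r *s v + s *s x + w *s e = 0" using eq tu by simp
      then have "r *s v + s *s x + (- w * T v g e0) *s f + (- w * T v f e0) *s g + w *s e0 = 0"
        by (simp add: e_def vec.scale_right_diff_distrib algebra_simps)
      from in_span_insertI[OF w this, of "{v, x, f, g}"] e0 show False
        by (meson vec.span_add vec.span_scale vec.span_base insertI1 insertI2)
    qed
    have "T x x (r *s v + s *s x + t *s f + u *s g + w *s e) = 0" unfolding eq by (simp add: T_simps)
    then have "s = 0" using F0 by (simp add: tu w T_simps zs)
    then show "r = 0 \<and> s = 0 \<and> t = 0 \<and> u = 0 \<and> w = 0"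
      using eq tu w sk by (simp add: simple_kernel_def)
  qed
  define \<Delta> where "\<Delta> y = T y x x * T y e e - (T y x e)\<^sup>2" for y
  have D0: "\<Delta> y = 0" if y23: "T v g y * T v f y \<noteq> 0" for y
  proof (rule ccontr)
    assume D: "\<Delta> y \<noteq> 0"
    define y2 y3 where y23_def: "y2 = T v g y" "y3 = T v f y"
    have y2: "y2 \<noteq> 0" and y3: "y3 \<noteq> 0" using y23 by (auto simp: y23_def)
    define G where "G = y2 *s f - y3 *s g"
    have qG: "T v G G = - 2 * y2 * y3" unfolding G_def by (simp add: T_simps zs)
    have yG: "T y v G = 0" unfolding G_def
      using comm12[of y v f] comm23[of v y f] comm12[of y v g] comm23[of v y g]
      by (simp add: T_simps y23_def)
    define gg gx ge where g_def: "gg = T y G G" "gx = T y G x" "ge = T y G e"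
    define a b d where abd: "a = T y x x" "b = T y x e" "d = T y e e"
    have D': "\<Delta> y = a * d - b\<^sup>2" by (simp add: \<Delta>_def abd)
    define S where "S = [: gg * \<Delta> y - gx * (gx * d - b * ge) + ge * (gx * b - a * ge), - 2 * y2 * y3 * \<Delta> y :]"
    have "S \<noteq> 0" using D y2 y3 by (simp add: S_def)
    then obtain s where s: "poly S s \<noteq> 0" using poly_all_0_iff_0 by blast
    let ?y = "s *s v + y"
    obtain u where u: "u \<noteq> 0" "\<And>w. T ?y u w = 0" using kernel_vectorE by blast
    obtain u0 u1 u2 u3 u4 where ur0: "u = u0 *s v + u1 *s x + u2 *s f + u3 *s g + u4 *s e"
      using indep5_expand[OF ind] .
    have yf: "T y v f = y3" "T y v g = y2" unfolding y23_def by (metis comm12 comm23)+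
    have yv: "T y v x = 0" "T y v e = 0" "T y v v = 0"
      using xv[of y] er[of y] vv[of y] by (metis comm12 comm23)+
    note yvs = T_perm[OF yf(1)] T_perm[OF yf(2)] T_perm[OF yv(1)] T_perm[OF yv(2)] T_perm[OF yv(3)]
    have "y3 * u2 + y2 * u3 = 0" using u(2)[of v] unfolding ur0 by (simp add: T_simps zs yvs algebra_simps)
    define \<mu> where "\<mu> = u2 / y2"
    have "u2 = \<mu> * y2" using y2 by (simp add: \<mu>_def)
    moreover have "u3 = - \<mu> * y3"
      using \<open>y3 * u2 + y2 * u3 = 0\<close> y2 by (simp add: \<mu>_def field_simps add_eq_0_iff)
    ultimately have ur: "u = u0 *s v + u1 *s x + \<mu> *s G + u4 *s e"
      by (simp add: ur0 G_def vec.scale_right_diff_distrib algebra_simps)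
    have gz: "T v G x = 0" "T v G e = 0" unfolding G_def by (simp_all add: T_simps zs)
    note gzs = T_perm[OF gz(1)] T_perm[OF gz(2)] T_perm[OF yG] T_perm[OF qG]
    have e1: "\<mu> * (- 2 * y2 * y3 * s + gg) + u1 * gx + u4 * ge = 0"
      using u(2)[of G] comm23[of y x G] comm23[of y e G] unfolding ur g_def
      by (simp add: T_simps zs yvs gzs algebra_simps)
    have e2: "\<mu> * gx + u1 * a + u4 * b = 0"
      using u(2)[of x] comm23[of y e x] unfolding ur g_def abd by (simp add: T_simps zs yvs gzs add_ac)
    have e3: "\<mu> * ge + u1 * b + u4 * d = 0"
      using u(2)[of e] unfolding ur g_def abd by (simp add: T_simps zs yvs gzs add_ac)
    have "poly S s = (- 2 * y2 * y3 * s + gg) * (a * d - b\<^sup>2) - gx * (gx * d - b * ge) + ge * (gx * b - a * ge)"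
      unfolding S_def D' by (simp add: algebra_simps)
    then have "poly S s * \<mu> = 0" "poly S s * u1 = 0" "poly S s * u4 = 0"
      using e1 e2 e3 by algebra+
    then have z: "\<mu> = 0" "u1 = 0" "u4 = 0" using s by simp_all
    have "u0 = 0" using u(2)[of f] z y3 unfolding ur by (simp add: T_simps zs yvs)
    then show False using u(1) z ur by simp
  qed
  have "(\<forall>y. \<Delta> y = 0) \<or> (\<forall>y. T v g y * T v f y = 0)"
  proof (rule polyfun_domain)
    show "polyfun \<Delta>" unfolding \<Delta>_def[abs_def] by (intro pf_intros)
    show "polyfun (\<lambda>y. T v g y * T v f y)" by (intro pf_intros)
    show "\<Delta> y * (T v g y * T v f y) = 0" for y using D0[of y] by (cases "T v g y * T v f y = 0") auto
  qed
  moreover have "T v g (f + g) * T v f (f + g) = 1" by (simp add: T_simps zs)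
  ultimately have \<Delta>: "\<Delta> y = 0" for y by (metis zero_neq_one)
  define \<nu> where "\<nu> = T x x e / F x"
  have "T x (e - \<nu> *s x) y = 0" for y
  proof -
    \<comment> \<open>Moved along \<open>x\<close> to reach \<open>T y' x x = 0\<close>; then
      \<open>\<Delta> y' = 0\<close> leaves \<open>T y' x e = 0\<close>.\<close>
    define y' where "y' = y - (T y x x / F x) *s x"
    have "T y' x x = 0" using F0 by (simp add: y'_def T_simps)
    then have "T y' x e = 0" using \<Delta>[of y'] by (simp add: \<Delta>_def)
    then have "T y x e - T y x x / F x * T x x e = 0" by (simp add: y'_def T_simps)
    moreover have "T x e y = T y x e" "T x x y = T y x x" by (metis comm12 comm23)+
    ultimately show ?thesis by (simp add: T_simps \<nu>_def)
  qed
  then have "e - \<nu> *s x \<in> vec.span {v}" using sk by (simp add: simple_kernel_def)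
  then obtain k where "e - \<nu> *s x = k *s v" by (auto simp: vec.span_singleton)
  then have "(- k) *s v + (- \<nu>) *s x + 0 *s f + 0 *s g + 1 *s e = 0" by (simp add: algebra_simps)
  from indep5D[OF ind this] show False by simp
qed

lemma normalise:
  assumes "T v e e \<noteq> 0"
  obtains c where "T v (c *s e) (c *s e) = 1"
proof -
  obtain c where c: "c\<^sup>2 = 1 / T v e e" using alg_closed_sqrt .
  have "T v (c *s e) (c *s e) = c\<^sup>2 * T v e e" by (simp add: T_simps power2_eq_square)
  then show ?thesis using that[of c] assms c by simp
qed

text \<open>Orthonormal vectors for \<open>T v\<close> are split off one by one. A third one
  contradicts \<open>no_rank_three\<close>; if there are just two, the isotropic vectors
  \<open>m\<close>, \<open>n\<close> of their plane contradict \<open>no_rank_two\<close>.\<close>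

lemma rank_one:
  assumes sk: "simple_kernel x v"
  obtains l where "lfun l" "\<And>y z. T v y z = l y * l z"
proof -
  have "v \<noteq> 0" using sk by (simp add: simple_kernel_def)
  then obtain y z where yz: "T v y z \<noteq> 0" using no_vertex by blast
  have "\<exists>e. T v e e \<noteq> 0"
    using isotropic_polar[of "\<lambda>_. True" v y z] yz by blast
  then obtain e where e: "T v e e = 1" using normalise by metis
  have orth: "T v e (w - T v e w *s e) = 0" for w using e by (simp add: T_simps)
  have rank1: "T v f f = 0" if f: "T v e f = 0" for f
  proof (rule ccontr)
    assume "T v f f \<noteq> 0"
    then obtain c where c: "T v (c *s f) (c *s f) = 1" by (rule normalise)
    define f' where "f' = c *s f"
    have f': "T v f' f' = 1" "T v e f' = 0" using c f by (simp_all add: f'_def T_simps)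
    have rank2: "T v g g = 0" if g: "T v e g = 0" "T v f' g = 0" for g
    proof (rule ccontr)
      assume "T v g g \<noteq> 0"
      then obtain d where d: "T v (d *s g) (d *s g) = 1" by (rule normalise)
      show False
        by (rule no_rank_three[OF sk e f'(1) d f'(2)]) (use g in \<open>simp_all add: T_simps\<close>)
    qed
    obtain i :: 'a where i: "i\<^sup>2 = - 1" using alg_closed_sqrt .
    have fe: "T v f' e = 0" using f'(2) comm23[of v e f'] by simp
    define m where "m = e + i *s f'"
    define n where "n = (1 / 2) *s (e - i *s f')"
    have ii: "i * i = - 1" using i by (simp add: power2_eq_square)
    have q: "T v m m = 0" "T v n n = 0" "T v m n = 1"
      using e f' fe ii by (simp_all add: m_def n_def T_simps field_simps)
    show False
    proof (rule no_rank_two[OF sk q])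
      fix a w assume a: "T v m a = 0" "T v n a = 0"
      have "T v e a = 0"
        using a by (simp add: m_def n_def T_simps)
      moreover from this have "i * T v f' a = 0" using a(1) by (simp add: m_def T_simps)
      then have "T v f' a = 0" using ii by auto
      ultimately have ea: "T v e a = 0" "T v f' a = 0" .
      define w' where "w' = w - T v e w *s e - T v f' w *s f'"
      have w': "T v e w' = 0" "T v f' w' = 0" using e f' fe by (simp_all add: w'_def T_simps)
      have "T v a w' = 0"
        by (rule isotropic_polar[of "\<lambda>z. T v e z = 0 \<and> T v f' z = 0"])
          (use rank2 ea w' in \<open>auto simp: T_simps\<close>)
      moreover have "T v a w = T v a w' + T v e w * T v a e + T v f' w * T v a f'"
        by (simp add: w'_def T_simps)
      moreover have "T v a e = 0" "T v a f' = 0" using ea by (metis comm23)+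
      ultimately show "T v a w = 0" by simp
    qed
  qed
  have "T v y z = T v e y * T v e z" for y z
  proof -
    define y' where "y' = y - T v e y *s e"
    define z' where "z' = z - T v e z *s e"
    have yz': "T v e y' = 0" "T v e z' = 0" using orth by (simp_all add: y'_def z'_def)
    have "T v y' z' = 0"
      by (rule isotropic_polar[of "\<lambda>z. T v e z = 0"]) (use rank1 yz' in \<open>auto simp: T_simps\<close>)
    then show ?thesis
      using e comm23[of v y e] by (simp add: y'_def z'_def T_simps)
  qed
  then show ?thesis using that[OF lfun3] by blast
qed

text \<open>Leaving the hyperplane \<open>l = 0\<close> leads to a second point \<open>x'\<close>
  with its own kernel vector \<open>v'\<close> and linear form \<open>l'\<close>. The singular plane
  is spanned by \<open>v\<close>, \<open>v'\<close> and a further vector \<open>e\<close> on which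
  \<open>l\<close> and \<open>l'\<close> vanish.\<close>

lemma double_plane:
  assumes sk: "simple_kernel x v"
  shows determinantal
proof -
  obtain l where l: "lfun l" and ql: "\<And>y z. T v y z = l y * l z" using rank_one[OF sk] by blast
  have v0: "v \<noteq> 0" and F0: "F x \<noteq> 0" and xv: "\<And>w. T x v w = 0"
    and ker: "\<And>u. \<forall>w. T x u w = 0 \<Longrightarrow> u \<in> vec.span {v}"
    using sk by (auto simp: simple_kernel_def)
  obtain w where w: "l w \<noteq> 0" using no_vertex[OF v0] ql by auto
  have lx: "l x = 0"
  proof -
    have "l x * l w = 0" using xv[of w] ql comm12[of x v w] by simp
    then show ?thesis using w by simp
  qed
  obtain k where k: "v $ k \<noteq> 0" using v0 by (metis vec_eq_iff zero_index)
  \<comment> \<open>Adding the square of a form that is nonzero on \<open>v\<close> makes the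
    Hessian at \<open>x\<close> invertible. This persists at \<open>x + t *s w\<close> for general
    \<open>t\<close>, so the kernel at \<open>x'\<close> is again a line.\<close>
  define \<phi> :: "'a ^ 5 \<Rightarrow> 'a" where "\<phi> u = u $ k" for u
  have l\<phi>: "lfun \<phi>" by (rule lfunI) (simp_all add: \<phi>_def)
  then have l\<Phi>: "\<forall>f\<in>{\<phi>}. lfun f" by simp
  have "det (perturbed_hess {\<phi>} x) \<noteq> 0"
    unfolding det_nonzero_iff
  proof (intro allI impI)
    fix u assume "perturbed_hess {\<phi>} x *v u = 0"
    then have *: "T x y u + \<phi> y * \<phi> u = 0" for y unfolding perturbed_hess_kernel[OF l\<Phi>] by simp
    have "\<phi> u = 0" using *[of v] xv[of u] k by (simp add: \<phi>_def)
    then have "T x u y = 0" for y using *[of y] comm23[of x u y] by simp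
    then have "u \<in> vec.span {v}" using ker by blast
    then obtain c where "u = c *s v" by (auto simp: vec.span_singleton)
    then show "u = 0" using \<open>\<phi> u = 0\<close> k by (simp add: \<phi>_def)
  qed
  moreover obtain p where p: "\<And>t. det (pencil (perturbed_hess {\<phi>} x) (hess w) t) = poly p t"
    using det_pencil_poly by blast
  ultimately have "poly p 0 \<noteq> 0"
    using p[of 0] perturbed_hess_line[of "{\<phi>}" x 0 w] by (metis add.right_neutral vec.scale_zero_left)
  moreover have "[:F x, 3 * T x x w, 3 * T x w w, F w:] \<noteq> 0" using F0 by simp
  ultimately obtain t where t: "t \<noteq> 0" "poly p t \<noteq> 0" "poly [:F x, 3 * T x x w, 3 * T x w w, F w:] t \<noteq> 0"
    using poly_product_nonzero_point by blast
  define x' where "x' = x + t *s w"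
  have Fx': "F x' \<noteq> 0" using t(3) unfolding x'_def F_line
    by (simp add: algebra_simps power2_eq_square power3_eq_cube)
  have lx': "l x' \<noteq> 0" using t(1) w lx by (simp add: x'_def lfun_simps[OF l])
  have nonsing: "u = 0" if "\<phi> u = 0" "\<And>y. T x' u y = 0" for u
  proof -
    have "det (perturbed_hess {\<phi>} x') \<noteq> 0" using t(2) p[of t] unfolding x'_def perturbed_hess_line by simp
    moreover have "perturbed_hess {\<phi>} x' *v u = 0"
      unfolding perturbed_hess_kernel[OF l\<Phi>] using that comm23[of x' _ u] by simp
    ultimately show ?thesis unfolding det_nonzero_iff by blast
  qed
  obtain v' where v': "v' \<noteq> 0" "\<And>y. T x' v' y = 0" using kernel_vectorE by blast
  have "simple_kernel x' v'"
    unfolding simple_kernel_def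
  proof (intro conjI allI impI Fx' v')
    fix u assume u: "\<forall>w. T x' u w = 0"
    have \<phi>v: "\<phi> v' \<noteq> 0" using nonsing[of v'] v' by blast
    have "u - (\<phi> u / \<phi> v') *s v' = 0"
      by (rule nonsing) (use \<phi>v u v'(2) in \<open>simp_all add: lfun_simps[OF l\<phi>] T_simps\<close>)
    then have "u = (\<phi> u / \<phi> v') *s v'" by simp
    then show "u \<in> vec.span {v'}" by (metis vec.span_base vec.span_scale singletonI)
  qed
  then obtain l' where l': "lfun l'" and ql': "\<And>y z. T v' y z = l' y * l' z" using rank_one by blast
  obtain w' where w': "l' w' \<noteq> 0" using no_vertex[OF v'(1)] ql' by auto
  have l'x': "l' x' = 0"
  proof -
    have "l' x' * l' w' = 0" using v'(2)[of w'] ql' comm12[of x' v' w'] by simp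
    then show ?thesis using w' by simp
  qed
  have lv: "l v = 0" using ql[of v w] simple_kernel_singular[OF sk, of w] w by simp
  have l'v': "l' v' = 0"
    using ql'[of v' w'] simple_kernel_singular[OF \<open>simple_kernel x' v'\<close>, of w'] w' by simp
  \<comment> \<open>Both sides equal \<open>T v v' y\<close>. At \<open>x'\<close> the form
    \<open>l'\<close> vanishes and \<open>l\<close> does not, which gives
    \<open>l v' = 0\<close>.\<close>
  have cross: "l v' * l y = l' v * l' y" for y
    using ql[of v' y] ql'[of v y] comm12[of v v' y] by simp
  have lv': "l v' = 0" using cross[of x'] lx' l'x' by simp
  have l'v: "l' v = 0" using cross[of w'] lv' w' by simp
  define a where "a = (1 / l x') *s x'"
  have a: "l a = 1" "l' a = 0" using lx' l'x' by (simp_all add: a_def lfun_simps[OF l] lfun_simps[OF l'])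
  define b where "b = (1 / l' w') *s (w' - l w' *s a)"
  have b: "l b = 0" "l' b = 1" using w' a by (simp_all add: b_def lfun_simps[OF l] lfun_simps[OF l'])
  have vv': "v' \<notin> vec.span {v}"
  proof
    assume "v' \<in> vec.span {v}"
    then obtain c where c: "v' = c *s v" by (auto simp: vec.span_singleton)
    have "l' x' * l' x' = c * (l x' * l x')" using ql'[of x' x'] ql[of x' x'] by (simp add: c T_simps)
    then have "c = 0" using lx' l'x' by simp
    with c v'(1) show False by simp
  qed
  have "card {v, v', a, b} < 5" "finite {v, v', a, b}" by (auto simp: card_insert_if)
  then obtain e0 where e0: "e0 \<notin> vec.span {v, v', a, b}" using exists_not_in_span by blast
  define e where "e = e0 - l e0 *s a - l' e0 *s b"
  have e: "l e = 0" "l' e = 0" using a b by (simp_all add: e_def lfun_simps[OF l] lfun_simps[OF l'])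
  have ind: "indep5 v v' e a b"
    unfolding indep5_def
  proof (intro allI impI)
    fix r s t u w
    assume eq: "r *s v + s *s v' + t *s e + u *s a + w *s b = 0"
    have "l (r *s v + s *s v' + t *s e + u *s a + w *s b) = 0" "l' (r *s v + s *s v' + t *s e + u *s a + w *s b) = 0"
      unfolding eq by (simp_all add: lfun_simps[OF l] lfun_simps[OF l'])
    then have uw: "u = 0" "w = 0"
      using lv lv' l'v l'v' e a b by (simp_all add: lfun_simps[OF l] lfun_simps[OF l'])
    have t: "t = 0"
    proof (rule ccontr)
      assume t: "t \<noteq> 0"
      have "r *s v + s *s v' + (- t * l e0) *s a + (- t * l' e0) *s b + t *s e0 = 0"
        using eq uw by (simp add: e_def vec.scale_right_diff_distrib algebra_simps)
      from in_span_insertI[OF t this, of "{v, v', a, b}"] e0 show False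
        by (meson vec.span_add vec.span_scale vec.span_base insertI1 insertI2)
    qed
    have rs: "r *s v + s *s v' = 0" using eq uw t by simp
    have s: "s = 0"
    proof (rule ccontr)
      assume s: "s \<noteq> 0"
      from in_span_insertI[OF s rs, of "{v}"] vv' show False
        by (meson vec.span_scale vec.span_base insertI1)
    qed
    then have "r = 0" using rs v0 by (simp add: vec.scale_eq_0_iff)
    with s t uw show "r = 0 \<and> s = 0 \<and> t = 0 \<and> u = 0 \<and> w = 0" by simp
  qed
  \<comment> \<open>At a point \<open>y\<close> where \<open>l\<close>, \<open>l'\<close> and
    \<open>T e e _\<close> are all nonzero, the equations against the five basis vectors would
    annihilate the kernel vector.\<close>
  have Tee: "T e e y = 0" for y
  proof (rule ccontr)
    assume ne: "T e e y \<noteq> 0"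
    have "\<exists>y. l y * l' y * T e e y \<noteq> 0"
    proof (rule ccontr)
      assume z: "\<not> ?thesis"
      have "(\<forall>y. l y * l' y = 0) \<or> (\<forall>y. T e e y = 0)"
        by (rule polyfun_domain) (use z in \<open>auto intro!: pf_intros polyfun_lfun[OF l] polyfun_lfun[OF l']\<close>)
      with ne have "\<forall>y. l y * l' y = 0" by blast
      then have "l (a + b) * l' (a + b) = 0" by blast
      then show False using a b by (simp add: lfun_simps[OF l] lfun_simps[OF l'])
    qed
    then obtain y where y: "l y \<noteq> 0" "l' y \<noteq> 0" "T e e y \<noteq> 0" by auto
    obtain u where u: "u \<noteq> 0" "\<And>w. T y u w = 0" using kernel_vectorE by blast
    obtain r1 r2 r3 r4 r5 where ur: "u = r1 *s v + r2 *s v' + r3 *s e + r4 *s a + r5 *s b"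
      using indep5_expand[OF ind] .
    have yv: "T y z v = l y * l z" "T y z v' = l' y * l' z" for z
      using ql[of y z] ql'[of y z] by (metis comm12 comm23)+
    have "l u = 0" "l' u = 0" using u(2)[of v] u(2)[of v'] yv y by simp_all
    then have r45: "r4 = 0" "r5 = 0"
      unfolding ur using lv lv' l'v l'v' e a b by (simp_all add: lfun_simps[OF l] lfun_simps[OF l'])
    have yve: "T y v z = l y * l z" "T y v' z = l' y * l' z" for z
      using yv[of z] by (metis comm23)+
    have "r3 * T y e e = 0" using u(2)[of e] r45 e unfolding ur by (simp add: T_simps yve)
    moreover have "T y e e = T e e y" by (metis comm12 comm23)
    ultimately have r3: "r3 = 0" using y by simp
    have "r1 = 0" "r2 = 0" using u(2)[of a] u(2)[of b] r45 r3 a b y unfolding ur by (simp_all add: T_simps yve)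
    with r3 r45 u(1) ur show False by simp
  qed
  show ?thesis
    by (rule determinantal_if_double_plane[OF ind])
      (simp_all add: ql ql' lv lv' l'v l'v' e Tee)
qed

lemma determinantal_if_not_zero:
  assumes "F x0 \<noteq> 0"
  shows determinantal
proof -
  define m where "m = (LEAST n. \<exists>x. F x \<noteq> 0 \<and> vec.dim (ker_at x) = n)"
  have "\<exists>x. F x \<noteq> 0 \<and> vec.dim (ker_at x) = m"
    unfolding m_def by (rule LeastI[of "\<lambda>n. \<exists>x. F x \<noteq> 0 \<and> vec.dim (ker_at x) = n"]) (use assms in blast)
  then obtain x where x: "F x \<noteq> 0" "vec.dim (ker_at x) = m" by blast
  have min: "vec.dim (ker_at x) \<le> vec.dim (ker_at y)" if "F y \<noteq> 0" for y
    unfolding x(2) m_def by (rule Least_le) (use that in blast)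
  obtain v where v: "v \<noteq> 0" "\<And>w. T x v w = 0" using kernel_vectorE by blast
  then have vk: "v \<in> ker_at x" by (simp add: ker_at_def)
  have "u \<in> vec.span {v}" if "\<forall>w. T x u w = 0" for u
    by (rule corank_one[OF x(1) min v(1) vk]) (use that in \<open>auto simp: ker_at_def\<close>)
  with x v have "simple_kernel x v" by (simp add: simple_kernel_def)
  then show ?thesis by (rule double_plane)
qed

end

lemma determinantal_if_hessian_vanishes:
  fixes T :: "'a::{alg_closed_field, field_char_0} ^ 5 \<Rightarrow> 'a ^ 5 \<Rightarrow> 'a ^ 5 \<Rightarrow> 'a"
  assumes T: "sym_trilinear T" and irr: "\<not> sym_trilinear.linear_factor T"
    and nv: "\<And>v. v \<noteq> 0 \<Longrightarrow> \<exists>y z. T v y z \<noteq> 0"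
    and van: "\<And>x. T x x x = 0 \<Longrightarrow> det (sym_trilinear.hess T x) = 0"
  shows "sym_trilinear.determinantal T"
proof -
  interpret sym_trilinear T by fact
  have "\<exists>x. F x \<noteq> 0"
  proof (rule ccontr)
    assume "\<not> ?thesis"
    then have linear_factor
      unfolding linear_factor_def by (intro exI[of _ "\<lambda>_. 0"]) (auto simp: lfun_def intro: pf_intros)
    with irr show False ..
  qed
  then obtain x where x: "F x \<noteq> 0" by blast
  obtain c where c: "c ^ 3 = 1 / F x" using nth_root_exists[of 3 "1 / F x"] by auto
  have p: "F (c *s x) = 1"
  proof -
    have "F (c *s x) = c ^ 3 * F x" by (simp add: T_simps power3_eq_cube)
    then show ?thesis using c x by simp
  qed
  show ?thesis
  proof (cases "\<exists>y. det (hess y) \<noteq> 0")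
    case True
    then obtain y where "det (hess y) \<noteq> 0" by blast
    then show ?thesis by (intro determinantal_if_hessian_nonzero[OF T p irr van])
  next
    case False
    interpret zero_hessian_cubic T
      by unfold_locales (use nv False in auto)
    show ?thesis using determinantal_if_not_zero[OF x] .
  qed
qed

section \<open>Bounding transcendence degrees by counting\<close>

lemma homogeneous_system_solution:
  fixes c :: "'b \<Rightarrow> 'c \<Rightarrow> 'a::field"
  assumes "finite B" "finite A" "card B < card A"
  shows "\<exists>z. (\<exists>a\<in>A. z a \<noteq> 0) \<and> (\<forall>b\<in>B. (\<Sum>a\<in>A. z a * c a b) = 0)"
  using assms
proof (induction B arbitrary: A c rule: finite_induct)
  case empty
  then obtain a where "a \<in> A" by (metis card.empty equals0I less_irrefl)
  then show ?case by (intro exI[of _ "\<lambda>_. 1"]) auto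
next
  case (insert b B)
  show ?case
  proof (cases "\<forall>a\<in>A. c a b = 0")
    case True
    have "card B < card A" using insert by simp
    from insert.IH[OF insert.prems(1) this, of c]
    obtain z where "\<exists>a\<in>A. z a \<noteq> 0" "\<forall>b\<in>B. (\<Sum>a\<in>A. z a * c a b) = 0" by blast
    then show ?thesis using True by (intro exI[of _ z]) auto
  next
    case False
    then obtain a0 where a0: "a0 \<in> A" "c a0 b \<noteq> 0" by blast
    define c' where "c' a b' = c a b' - c a b / c a0 b * c a0 b'" for a b'
    have "card B < card (A - {a0})" "finite (A - {a0})" using insert a0 by auto
    from insert.IH[OF this(2,1), of c']
    obtain z where z: "\<exists>a\<in>A - {a0}. z a \<noteq> 0" "\<forall>b\<in>B. (\<Sum>a\<in>A - {a0}. z a * c' a b) = 0" by blast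
    define s where "s = (\<Sum>a\<in>A - {a0}. z a * c a b) / c a0 b"
    define z' where "z' a = (if a = a0 then - s else z a)" for a
    have sum: "(\<Sum>a\<in>A. z' a * c a b') = (\<Sum>a\<in>A - {a0}. z a * c a b') - s * c a0 b'" for b'
    proof -
      have "(\<Sum>a\<in>A - {a0}. z' a * c a b') = (\<Sum>a\<in>A - {a0}. z a * c a b')"
        by (intro sum.cong refl) (auto simp: z'_def)
      then show ?thesis using sum.remove[OF insert.prems(1) a0(1), of "\<lambda>a. z' a * c a b'"]
        by (simp add: z'_def)
    qed
    have "(\<Sum>a\<in>A. z' a * c a b) = 0" unfolding sum s_def using a0(2) by simp
    moreover have "(\<Sum>a\<in>A. z' a * c a b') = 0" if "b' \<in> B" for b'
    proof -
      have "(\<Sum>a\<in>A - {a0}. z a * c' a b') = (\<Sum>a\<in>A - {a0}. z a * c a b') - s * c a0 b'"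
        by (simp add: c'_def s_def ring_distribs sum_subtractf sum_distrib_right sum_divide_distrib mult.assoc)
      then show ?thesis unfolding sum using z(2) that by simp
    qed
    moreover have "\<exists>a\<in>A. z' a \<noteq> 0" using z(1) by (auto simp: z'_def)
    ultimately show ?thesis by (intro exI[of _ z']) auto
  qed
qed

definition spanfun :: "('y \<Rightarrow> 'a::field) set \<Rightarrow> 'y set \<Rightarrow> ('y \<Rightarrow> 'a) set" where
  "spanfun B Y = {f. \<exists>c. \<forall>y\<in>Y. f y = (\<Sum>b\<in>B. c b * b y)}"

lemma spanfun_base: "finite B \<Longrightarrow> b \<in> B \<Longrightarrow> b \<in> spanfun B Y"
  unfolding spanfun_def
  by (auto intro!: exI[of _ "\<lambda>b'. if b' = b then 1 else 0"] simp: if_distrib[of "\<lambda>x. x * _"] cong: if_cong)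

lemma spanfun_cong: "f \<in> spanfun B Y \<Longrightarrow> (\<And>y. y \<in> Y \<Longrightarrow> g y = f y) \<Longrightarrow> g \<in> spanfun B Y"
  unfolding spanfun_def by auto

lemma spanfun_0: "(\<lambda>_. 0) \<in> spanfun B Y"
  unfolding spanfun_def by (auto intro!: exI[of _ "\<lambda>_. 0"])

lemma spanfun_add: "f \<in> spanfun B Y \<Longrightarrow> g \<in> spanfun B Y \<Longrightarrow> (\<lambda>y. f y + g y) \<in> spanfun B Y"
  unfolding spanfun_def
proof safe
  fix c d assume "\<forall>y\<in>Y. f y = (\<Sum>b\<in>B. c b * b y)" "\<forall>y\<in>Y. g y = (\<Sum>b\<in>B. d b * b y)"
  then show "\<exists>c. \<forall>y\<in>Y. f y + g y = (\<Sum>b\<in>B. c b * b y)"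
    by (intro exI[of _ "\<lambda>b. c b + d b"]) (simp add: ring_distribs sum.distrib)
qed

lemma spanfun_scale: "f \<in> spanfun B Y \<Longrightarrow> (\<lambda>y. k * f y) \<in> spanfun B Y"
  unfolding spanfun_def
proof safe
  fix c assume "\<forall>y\<in>Y. f y = (\<Sum>b\<in>B. c b * b y)"
  then show "\<exists>c. \<forall>y\<in>Y. k * f y = (\<Sum>b\<in>B. c b * b y)"
    by (intro exI[of _ "\<lambda>b. k * c b"]) (simp add: sum_distrib_left mult.assoc)
qed

lemma spanfun_sum: "(\<And>i. i \<in> I \<Longrightarrow> f i \<in> spanfun B Y) \<Longrightarrow> (\<lambda>y. \<Sum>i\<in>I. f i y) \<in> spanfun B Y"
  by (induction I rule: infinite_finite_induct) (auto intro: spanfun_0 spanfun_add)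

lemma spanfun_mult:
  assumes "f \<in> spanfun B Y" "\<And>b. b \<in> B \<Longrightarrow> (\<lambda>y. h y * b y) \<in> spanfun B' Y"
  shows "(\<lambda>y. h y * f y) \<in> spanfun B' Y"
proof -
  obtain c where c: "\<forall>y\<in>Y. f y = (\<Sum>b\<in>B. c b * b y)" using assms(1) unfolding spanfun_def by blast
  have "(\<lambda>y. \<Sum>b\<in>B. c b * (h y * b y)) \<in> spanfun B' Y"
    by (intro spanfun_sum spanfun_scale assms(2))
  then show ?thesis
    by (rule spanfun_cong) (use c in \<open>simp add: sum_distrib_left mult_ac\<close>)
qed

text \<open>\<open>B m\<close> spans the functions that the forms of degree \<open>m\<close> induce
  on \<open>Y\<close> through \<open>\<xi>\<close>; the two conditions are the start and the step of
  an induction on the degree. The growth of \<open>card (B m)\<close> will bound the transcendence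
  degree.\<close>

locale graded_functions =
  fixes B :: "nat \<Rightarrow> ('y \<Rightarrow> 'a::field) set" and Y :: "'y set" and \<xi> :: "'y \<Rightarrow> 'i \<Rightarrow> 'a"
  assumes one: "(\<lambda>_. 1) \<in> spanfun (B 0) Y"
    and coord: "b \<in> B m \<Longrightarrow> (\<lambda>y. \<xi> y i * b y) \<in> spanfun (B (Suc m)) Y"
begin

lemma monomial_spanfun: "mon_deg m = d \<Longrightarrow> (\<lambda>y. mon_eval m (\<xi> y)) \<in> spanfun (B d) Y"
proof (induction d arbitrary: m)
  case 0
  then show ?case using one by (simp add: mon_deg_0_iff)
next
  case (Suc d)
  obtain i m' where m': "m = Poly_Mapping.single i 1 + m'" "mon_deg m' = d"
    using mon_deg_SucE[OF Suc.prems] .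
  have "(\<lambda>y. \<xi> y i * mon_eval m' (\<xi> y)) \<in> spanfun (B (Suc d)) Y"
    by (rule spanfun_mult[OF Suc.IH[OF m'(2)] coord])
  then show ?case by (simp add: m' mon_eval_add)
qed

lemma homogeneous_spanfun: "homogeneous d p \<Longrightarrow> (\<lambda>y. mp_eval p (\<xi> y)) \<in> spanfun (B d) Y"
  unfolding mp_eval_keys homogeneous_alt by (intro spanfun_sum spanfun_scale monomial_spanfun) auto

text \<open>There are \<open>N ^ r\<close> products of powers of the \<open>f i\<close> with
  exponents below \<open>N\<close>, and a power of \<open>g\<close> brings each of them to degree
  \<open>d * (r * N)\<close>. They lie in the span of fewer functions, so a nontrivial combination
  \<open>R\<close> vanishes on \<open>Y\<close>; \<open>Q\<close> is the same combination after
  division by \<open>g ^ (r * N)\<close>.\<close>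

lemma dependence:
  assumes d: "homogeneous d g" "\<And>i. i < r \<Longrightarrow> homogeneous d (f i)"
    and fin: "finite (B (d * (r * N)))" and card: "card (B (d * (r * N))) < N ^ r"
  obtains Q :: "(nat, 'a) mpoly" and R where "Q \<noteq> 0" "mp_vars Q \<subseteq> {..<r}" "homogeneous (d * (r * N)) R"
    "\<And>y. y \<in> Y \<Longrightarrow> mp_eval R (\<xi> y) = 0"
    "\<And>x. mp_eval g x \<noteq> 0 \<Longrightarrow>
       mp_eval R x = mp_eval g x ^ (r * N) * mp_eval Q (\<lambda>i. mp_eval (f i) x / mp_eval g x)"
proof -
  define A where "A = PiE {..<r} (\<lambda>_. {..<N})"
  have finA: "finite A" by (simp add: A_def finite_PiE)
  have cardA: "card A = N ^ r" by (simp add: A_def card_PiE)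
  define mm where "mm a = (\<Sum>i<r. Poly_Mapping.single i (a i :: nat))" for a
  have lookup_mm: "Poly_Mapping.lookup (mm a) i = (if i < r then a i else 0)" for a i
    by (auto simp: mm_def lookup_sum lookup_single when_def)
  have inj: "inj_on mm A"
  proof (rule inj_onI)
    fix a b assume ab: "a \<in> A" "b \<in> A" "mm a = mm b"
    then have "a i = b i" if "i \<in> {..<r}" for i using lookup_mm[of a i] lookup_mm[of b i] that by simp
    then show "a = b" using ab(1,2) unfolding A_def by (metis PiE_ext)
  qed
  have le: "(\<Sum>i<r. a i) \<le> r * N" if "a \<in> A" for a
  proof -
    have "(\<Sum>i<r. a i) \<le> (\<Sum>i<r. N)" using that by (intro sum_mono) (auto simp: A_def PiE_iff less_imp_le)
    then show ?thesis by simp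
  qed
  define P where "P a = g ^ (r * N - (\<Sum>i<r. a i)) * (\<Prod>i<r. f i ^ a i)" for a
  have homP: "homogeneous (d * (r * N)) (P a)" if "a \<in> A" for a
  proof -
    have "homogeneous (d * (r * N - (\<Sum>i<r. a i)) + (\<Sum>i<r. d * a i)) (P a)"
      unfolding P_def by (intro homogeneous_mult homogeneous_power homogeneous_prod d) auto
    moreover have "d * (r * N - (\<Sum>i<r. a i)) + (\<Sum>i<r. d * a i) = d * (r * N)"
      using le[OF that] by (simp flip: sum_distrib_left distrib_left)
    ultimately show ?thesis by simp
  qed
  have "\<forall>a\<in>A. \<exists>c. \<forall>y\<in>Y. mp_eval (P a) (\<xi> y) = (\<Sum>b\<in>B (d * (r * N)). c b * b y)"
    using homogeneous_spanfun[OF homP] unfolding spanfun_def by blast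
  then obtain c where c: "\<And>a y. a \<in> A \<Longrightarrow> y \<in> Y \<Longrightarrow>
      mp_eval (P a) (\<xi> y) = (\<Sum>b\<in>B (d * (r * N)). c a b * b y)" by metis
  obtain z where z: "\<exists>a\<in>A. z a \<noteq> 0" "\<forall>b\<in>B (d * (r * N)). (\<Sum>a\<in>A. z a * c a b) = 0"
    using homogeneous_system_solution[OF fin finA, of c] card cardA by auto
  define Q where "Q = (\<Sum>a\<in>A. Poly_Mapping.single (mm a) (z a))"
  define R where "R = (\<Sum>a\<in>A. mconst (z a) * P a)"
  show ?thesis
  proof (rule that[of Q R])
    show "Q \<noteq> 0"
    proof
      assume "Q = 0"
      obtain a where a: "a \<in> A" "z a \<noteq> 0" using z(1) by blast
      have "Poly_Mapping.lookup Q (mm a) = (\<Sum>b\<in>A. if b = a then z a else 0)"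
        unfolding Q_def lookup_sum
        by (intro sum.cong refl) (use a inj in \<open>auto simp: lookup_single when_def inj_on_def\<close>)
      then have "Poly_Mapping.lookup Q (mm a) = z a" using a finA by simp
      with \<open>Q = 0\<close> a show False by simp
    qed
    have "Poly_Mapping.keys Q \<subseteq> mm ` A"
      unfolding Q_def using keys_sum[of "\<lambda>a. Poly_Mapping.single (mm a) (z a)" A]
      by (fastforce split: if_splits)
    moreover have "Poly_Mapping.keys (mm a) \<subseteq> {..<r}" for a
      by (auto simp: in_keys_iff lookup_mm split: if_splits)
    ultimately show "mp_vars Q \<subseteq> {..<r}" unfolding mp_vars_def by blast
    show "homogeneous (d * (r * N)) R"
      unfolding R_def by (intro homogeneous_sum homogeneous_mconst_mult homP)
    show "mp_eval R (\<xi> y) = 0" if "y \<in> Y" for y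
    proof -
      have "mp_eval R (\<xi> y) = (\<Sum>a\<in>A. \<Sum>b\<in>B (d * (r * N)). z a * c a b * b y)"
        using that by (simp add: R_def c sum_distrib_left mult.assoc)
      also have "\<dots> = (\<Sum>b\<in>B (d * (r * N)). (\<Sum>a\<in>A. z a * c a b) * b y)"
        by (subst sum.swap) (simp add: sum_distrib_right)
      also have "\<dots> = 0" using z(2) by simp
      finally show ?thesis .
    qed
    show "mp_eval R x = mp_eval g x ^ (r * N) * mp_eval Q (\<lambda>i. mp_eval (f i) x / mp_eval g x)"
      if g: "mp_eval g x \<noteq> 0" for x
    proof -
      have "mp_eval R x = (\<Sum>a\<in>A. z a * (mp_eval g x ^ (r * N - (\<Sum>i<r. a i)) * (\<Prod>i<r. mp_eval (f i) x ^ a i)))"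
        by (simp add: R_def P_def)
      also have "\<dots> = (\<Sum>a\<in>A. mp_eval g x ^ (r * N) * (z a * (\<Prod>i<r. (mp_eval (f i) x / mp_eval g x) ^ a i)))"
      proof (intro sum.cong refl)
        fix a assume a: "a \<in> A"
        have "mp_eval g x ^ (r * N) = mp_eval g x ^ (r * N - (\<Sum>i<r. a i)) * (\<Prod>i<r. mp_eval g x ^ a i)"
          using le[OF a] by (simp flip: power_add power_sum)
        then show "z a * (mp_eval g x ^ (r * N - (\<Sum>i<r. a i)) * (\<Prod>i<r. mp_eval (f i) x ^ a i)) =
           mp_eval g x ^ (r * N) * (z a * (\<Prod>i<r. (mp_eval (f i) x / mp_eval g x) ^ a i))"
          using g by (simp add: power_divide prod_dividef)
      qed
      also have "\<dots> = mp_eval g x ^ (r * N) * mp_eval Q (\<lambda>i. mp_eval (f i) x / mp_eval g x)"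
        by (simp add: Q_def mm_def mon_eval_sum sum_distrib_left)
      finally show ?thesis .
    qed
  qed
qed

end

lemma alg_indep_rational_mono:
  "alg_indep_rational co Z r f g \<Longrightarrow> r' \<le> r \<Longrightarrow> alg_indep_rational co Z r' f g"
  unfolding alg_indep_rational_def by (meson lessThan_subset_iff order_trans)

lemma variety_dim_le:
  assumes "\<And>d f g. homogeneous d g \<Longrightarrow> (\<And>i. i \<le> k \<Longrightarrow> homogeneous d (f i)) \<Longrightarrow>
    \<not> alg_indep_rational co Z (Suc k) f g"
  shows "variety_dim co Z \<le> enat k"
  unfolding variety_dim_def
proof (rule Sup_least)
  fix e assume "e \<in> {enat r | r. \<exists>d f g. homogeneous d g \<and> \<not> vanishes_on co g Z \<and>
         (\<forall>i<r. homogeneous d (f i)) \<and> alg_indep_rational co Z r f g}"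
  then obtain r d f g where r: "e = enat r" "homogeneous d g" "\<forall>i<r. homogeneous d (f i)"
    "alg_indep_rational co Z r f g" by blast
  show "e \<le> enat k"
  proof (rule ccontr)
    assume "\<not> e \<le> enat k"
    then have "Suc k \<le> r" by (simp add: r(1))
    then have "alg_indep_rational co Z (Suc k) f g" using r(4) alg_indep_rational_mono by blast
    moreover have "homogeneous d (f i)" if "i \<le> k" for i using r(3) that \<open>Suc k \<le> r\<close> by simp
    ultimately show False using assms[OF r(2)] by blast
  qed
qed

lemma variety_dim_ge:
  assumes "homogeneous d g" "\<not> vanishes_on co g Z" "\<And>i. i < r \<Longrightarrow> homogeneous d (f i)"
    "alg_indep_rational co Z r f g"
  shows "enat r \<le> variety_dim co Z"
  unfolding variety_dim_def by (rule Sup_upper) (use assms in blast)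

section \<open>Cubic forms\<close>

lemma sym_trilinear_sum:
  assumes "\<And>m. m \<in> K \<Longrightarrow> sym_trilinear (T m)"
  shows "sym_trilinear (\<lambda>x y z. \<Sum>m\<in>K. c m * T m x y z)"
  unfolding sym_trilinear_def
proof (intro conjI allI)
  fix x y z w and r
  show "(\<Sum>m\<in>K. c m * T m (x + y) z w) = (\<Sum>m\<in>K. c m * T m x z w) + (\<Sum>m\<in>K. c m * T m y z w)"
    by (simp add: sym_trilinear.add1[OF assms] ring_distribs sum.distrib)
  show "(\<Sum>m\<in>K. c m * T m (r *s x) z w) = r * (\<Sum>m\<in>K. c m * T m x z w)"
    by (simp add: sym_trilinear.scale1[OF assms] sum_distrib_left mult_ac)
  show "(\<Sum>m\<in>K. c m * T m x y z) = (\<Sum>m\<in>K. c m * T m y x z)"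
    by (intro sum.cong refl) (metis sym_trilinear.comm12[OF assms])
  show "(\<Sum>m\<in>K. c m * T m x y z) = (\<Sum>m\<in>K. c m * T m x z y)"
    by (intro sum.cong refl) (metis sym_trilinear.comm23[OF assms])
qed

lemma cubic_form_polarization:
  fixes P :: "('n::finite, 'a::{alg_closed_field, field_char_0}) mpoly"
  assumes "homogeneous 3 P"
  obtains T :: "'a ^ 'n \<Rightarrow> 'a ^ 'n \<Rightarrow> 'a ^ 'n \<Rightarrow> 'a"
  where "sym_trilinear T" "\<And>x. mp_eval P (($) x) = T x x x"
proof -
  have ex: "\<exists>T :: 'a ^ 'n \<Rightarrow> 'a ^ 'n \<Rightarrow> 'a ^ 'n \<Rightarrow> 'a. sym_trilinear T \<and> (\<forall>x. mon_eval m (($) x) = T x x x)"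
    if "mon_deg m = 3" for m :: "'n \<Rightarrow>\<^sub>0 nat"
  proof -
    have "mon_deg m = Suc 2" using that by simp
    then obtain i m1 where m1: "m = Poly_Mapping.single i 1 + m1" "mon_deg m1 = 2" by (rule mon_deg_SucE)
    then have "mon_deg m1 = Suc 1" by simp
    then obtain j m2 where m2: "m1 = Poly_Mapping.single j 1 + m2" "mon_deg m2 = 1" by (rule mon_deg_SucE)
    then have "mon_deg m2 = Suc 0" by simp
    then obtain k m3 where m3: "m2 = Poly_Mapping.single k 1 + m3" "mon_deg m3 = 0" by (rule mon_deg_SucE)
    have ev: "mon_eval m (($) x) = x $ i * x $ j * x $ k" for x :: "'a ^ 'n"
      using m3(2) unfolding m1(1) m2(1) m3(1) by (simp add: mon_eval_add mon_deg_0_iff mult.assoc)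
    define T :: "'a ^ 'n \<Rightarrow> 'a ^ 'n \<Rightarrow> 'a ^ 'n \<Rightarrow> 'a" where
      "T x y z = (x $ i * y $ j * z $ k + x $ i * z $ j * y $ k + y $ i * x $ j * z $ k +
         y $ i * z $ j * x $ k + z $ i * x $ j * y $ k + z $ i * y $ j * x $ k) / 6" for x y z
    have "sym_trilinear T"
      by unfold_locales (simp_all add: T_def algebra_simps add_divide_distrib)
    moreover have "mon_eval m (($) x) = T x x x" for x
      unfolding ev T_def by simp
    ultimately show ?thesis by blast
  qed
  then have "\<forall>m. \<exists>T :: 'a ^ 'n \<Rightarrow> 'a ^ 'n \<Rightarrow> 'a ^ 'n \<Rightarrow> 'a. mon_deg m = 3 \<longrightarrow>
      sym_trilinear T \<and> (\<forall>x. mon_eval m (($) x) = T x x x)" by blast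
  from choice[OF this] obtain T :: "('n \<Rightarrow>\<^sub>0 nat) \<Rightarrow> 'a ^ 'n \<Rightarrow> 'a ^ 'n \<Rightarrow> 'a ^ 'n \<Rightarrow> 'a"
    where T: "\<And>m. mon_deg m = 3 \<Longrightarrow> sym_trilinear (T m)"
    "\<And>m x. mon_deg m = 3 \<Longrightarrow> mon_eval m (($) x) = T m x x x" by blast
  have deg: "mon_deg m = 3" if "m \<in> Poly_Mapping.keys P" for m
    using assms that by (simp add: homogeneous_alt)
  show ?thesis
  proof (rule that)
    show "sym_trilinear (\<lambda>x y z. \<Sum>m\<in>Poly_Mapping.keys P. Poly_Mapping.lookup P m * T m x y z)"
      by (rule sym_trilinear_sum) (use T deg in blast)
    show "mp_eval P (($) x) = (\<Sum>m\<in>Poly_Mapping.keys P. Poly_Mapping.lookup P m * T m x x x)" for x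
      unfolding mp_eval_keys by (intro sum.cong refl) (simp add: T deg)
  qed
qed

lemma mp_eval_vec_inject:
  fixes P Q :: "('n::finite, 'a::field_char_0) mpoly"
  assumes "\<And>x :: 'a ^ 'n. mp_eval P (($) x) = mp_eval Q (($) x)"
  shows "P = Q"
proof -
  have "mp_eval (P - Q) y = 0" for y
  proof -
    have "y = ($) (\<chi> i. y i)" by (simp add: fun_eq_iff)
    then show ?thesis using assms[of "\<chi> i. y i"] by (metis mp_eval_diff right_minus_eq)
  qed
  then have "P - Q = 0" by (rule mp_eval_inject)
  then show ?thesis by simp
qed

text \<open>Both factors vanish at 0, so neither is a unit.\<close>

lemma irreducible_no_linear_factor:
  fixes T :: "'a::{alg_closed_field, field_char_0} ^ 'n::finite \<Rightarrow> 'a ^ 'n \<Rightarrow> 'a ^ 'n \<Rightarrow> 'a"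
  assumes T: "sym_trilinear T" and ev: "\<And>x. mp_eval P (($) x) = T x x x" and irr: "irreducible P"
  shows "\<not> sym_trilinear.linear_factor T"
proof
  interpret sym_trilinear T by fact
  assume linear_factor
  then obtain l q where l: "lfun l" and q: "polyfun q" "q 0 = 0" "\<And>x. F x = l x * q x"
    unfolding linear_factor_def by blast
  obtain L where L: "\<forall>x. l x = mp_eval L (($) x)" using polyfun_imp_mp_eval[OF polyfun_lfun[OF l]] by blast
  obtain Q where Q: "\<forall>x. q x = mp_eval Q (($) x)" using polyfun_imp_mp_eval[OF q(1)] by blast
  have "P = L * Q" by (rule mp_eval_vec_inject) (simp add: ev q(3) L Q)
  then have "L dvd 1 \<or> Q dvd 1" using irreducibleD[OF irr] by blast
  moreover have "\<not> R dvd 1" if "mp_eval R (($) 0) = 0" for R :: "('n, 'a) mpoly"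
  proof
    assume "R dvd 1"
    then obtain S where S: "1 = R * S" by (rule dvdE)
    have "mp_eval 1 (($) (0 :: 'a ^ 'n)) = mp_eval (R * S) (($) 0)" by (simp only: S[symmetric])
    with that show False by simp
  qed
  ultimately show False using L Q q(2) lfun_simps(3)[OF l] by metis
qed


section \<open>Points of projective space\<close>

lemma Gr_0_iff: "L \<in> Gr 0 \<longleftrightarrow> (\<exists>x. x \<noteq> 0 \<and> L = vec.span {x})"
proof
  assume "L \<in> Gr 0"
  then have L: "vec.subspace L" "vec.dim L = 1" by (simp_all add: Gr_def)
  then obtain B where B: "B \<subseteq> L" "vec.independent B" "L \<subseteq> vec.span B" "card B = 1"
    using vec.basis_exists by metis
  then obtain x where x: "B = {x}" by (auto simp: card_1_singleton_iff)
  have "x \<noteq> 0" using B(2) x vec.dependent_zero by auto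
  moreover have "L = vec.span {x}"
    using B(1,3) x vec.span_minimal[OF _ L(1)] by blast
  ultimately show "\<exists>x. x \<noteq> 0 \<and> L = vec.span {x}" by blast
next
  assume "\<exists>x. x \<noteq> 0 \<and> L = vec.span {x}"
  then show "L \<in> Gr 0" by (auto simp: Gr_def)
qed

lemma span_singleton_in_Gr_0: "x \<noteq> 0 \<Longrightarrow> vec.span {x} \<in> Gr 0"
  unfolding Gr_0_iff by blast

lemma point_coords_span: "point_coords (vec.span {x}) = {($) (c *s x) | c. c *s x \<noteq> 0}"
  by (auto simp: point_coords_def vec.span_singleton)

lemma span_singleton_eqD:
  assumes "vec.span {x} = vec.span {y}" "y \<noteq> 0"
  obtains c where "c \<noteq> 0" "y = c *s x"
proof -
  have "y \<in> vec.span {x}" using assms(1) by (simp add: vec.span_base)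
  then obtain c where "y = c *s x" by (auto simp: vec.span_singleton)
  with assms(2) show ?thesis using that by auto
qed

lemma zariski_closure_subset:
  assumes "Z \<subseteq> U"
  shows "Z \<subseteq> zariski_closure co U Z"
  using assms by (auto simp: zariski_closure_def zero_locus_def forms_vanishing_on_def vanishes_on_def)

lemma vanishes_on_closure:
  "homogeneous d G \<Longrightarrow> vanishes_on co G Z \<Longrightarrow> vanishes_on co G (zariski_closure co U Z)"
  by (auto simp: zariski_closure_def zero_locus_def forms_vanishing_on_def vanishes_on_def)


section \<open>Irreducible cubic hypersurfaces\<close>

locale cubic_hypersurface = sym_trilinear T
  for T :: "'a::{alg_closed_field, field_char_0} ^ 5 \<Rightarrow> 'a ^ 5 \<Rightarrow> 'a ^ 5 \<Rightarrow> 'a" +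
  fixes Fm :: "(5, 'a) mpoly" and X :: "('a ^ 5) set set"
  assumes Fm: "\<And>x. mp_eval Fm (($) x) = T x x x"
    and homogeneous_Fm: "homogeneous 3 Fm"
    and no_linear_factor: "\<not> linear_factor"
    and X_def: "X = zero_locus point_coords proj_space {Fm}"
begin

lemma F_scale: "F (c *s x) = c ^ 3 * F x"
  by (simp add: T_simps power3_eq_cube)

lemma X_eq: "X = {vec.span {x} | x. x \<noteq> 0 \<and> F x = 0}"
proof
  show "X \<subseteq> {vec.span {x} | x. x \<noteq> 0 \<and> F x = 0}"
  proof
    fix L assume L: "L \<in> X"
    then obtain x where x: "x \<noteq> 0" "L = vec.span {x}" unfolding X_def zero_locus_def Gr_0_iff by blast
    have "($) x \<in> point_coords L" using x by (auto simp: point_coords_def vec.span_base)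
    then have "mp_eval Fm (($) x) = 0"
      using L unfolding X_def zero_locus_def vanishes_on_def by blast
    with x show "L \<in> {vec.span {x} | x. x \<noteq> 0 \<and> F x = 0}" by (auto simp: Fm)
  qed
  show "{vec.span {x} | x. x \<noteq> 0 \<and> F x = 0} \<subseteq> X"
    unfolding X_def zero_locus_def vanishes_on_def
    by (auto simp: point_coords_span Fm F_scale span_singleton_in_Gr_0)
qed

lemma span_in_X_iff: "x \<noteq> 0 \<Longrightarrow> vec.span {x} \<in> X \<longleftrightarrow> F x = 0"
proof
  assume x: "x \<noteq> 0" "vec.span {x} \<in> X"
  then obtain y where y: "vec.span {x} = vec.span {y}" "y \<noteq> 0" "F y = 0" unfolding X_eq by blast
  then obtain c where "c \<noteq> 0" "y = c *s x" using span_singleton_eqD by metis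
  then show "F x = 0" using y(3) F_scale by simp
qed (auto simp: X_eq)

lemma vanishes_on_X_iff:
  "vanishes_on point_coords G X \<longleftrightarrow> (\<forall>x. x \<noteq> 0 \<longrightarrow> F x = 0 \<longrightarrow> mp_eval G (($) x) = 0)"
proof safe
  fix x assume *: "vanishes_on point_coords G X" "x \<noteq> 0" "F x = 0"
  then have "vec.span {x} \<in> X" by (simp add: span_in_X_iff)
  moreover have "($) x \<in> point_coords (vec.span {x})"
    using \<open>x \<noteq> 0\<close> by (auto simp: point_coords_def vec.span_base)
  ultimately show "mp_eval G (($) x) = 0" using *(1) unfolding vanishes_on_def by blast
next
  assume *: "\<forall>x. x \<noteq> 0 \<longrightarrow> F x = 0 \<longrightarrow> mp_eval G (($) x) = 0"
  show "vanishes_on point_coords G X"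
    unfolding vanishes_on_def X_eq using * by (auto simp: point_coords_span F_scale)
qed

lemma F_not_zero: "\<exists>x. F x \<noteq> 0"
proof (rule ccontr)
  assume "\<not> ?thesis"
  then have linear_factor
    unfolding linear_factor_def by (intro exI[of _ "\<lambda>_. 0"]) (auto simp: lfun_def intro: pf_intros)
  with no_linear_factor show False ..
qed

lemma F_one:
  obtains p where "F p = 1"
proof -
  obtain x where x: "F x \<noteq> 0" using F_not_zero by blast
  obtain c where c: "c ^ 3 = 1 / F x" using nth_root_exists[of 3 "1 / F x"] by auto
  then have "F (c *s x) = 1" using x by (simp add: F_scale)
  then show ?thesis by (rule that)
qed

lemma vanishing_multiple:
  assumes "polyfun G" "\<And>x. x \<noteq> 0 \<Longrightarrow> F x = 0 \<Longrightarrow> G x = 0"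
  obtains S where "polyfun S" "\<And>x. G x = F x * S x"
proof -
  obtain p where p: "F p = 1" by (rule F_one)
  have "disc p 0 = 0" by (simp add: disc_def proj_def T_simps)
  then have "G x = 0" if "F x = 0" "disc p x \<noteq> 0" for x
    using assms(2)[of x] that by (cases "x = 0") auto
  from vanishing_imp_multiple[OF p disc_nonzero[OF p no_linear_factor] assms(1) this]
  show ?thesis using that by blast
qed

text \<open>Lines from \<open>v\<close> to points of \<open>X\<close> stay in \<open>X\<close>,
  since \<open>F (b *s y + a *s v) = b ^ 3 * F y\<close>; the closure adds nothing because
  \<open>Fm\<close> vanishes on these lines.\<close>

lemma vertex_imp_cone:
  assumes v: "v \<noteq> 0" "\<And>y z. T v y z = 0"
  shows "is_cone X"
proof -
  note vs = T_perm[OF v(2)]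
  let ?Z = "{r \<in> proj_space. \<exists>p\<in>{vec.span {v}}. \<exists>q\<in>X. r \<subseteq> vec.span (p \<union> q)}"
  have vX: "vec.span {v} \<in> X" using v by (simp add: span_in_X_iff)
  have Z: "?Z \<subseteq> X"
  proof
    fix r assume "r \<in> ?Z"
    then obtain q where r: "r \<in> Gr 0" "q \<in> X" "r \<subseteq> vec.span (vec.span {v} \<union> q)" by blast
    then obtain x y where x: "x \<noteq> 0" "r = vec.span {x}" and y: "F y = 0" "q = vec.span {y}"
      unfolding X_eq Gr_0_iff by blast
    have "x \<in> vec.span (vec.span {v} \<union> vec.span {y})" using r(3) x y by (meson subsetD vec.span_base singletonI)
    also have "\<dots> = vec.span ({v} \<union> {y})" by (simp only: vec.span_Un vec.span_span)
    finally have "\<exists>k l. x = k *s y + l *s v"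
      by (auto simp: vec.span_breakdown_eq vec.span_singleton algebra_simps; blast)
    then obtain a b where "x = b *s y + a *s v" by blast
    then have "F x = b ^ 3 * F y" by (simp add: T_simps vs power3_eq_cube)
    with y have "F x = 0" by simp
    then show "r \<in> X" using x by (simp add: span_in_X_iff)
  qed
  have XZ: "X \<subseteq> ?Z"
    unfolding X_eq by (auto simp: Gr_0_iff intro!: vec.span_base intro: bexI)
  have "join {vec.span {v}} X = X"
  proof
    show "X \<subseteq> join {vec.span {v}} X"
      unfolding join_def using XZ zariski_closure_subset[of ?Z proj_space point_coords] by blast
    show "join {vec.span {v}} X \<subseteq> X"
    proof
      fix r assume "r \<in> join {vec.span {v}} X"
      then have r: "r \<in> zariski_closure point_coords proj_space ?Z" unfolding join_def .
      have "vanishes_on point_coords Fm ?Z"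
        using Z unfolding X_def zero_locus_def vanishes_on_def by blast
      then have "Fm \<in> forms_vanishing_on point_coords ?Z"
        using homogeneous_Fm unfolding forms_vanishing_on_def by blast
      then show "r \<in> X" using r unfolding zariski_closure_def X_def zero_locus_def by blast
    qed
  qed
  with vX show ?thesis unfolding is_cone_def by blast
qed

lemma cubic_in_direction:
  "F p = 1 \<Longrightarrow> F (y + t *s p) = t ^ 3 + 3 * T p p y * t\<^sup>2 + 3 * T p y y * t + F y"
  unfolding F_line using T_perm[of p p y, OF refl] T_perm[of p y y, OF refl] by simp

lemma root_in_direction:
  assumes "F p = 1"
  obtains t where "F (y + t *s p) = 0"
proof -
  have "\<exists>t. poly [:F y, 3 * T p y y, 3 * T p p y, 1:] t = 0"
    by (rule alg_closed_imp_poly_has_root) simp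
  then obtain t where "poly [:F y, 3 * T p y y, 3 * T p p y, 1:] t = 0" by blast
  then have "F (y + t *s p) = 0"
    unfolding cubic_in_direction[OF assms] by (simp add: algebra_simps power2_eq_square power3_eq_cube)
  then show ?thesis by (rule that)
qed

end

definition mlin :: "('a::field ^ 'n::finite \<Rightarrow> 'a) \<Rightarrow> ('n, 'a) mpoly" where
  "mlin l = (\<Sum>i\<in>UNIV. mconst (l (axis i 1)) * mvar i)"

lemma mp_eval_mlin: "lfun l \<Longrightarrow> mp_eval (mlin l) (($) x) = l x"
  using lfun_expand[of l x] by (simp add: mlin_def mult.commute)

lemma homogeneous_mlin: "homogeneous 1 (mlin l)"
  unfolding mlin_def by (intro homogeneous_sum homogeneous_mconst_mult homogeneous_mvar)

section \<open>The dimension of the hypersurface\<close>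

text \<open>The projection from a point \<open>p\<close> outside of the hypersurface makes it finite over the
  hyperplane where the \<open>k\<close>-th coordinate vanishes.\<close>

locale cubic_projection = cubic_hypersurface +
  fixes p :: "'a ^ 5" and k j0 j1 j2 j3 :: 5
  assumes p: "F p = 1" and pk: "p $ k \<noteq> 0"
    and idx: "UNIV = {k, j0, j1, j2, j3}" "distinct [k, j0, j1, j2, j3]"
begin

definition tau :: "'a ^ 5 \<Rightarrow> 'a" where "tau x = x $ k / p $ k"

definition base :: "'a ^ 5 \<Rightarrow> 'a ^ 5" where "base x = x - tau x *s p"

lemma lfun_tau: "lfun tau"
  by (rule lfunI) (simp_all add: tau_def add_divide_distrib)

lemma lfun_base: "lfun (\<lambda>x. base x $ i)"
  by (rule lfunI) (simp_all add: base_def lfun_simps[OF lfun_tau] algebra_simps)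

lemma base_k [simp]: "base x $ k = 0"
  using pk by (simp add: base_def tau_def)

lemma decompose: "x = base x + tau x *s p"
  by (simp add: base_def)

text \<open>Monomials of degree \<open>e\<close> in the base coordinates and \<open>tau\<close>.
  With \<open>tau\<close> at most squared, as in \<open>Ix\<close>, they span all forms of degree
  \<open>e\<close> modulo the cubic equation. The truncated difference is exact on
  \<open>Ix e\<close>.\<close>

definition bmon :: "nat \<Rightarrow> nat \<times> nat \<times> nat \<times> nat \<Rightarrow> 'a ^ 5 \<Rightarrow> 'a" where
  "bmon e = (\<lambda>(a, b, c, i) x. base x $ j0 ^ (e - (a + b + c + i)) * base x $ j1 ^ a * base x $ j2 ^ b *
     base x $ j3 ^ c * tau x ^ i)"

definition Ix :: "nat \<Rightarrow> (nat \<times> nat \<times> nat \<times> nat) set" where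
  "Ix e = {(a, b, c, i). a + b + c + i \<le> e \<and> i \<le> 2}"

definition B :: "nat \<Rightarrow> ('a ^ 5 \<Rightarrow> 'a) set" where
  "B e = bmon e ` Ix e"

lemma Ix_subset: "Ix e \<subseteq> {..e} \<times> {..e} \<times> {..e} \<times> {..2}"
  by (auto simp: Ix_def)

lemma finite_B: "finite (B e)"
  unfolding B_def by (rule finite_imageI, rule finite_subset[OF Ix_subset]) auto

lemma card_B: "card (B e) \<le> 3 * (e + 1) ^ 3"
proof -
  have "card (B e) \<le> card (Ix e)"
    unfolding B_def by (rule card_image_le, rule finite_subset[OF Ix_subset]) auto
  also have "\<dots> \<le> card ({..e} \<times> {..e} \<times> {..e} \<times> {..2::nat})"
    by (rule card_mono[OF _ Ix_subset]) auto
  also have "\<dots> = 3 * (e + 1) ^ 3" by (simp add: card_cartesian_product power3_eq_cube algebra_simps)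
  finally show ?thesis .
qed

abbreviation (input) "Y \<equiv> {x. F x = 0}"

lemma mult_base: "f \<in> spanfun (B e) Y \<Longrightarrow> (\<lambda>x. base x $ j * f x) \<in> spanfun (B (Suc e)) Y"
proof (erule spanfun_mult)
  fix g assume "g \<in> B e"
  then obtain a b c i where g: "g = bmon e (a, b, c, i)" and I: "a + b + c + i \<le> e" "i \<le> 2"
    by (auto simp: B_def Ix_def)
  have mem: "bmon (Suc e) t \<in> spanfun (B (Suc e)) Y" if "t \<in> Ix (Suc e)" for t
    by (rule spanfun_base[OF finite_B]) (use that in \<open>simp add: B_def\<close>)
  have "j \<in> {k, j0, j1, j2, j3}" using idx(1) by blast
  then consider "j = k" | "j = j0" | "j = j1" | "j = j2" | "j = j3" by blast
  then show "(\<lambda>x. base x $ j * g x) \<in> spanfun (B (Suc e)) Y"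
  proof cases
    case 1 then show ?thesis using spanfun_0 by simp
  next
    case 2
    show ?thesis
      by (rule spanfun_cong[OF mem[of "(a, b, c, i)"]]) (use I 2 in \<open>simp_all add: g bmon_def Ix_def Suc_diff_le\<close>)
  next
    case 3
    show ?thesis
      by (rule spanfun_cong[OF mem[of "(Suc a, b, c, i)"]]) (use I 3 in \<open>simp_all add: g bmon_def Ix_def\<close>)
  next
    case 4
    show ?thesis
      by (rule spanfun_cong[OF mem[of "(a, Suc b, c, i)"]]) (use I 4 in \<open>simp_all add: g bmon_def Ix_def\<close>)
  next
    case 5
    show ?thesis
      by (rule spanfun_cong[OF mem[of "(a, b, Suc c, i)"]]) (use I 5 in \<open>simp_all add: g bmon_def Ix_def\<close>)
  qed
qed

lemma mult_lfun_base:
  assumes "\<And>x. lfun (l x)" "\<And>i. (\<lambda>x. l x (axis i 1) * f x) \<in> spanfun (B e) Y"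
  shows "(\<lambda>x. l x (base x) * f x) \<in> spanfun (B (Suc e)) Y"
proof -
  have "(\<lambda>x. \<Sum>i\<in>UNIV. base x $ i * (l x (axis i 1) * f x)) \<in> spanfun (B (Suc e)) Y"
    by (intro spanfun_sum mult_base assms)
  then show ?thesis
    by (rule spanfun_cong) (simp add: lfun_expand[OF assms(1), of _ "base _"] sum_distrib_left sum_distrib_right mult_ac)
qed

lemma mult_linear: "f \<in> spanfun (B e) Y \<Longrightarrow> (\<lambda>x. T u v (base x) * f x) \<in> spanfun (B (Suc e)) Y"
  by (rule mult_lfun_base[of "\<lambda>_ z. T u v z"]) (auto intro: lfun3 spanfun_scale)

lemma mult_quadratic: "f \<in> spanfun (B e) Y \<Longrightarrow> (\<lambda>x. T u (base x) (base x) * f x) \<in> spanfun (B (Suc (Suc e))) Y"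
proof (rule mult_lfun_base[of "\<lambda>x z. T u (base x) z"])
  fix i
  assume f: "f \<in> spanfun (B e) Y"
  show "(\<lambda>x. T u (base x) (axis i 1) * f x) \<in> spanfun (B (Suc e)) Y"
    by (rule spanfun_cong[OF mult_linear[OF f, of u "axis i 1"]]) (metis comm23)
qed (rule lfun3)

lemma mult_cubic: "f \<in> spanfun (B e) Y \<Longrightarrow> (\<lambda>x. F (base x) * f x) \<in> spanfun (B (Suc (Suc (Suc e)))) Y"
proof (rule mult_lfun_base[of "\<lambda>x z. T (base x) (base x) z"])
  fix i
  assume f: "f \<in> spanfun (B e) Y"
  show "(\<lambda>x. T (base x) (base x) (axis i 1) * f x) \<in> spanfun (B (Suc (Suc e))) Y"
    by (rule spanfun_cong[OF mult_quadratic[OF f, of "axis i 1"]]) (metis comm12 comm23)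
qed (rule lfun3)

lemma mult_tau:
  assumes "f \<in> spanfun (B e) Y"
  shows "(\<lambda>x. tau x * f x) \<in> spanfun (B (Suc e)) Y"
  using assms
proof (rule spanfun_mult)
  fix g assume "g \<in> B e"
  then obtain a b c i where g: "g = bmon e (a, b, c, i)" and I: "a + b + c + i \<le> e" "i \<le> 2"
    by (auto simp: B_def Ix_def)
  have mem: "bmon e t \<in> spanfun (B e) Y" if "t \<in> Ix e" for e t
    by (rule spanfun_base[OF finite_B]) (use that in \<open>simp add: B_def\<close>)
  show "(\<lambda>x. tau x * g x) \<in> spanfun (B (Suc e)) Y"
  proof (cases "i = 2")
    case False
    show ?thesis
      by (rule spanfun_cong[OF mem[of "(a, b, c, Suc i)"]])
        (use I False in \<open>simp_all add: g bmon_def Ix_def mult_ac\<close>)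
  next
    case True
    define e' where "e' = e - 2"
    have e: "e = Suc (Suc e')" using I True by (simp add: e'_def)
    have abc: "a + b + c \<le> e'" using I True e by simp
    have m0: "bmon e' (a, b, c, 0) \<in> spanfun (B e') Y"
      and m1: "bmon (Suc e') (a, b, c, 1) \<in> spanfun (B (Suc e')) Y"
      and m2: "bmon (Suc (Suc e')) (a, b, c, 2) \<in> spanfun (B (Suc (Suc e'))) Y"
      using abc by (auto intro!: mem simp: Ix_def)
    have "(\<lambda>x. (- 3) * (T p p (base x) * bmon (Suc (Suc e')) (a, b, c, 2) x) +
       ((- 3) * (T p (base x) (base x) * bmon (Suc e') (a, b, c, 1) x) +
       (- 1) * (F (base x) * bmon e' (a, b, c, 0) x))) \<in> spanfun (B (Suc e)) Y"
      unfolding e by (intro spanfun_add spanfun_scale mult_linear mult_quadratic mult_cubic m0 m1 m2)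
    then show ?thesis
    proof (rule spanfun_cong)
      fix x assume "x \<in> Y"
      then have "F (base x + tau x *s p) = 0" using decompose[of x] by simp
      then have z: "tau x ^ 3 + 3 * T p p (base x) * (tau x)\<^sup>2 + 3 * T p (base x) (base x) * tau x + F (base x) = 0"
        unfolding cubic_in_direction[OF p] .
      define m where "m = bmon e' (a, b, c, 0) x"
      have "bmon (Suc (Suc e')) (a, b, c, 2) x = m * (tau x)\<^sup>2" "bmon (Suc e') (a, b, c, 1) x = m * tau x"
        "g x = m * (tau x)\<^sup>2"
        using abc by (simp_all add: m_def bmon_def g e True)
      moreover have "tau x * (m * (tau x)\<^sup>2) = (- 3) * (T p p (base x) * (m * (tau x)\<^sup>2)) +
        ((- 3) * (T p (base x) (base x) * (m * tau x)) + (- 1) * (F (base x) * m))"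
        using z by algebra
      ultimately show "tau x * g x = (- 3) * (T p p (base x) * bmon (Suc (Suc e')) (a, b, c, 2) x) +
       ((- 3) * (T p (base x) (base x) * bmon (Suc e') (a, b, c, 1) x) +
       (- 1) * (F (base x) * bmon e' (a, b, c, 0) x))" by (simp only: m_def[symmetric])
    qed
  qed
qed

sublocale graded_functions B Y "\<lambda>x i. x $ i"
proof
  show "(\<lambda>_. 1) \<in> spanfun (B 0) Y"
  proof (rule spanfun_cong)
    show "bmon 0 (0, 0, 0, 0) \<in> spanfun (B 0) Y"
      by (rule spanfun_base[OF finite_B]) (auto simp: B_def Ix_def)
  qed (simp add: bmon_def)
next
  fix g i m assume "g \<in> B m"
  then have g: "g \<in> spanfun (B m) Y" by (rule spanfun_base[OF finite_B])
  have "(\<lambda>x. base x $ i * g x + p $ i * (tau x * g x)) \<in> spanfun (B (Suc m)) Y"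
    by (intro spanfun_add spanfun_scale mult_base mult_tau g)
  then show "(\<lambda>x. x $ i * g x) \<in> spanfun (B (Suc m)) Y"
    by (rule spanfun_cong) (simp add: base_def algebra_simps)
qed

text \<open>\<open>card (B m)\<close> grows at most like \<open>m ^ 3\<close>, against
  \<open>N ^ 4\<close> monomials in four functions; \<open>N\<close> is chosen just above
  \<open>3 * (4 * d + 1) ^ 3\<close> for this reason.\<close>

lemma dim_upper: "variety_dim point_coords X \<le> enat 3"
proof (rule variety_dim_le)
  fix d and f :: "nat \<Rightarrow> (5, 'a) mpoly" and g :: "(5, 'a) mpoly"
  assume d: "homogeneous d g" "\<And>i. i \<le> 3 \<Longrightarrow> homogeneous d (f i)"
  define N where "N = 3 * (4 * d + 1) ^ 3 + 1"
  have N1: "N \<ge> 1" by (simp add: N_def)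
  have "card (B (d * (4 * N))) \<le> 3 * (d * (4 * N) + 1) ^ 3" by (rule card_B)
  also have "\<dots> \<le> 3 * ((4 * d + 1) * N) ^ 3"
    using N1 by (intro mult_left_mono power_mono) (auto simp: algebra_simps)
  also have "\<dots> = (3 * (4 * d + 1) ^ 3) * N ^ 3" by (simp only: power_mult_distrib mult.assoc)
  also have "\<dots> < N * N ^ 3" using N1 by (intro mult_strict_right_mono) (auto simp: N_def)
  also have "\<dots> = N ^ 4" by (simp add: power_numeral_reduce)
  finally have card: "card (B (d * (4 * N))) < N ^ 4" .
  have d': "homogeneous d (f i)" if "i < 4" for i using d(2) that by simp
  obtain Q R where Q: "Q \<noteq> 0" "mp_vars Q \<subseteq> {..<4}"
    and "homogeneous (d * (4 * N)) R"
    and R: "\<And>x. x \<in> Y \<Longrightarrow> mp_eval R (($) x) = 0"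
    "\<And>x. mp_eval g x \<noteq> 0 \<Longrightarrow>
       mp_eval R x = mp_eval g x ^ (4 * N) * mp_eval Q (\<lambda>i. mp_eval (f i) x / mp_eval g x)"
    by (rule dependence[OF d(1) d' finite_B card]) (assumption, rule that)
  have "mp_eval Q (\<lambda>i. mp_eval (f i) x / mp_eval g x) = 0"
    if zx: "z \<in> X" "x \<in> point_coords z" "mp_eval g x \<noteq> 0" for z x
  proof -
    obtain w c where "F w = 0" "x = ($) (c *s w)"
      using zx(1,2) unfolding X_eq by (auto simp: point_coords_span)
    then obtain v where "F v = 0" "x = ($) v" using F_scale[of c w] by auto
    then have "mp_eval R x = 0" using R(1) by simp
    then show ?thesis using R(2)[OF zx(3)] zx(3) by simp
  qed
  then show "\<not> alg_indep_rational point_coords X (Suc 3) f g"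
    unfolding alg_indep_rational_def using Q by auto
qed

text \<open>Every line in direction \<open>p\<close> meets the hypersurface, so three quotients of
  base coordinates take arbitrary values on it.\<close>

lemma dim_lower: "enat 3 \<le> variety_dim point_coords X"
proof -
  define js where "js i = (if i = 0 then j0 else if i = 1 then j1 else if i = (2::nat) then j2 else j3)" for i
  define f where "f i = mlin (\<lambda>x. base x $ js (Suc i))" for i
  define g where "g = mlin (\<lambda>x. base x $ j0)"
  have eval: "mp_eval (f i) (($) x) = base x $ js (Suc i)" "mp_eval g (($) x) = base x $ j0" for i x
    by (simp_all add: f_def g_def mp_eval_mlin lfun_base)
  have point: "\<exists>x. x \<noteq> 0 \<and> F x = 0 \<and> base x $ j0 = 1 \<and> (\<forall>i<3. base x $ js (Suc i) = a i)" for a :: "nat \<Rightarrow> 'a"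
  proof -
    define y where "y = axis j0 1 + a 0 *s axis j1 1 + a 1 *s axis j2 1 + a 2 *s axis j3 (1::'a)"
    obtain t where t: "F (y + t *s p) = 0" using root_in_direction[OF p] by blast
    have yk: "y $ k = 0" using idx(2) by (simp add: y_def axis_def)
    have "tau (y + t *s p) = t" using pk yk by (simp add: tau_def)
    then have b: "base (y + t *s p) = y" by (simp add: base_def)
    have y: "y $ j0 = 1" "y $ j1 = a 0" "y $ j2 = a 1" "y $ j3 = a 2"
      using idx(2) by (auto simp: y_def axis_def)
    have "base (y + t *s p) $ js (Suc i) = a i" if "i < 3" for i
    proof -
      have "i = 0 \<or> i = 1 \<or> i = 2" using that by auto
      then show ?thesis unfolding b by (auto simp: js_def y numeral_2_eq_2)
    qed
    moreover have "y + t *s p \<noteq> 0"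
    proof
      assume "y + t *s p = 0"
      then have "base (y + t *s p) $ j0 = 0" using lfun_simps(3)[OF lfun_base] by simp
      then show False unfolding b using y by simp
    qed
    ultimately show ?thesis using t b y by metis
  qed
  show ?thesis
  proof (rule variety_dim_ge)
    show "homogeneous 1 g" "\<And>i. i < 3 \<Longrightarrow> homogeneous 1 (f i)"
      unfolding f_def g_def by (rule homogeneous_mlin)+
    show "\<not> vanishes_on point_coords g X"
      unfolding vanishes_on_X_iff eval using point[of undefined] by (metis zero_neq_one)
    show "alg_indep_rational point_coords X 3 f g"
      unfolding alg_indep_rational_def
    proof (intro allI impI)
      fix Q :: "(nat, 'a) mpoly"
      assume vars: "mp_vars Q \<subseteq> {..<3}" and
        Q: "\<forall>z\<in>X. \<forall>x\<in>point_coords z. mp_eval g x \<noteq> 0 \<longrightarrow> mp_eval Q (\<lambda>i. mp_eval (f i) x / mp_eval g x) = 0"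
      show "Q = 0"
      proof (rule mp_eval_inject)
        fix a :: "nat \<Rightarrow> 'a"
        obtain x where x: "x \<noteq> 0" "F x = 0" "base x $ j0 = 1" "\<forall>i<3. base x $ js (Suc i) = a i"
          using point by blast
        have "vec.span {x} \<in> X" using x by (simp add: span_in_X_iff)
        moreover have "($) x \<in> point_coords (vec.span {x})"
          using x by (auto simp: point_coords_def vec.span_base)
        ultimately have "mp_eval Q (\<lambda>i. mp_eval (f i) (($) x) / mp_eval g (($) x)) = 0"
          using Q x(3) eval(2)[of x] by (metis zero_neq_one)
        also have "mp_eval Q (\<lambda>i. mp_eval (f i) (($) x) / mp_eval g (($) x)) = mp_eval Q a"
          by (rule mp_eval_cong) (use vars x in \<open>auto simp: eval\<close>)
        finally show "mp_eval Q a = 0" .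
      qed
    qed
  qed
qed

end

lemma (in cubic_hypersurface) variety_dim_X: "variety_dim point_coords X = enat 3"
proof -
  obtain p where p: "F p = 1" by (rule F_one)
  have "p \<noteq> 0" using p by (auto simp: T_simps)
  then obtain k where k: "p $ k \<noteq> 0" by (metis vec_eq_iff zero_index)
  obtain js where js: "set js = UNIV - {k}" "distinct js" using finite_distinct_list[of "UNIV - {k}"] by auto
  have "length js = 4" using distinct_card[OF js(2)] unfolding js(1) by (simp add: card_Diff_singleton)
  then obtain j0 j1 j2 j3 where js4: "js = [j0, j1, j2, j3]"
    by (auto simp: numeral_eq_Suc length_Suc_conv)
  have "UNIV = insert k (set js)" using js(1) by auto
  then have "UNIV = {k, j0, j1, j2, j3}" using js4 by simp
  moreover have "distinct [k, j0, j1, j2, j3]" using js js4 by auto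
  ultimately interpret cubic_projection T Fm X p k j0 j1 j2 j3
    using p k by unfold_locales
  show ?thesis using dim_upper dim_lower by (rule antisym)
qed

section \<open>Hyperplanes and their Pluecker coordinates\<close>

definition hyperplane :: "'a::field ^ 'n::finite \<Rightarrow> ('a ^ 'n) set" where
  "hyperplane n = {v. (\<Sum>i\<in>UNIV. n $ i * v $ i) = 0}"

lemma lfun_dot: "lfun (\<lambda>v. \<Sum>i\<in>UNIV. n $ i * v $ i)"
  by (rule lfunI) (simp_all add: ring_distribs sum.distrib sum_distrib_left mult.left_commute)

lemma dot_axis:
  fixes n :: "'a::field ^ 'n::finite"
  shows "(\<Sum>i\<in>UNIV. n $ i * axis j 1 $ i) = n $ j"
proof -
  have "(\<Sum>i\<in>UNIV. n $ i * axis j 1 $ i) = (\<Sum>i\<in>UNIV. if i = j then n $ j else 0)"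
    by (intro sum.cong refl) (auto simp: axis_def)
  then show ?thesis by simp
qed

lemma subspace_hyperplane: "vec.subspace (hyperplane n)"
  unfolding hyperplane_def vec.subspace_def mem_Collect_eq
  by (simp only: lfun_simps[OF lfun_dot]) simp

lemma hyperplane_axis_pair:
  fixes n :: "'a::field ^ 'n::finite"
  shows "n $ j *s axis i 1 - n $ i *s axis j 1 \<in> hyperplane n"
  unfolding hyperplane_def mem_Collect_eq
  by (simp only: lfun_simps[OF lfun_dot] dot_axis) simp

lemma dim_hyperplane:
  assumes "n \<noteq> 0"
  shows "vec.dim (hyperplane n :: ('a::field ^ 'n::finite) set) = CARD('n) - 1"
proof -
  obtain k where k: "n $ k \<noteq> 0" using assms by (metis vec_eq_iff zero_index)
  note pk = dot_axis[of n k]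
  have out: "axis k 1 \<notin> vec.span (hyperplane n)"
    using k pk subspace_hyperplane[of n] by (simp add: vec.span_eq_iff[THEN iffD2] hyperplane_def)
  have "v \<in> vec.span (insert (axis k 1) (hyperplane n))" for v
  proof -
    define c where "c = (\<Sum>i\<in>UNIV. n $ i * v $ i) / n $ k"
    have "(\<Sum>i\<in>UNIV. n $ i * (v - c *s axis k 1) $ i) =
        (\<Sum>i\<in>UNIV. n $ i * v $ i) - c * (\<Sum>i\<in>UNIV. n $ i * axis k 1 $ i)"
      by (simp only: lfun_simps[OF lfun_dot])
    also have "\<dots> = 0" unfolding pk c_def using k by simp
    finally have "v - c *s axis k 1 \<in> hyperplane n" by (simp add: hyperplane_def)
    then show ?thesis unfolding vec.span_breakdown_eq using vec.span_base by blast
  qed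
  then have "vec.dim (insert (axis k 1) (hyperplane n)) = vec.dim (UNIV :: ('a ^ 'n) set)"
    by (metis UNIV_eq_I vec.dim_span)
  then show ?thesis using out by (simp add: vec.dim_insert vec_dim_card del: vec.dim_UNIV)
qed

lemma hyperplane_in_Gr_iff: "hyperplane (n :: 'a::field ^ 5) \<in> Gr 3 \<longleftrightarrow> n \<noteq> 0"
proof
  assume "hyperplane n \<in> Gr 3"
  then have d: "vec.dim (hyperplane n) = 4" by (simp add: Gr_def)
  show "n \<noteq> 0"
  proof
    assume "n = 0"
    then have "hyperplane n = UNIV" by (simp add: hyperplane_def)
    then have "vec.dim (hyperplane n) = 5" by (simp add: vec_dim_card del: vec.dim_UNIV)
    with d show False by simp
  qed
qed (simp add: Gr_def subspace_hyperplane dim_hyperplane)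

lemma orthogonal_to_hyperplane:
  assumes "n \<noteq> 0" "\<And>v. v \<in> hyperplane n \<Longrightarrow> (\<Sum>i\<in>UNIV. m $ i * v $ i) = 0"
  obtains c where "m = c *s n"
proof -
  obtain k where k: "n $ k \<noteq> 0" using assms by (metis vec_eq_iff zero_index)
  have "m $ i = m $ k / n $ k * n $ i" for i
  proof -
    have "(\<Sum>j\<in>UNIV. m $ j * (n $ k *s axis i 1 - n $ i *s axis k 1) $ j) = n $ k * m $ i - n $ i * m $ k"
      by (simp only: lfun_simps[OF lfun_dot] dot_axis)
    then have "n $ k * m $ i - n $ i * m $ k = 0" using assms(2)[OF hyperplane_axis_pair] by metis
    then show ?thesis using k by (simp add: field_simps)
  qed
  then have "m = (m $ k / n $ k) *s n" unfolding vec_eq_iff vector_smult_component by blast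
  then show ?thesis by (rule that)
qed

section \<open>Maximal minors and the normal vector\<close>

lemma minor_4:
  fixes a b c d :: "'a::field ^ 'n::finite"
  defines "m3 \<equiv> \<lambda>j k l. b $ j * (c $ k * d $ l - c $ l * d $ k) - b $ k * (c $ j * d $ l - c $ l * d $ j)
     + b $ l * (c $ j * d $ k - c $ k * d $ j)"
  shows "minor [a, b, c, d] [i, j, k, l] =
    a $ i * m3 j k l - a $ j * m3 i k l + a $ k * m3 i j l - a $ l * m3 i j k"
proof -
  have set: "{..<length [a, b, c, d]} = insert 0 (insert 1 (insert 2 {3}))" by auto
  have fin: "finite {1::nat, 2, 3}" "0 \<notin> {1::nat, 2, 3}" "finite {2::nat, 3}" "1 \<notin> {2::nat, 3}"
    "finite {3::nat}" "2 \<notin> {3::nat}" by auto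
  show ?thesis
    unfolding minor_def set m3_def
    unfolding sum_over_permutations_insert[OF fin(1,2)] sum_over_permutations_insert[OF fin(3,4)]
      sum_over_permutations_insert[OF fin(5,6)] permutes_sing
    by (simp add: sign_swap_id permutation_swap_id sign_compose permutation_compose sign_id transpose_def)
      (simp add: algebra_simps)
qed

lemma minor_permute:
  assumes \<sigma>: "\<sigma> permutes {..<length vs}" and I: "length I = length vs"
  shows "minor vs I = of_int (sign \<sigma>) * minor vs (permute_list \<sigma> I)"
proof -
  let ?g = "\<lambda>\<pi>. of_int (sign \<pi>) * (\<Prod>j<length vs. (vs ! j) $ (I ! \<pi> j))"
  have "minor vs I = sum ?g {\<pi>. \<pi> permutes {..<length vs}}"
    using I by (simp add: minor_def)
  also have "\<dots> = sum (\<lambda>\<pi>. ?g (\<sigma> \<circ> \<pi>)) {\<pi>. \<pi> permutes {..<length vs}}"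
    by (rule setum_permutations_compose_left[OF \<sigma>])
  also have "\<dots> = of_int (sign \<sigma>) * minor vs (permute_list \<sigma> I)"
  proof -
    have "?g (\<sigma> \<circ> \<pi>) = of_int (sign \<sigma>) * (of_int (sign \<pi>) * (\<Prod>j<length vs. (vs ! j) $ (permute_list \<sigma> I ! \<pi> j)))"
      if \<pi>: "\<pi> permutes {..<length vs}" for \<pi>
    proof -
      have "permute_list \<sigma> I ! \<pi> j = I ! \<sigma> (\<pi> j)" if "j < length vs" for j
        using permutes_in_image[OF \<pi>, of j] that \<sigma> I by (intro permute_list_nth) auto
      moreover have "sign (\<sigma> \<circ> \<pi>) = sign \<sigma> * sign \<pi>"
        using \<sigma> \<pi> permutation_permutes by (intro sign_compose) blast+
      ultimately show ?thesis by (simp add: mult.assoc)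
    qed
    then show ?thesis using I by (simp add: minor_def sum_distrib_left)
  qed
  finally show ?thesis .
qed

lemma minor_repeated:
  fixes vs :: "('a::field_char_0 ^ 'n::finite) list"
  assumes "length I = length vs" "\<not> distinct I"
  shows "minor vs I = 0"
proof -
  obtain a b where ab: "a < length I" "b < length I" "a \<noteq> b" "I ! a = I ! b"
    using assms(2) by (auto simp: distinct_conv_nth)
  have t: "Transposition.transpose a b permutes {..<length vs}"
    using ab assms(1) by (intro permutes_swap_id) auto
  have "permute_list (Transposition.transpose a b) I = I"
    by (rule nth_equalityI) (use ab t assms(1) in \<open>auto simp: permute_list_nth Transposition.transpose_def\<close>)
  with minor_permute[OF t assms(1)] ab have "minor vs I = - minor vs I" by (simp add: sign_swap_id)
  then show ?thesis by (simp add: eq_neg_iff_add_eq_0)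
qed

lemma length_4E:
  assumes "length xs = 4"
  obtains a b c d where "xs = [a, b, c, d]"
  using assms by (auto simp: numeral_eq_Suc length_Suc_conv)

text \<open>The maximal minors of a basis of a hyperplane are, up to signs and a common factor,
  the coordinates of its normal vector.\<close>

definition normal_minors :: "5 list \<Rightarrow> ('a::field ^ 5) list \<Rightarrow> 'a ^ 5 \<Rightarrow> 'a \<Rightarrow> bool" where
  "normal_minors J vs n c \<longleftrightarrow> length vs = 4 \<and> (\<forall>j0 j1 j2 j3 j4. J = [j0, j1, j2, j3, j4] \<longrightarrow>
     minor vs [j1, j2, j3, j4] = c * n $ j0 \<and> minor vs [j0, j2, j3, j4] = - (c * n $ j1) \<and>
     minor vs [j0, j1, j3, j4] = c * n $ j2 \<and> minor vs [j0, j1, j2, j4] = - (c * n $ j3) \<and>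
     minor vs [j0, j1, j2, j3] = c * n $ j4)"

lemma sum_over_list5:
  assumes "UNIV = {j0, j1, j2, j3, j4 :: 5}" "distinct [j0, j1, j2, j3, j4]"
  shows "(\<Sum>i\<in>UNIV. f i) = f j0 + f j1 + f j2 + f j3 + (f j4 :: 'a::comm_monoid_add)"
  using assms(2) unfolding assms(1) by (simp add: ac_simps)

text \<open>The vector \<open>m\<close> of signed minors is orthogonal to each vector of
  \<open>vs\<close>, by a determinant with a repeated row, and is therefore a multiple of the normal
  vector.\<close>

lemma normal_minors_exists:
  fixes vs :: "('a::field ^ 5) list"
  assumes J: "UNIV = {j0, j1, j2, j3, j4 :: 5}" "distinct [j0, j1, j2, j3, j4]"
    and n: "n \<noteq> 0" and vs: "vec.span (set vs) = hyperplane n" "length vs = 4"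
  obtains c where "normal_minors [j0, j1, j2, j3, j4] vs n c"
proof -
  obtain a b c d where abcd: "vs = [a, b, c, d]" using length_4E[OF vs(2)] .
  define m :: "'a ^ 5" where "m = (\<chi> i. if i = j0 then minor vs [j1, j2, j3, j4] else
     if i = j1 then - minor vs [j0, j2, j3, j4] else if i = j2 then minor vs [j0, j1, j3, j4]
     else if i = j3 then - minor vs [j0, j1, j2, j4] else minor vs [j0, j1, j2, j3])"
  have m: "m $ j0 = minor vs [j1, j2, j3, j4]" "m $ j1 = - minor vs [j0, j2, j3, j4]"
    "m $ j2 = minor vs [j0, j1, j3, j4]" "m $ j3 = - minor vs [j0, j1, j2, j4]"
    "m $ j4 = minor vs [j0, j1, j2, j3]"
    using J(2) by (auto simp: m_def)
  have "(\<Sum>i\<in>UNIV. m $ i * v $ i) = 0" if "v \<in> {a, b, c, d}" for v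
    using that unfolding sum_over_list5[OF J] m abcd minor_4 by (auto simp: algebra_simps)
  then have "{a, b, c, d} \<subseteq> hyperplane m" by (auto simp: hyperplane_def)
  then have "hyperplane n \<subseteq> hyperplane m"
    unfolding vs(1)[symmetric] abcd by (simp add: vec.span_minimal subspace_hyperplane)
  then have "(\<Sum>i\<in>UNIV. m $ i * v $ i) = 0" if "v \<in> hyperplane n" for v
    using that by (auto simp: hyperplane_def)
  then obtain k where "m = k *s n" using orthogonal_to_hyperplane[OF n] by blast
  then have mk: "m $ i = k * n $ i" for i by simp
  have "normal_minors [j0, j1, j2, j3, j4] vs n k"
    unfolding normal_minors_def using m mk[of j0] mk[of j1] mk[of j2] mk[of j3] mk[of j4] vs(2)
    by (auto simp: minus_equation_iff[of "minor _ _"])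
  then show ?thesis by (rule that)
qed

text \<open>The coefficients \<open>e\<close> are the same for all hyperplanes and spanning lists,
  so every Pluecker coordinate is a fixed linear form in the normal vector, up to the common factor
  \<open>c\<close>. Lists with repetitions or of wrong length get 0; any other list is a permutation
  of one of the five in \<open>normal_minors\<close>.\<close>

lemma pluecker_linear:
  fixes J :: "5 list"
  assumes J: "UNIV = {j0, j1, j2, j3, j4 :: 5}" "distinct [j0, j1, j2, j3, j4]"
  shows "\<exists>e :: 5 list \<Rightarrow> 5 \<Rightarrow> 'a::field_char_0. \<forall>vs n c. normal_minors [j0, j1, j2, j3, j4] vs n c \<longrightarrow>
     (\<forall>I. minor vs I = c * (\<Sum>i\<in>UNIV. e I i * n $ i))"
proof -
  have single: "(\<Sum>i\<in>UNIV. (if i = j then s else 0) * (n::'a ^ 5) $ i) = s * n $ j" for s j n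
  proof -
    have "(\<Sum>i\<in>UNIV. (if i = j then s else 0) * n $ i) = (\<Sum>i\<in>UNIV. if i = j then s * n $ j else 0)"
      by (intro sum.cong refl) auto
    then show ?thesis by simp
  qed
  have "\<exists>e :: 5 \<Rightarrow> 'a. \<forall>vs n c. normal_minors [j0, j1, j2, j3, j4] vs n c \<longrightarrow>
     minor vs I = c * (\<Sum>i\<in>UNIV. e i * n $ i)" for I :: "5 list"
  proof (cases "length I = 4 \<and> distinct I")
    case False
    have "minor vs I = 0" if "normal_minors [j0, j1, j2, j3, j4] vs n c" for vs and n :: "'a ^ 5" and c
    proof -
      have "length vs = 4" using that by (simp add: normal_minors_def)
      with False show ?thesis using minor_repeated[of I vs] by (auto simp: minor_def)
    qed
    then show ?thesis by (intro exI[of _ "\<lambda>_. 0"]) auto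
  next
    case True
    have "card (UNIV - set I) = 1"
      using True by (simp add: card_Diff_subset distinct_card)
    then obtain j where j: "UNIV - set I = {j}" by (auto simp: card_1_singleton_iff)
    have setI: "set I = UNIV - {j}" using j by blast
    have key: ?thesis
      if K: "length K = 4" "distinct K" "set K = UNIV - {j}"
        and minorK: "\<And>vs n c. normal_minors [j0, j1, j2, j3, j4] vs n c \<Longrightarrow> minor vs K = c * (s * n $ j)"
      for K and s :: 'a
    proof -
      have "mset I = mset K" using True K setI by (metis set_eq_iff_mset_eq_distinct)
      then obtain \<sigma> where \<sigma>: "\<sigma> permutes {..<length K}" "permute_list \<sigma> K = I"
        by (rule mset_eq_permutation)
      have "minor vs I = c * (\<Sum>i\<in>UNIV. (if i = j then of_int (sign \<sigma>) * s else 0) * n $ i)"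
        if nm: "normal_minors [j0, j1, j2, j3, j4] vs n c" for vs n c
      proof -
        have len: "length vs = 4" using nm by (simp add: normal_minors_def)
        have "minor vs K = of_int (sign \<sigma>) * minor vs I"
          using minor_permute[of \<sigma> vs K] \<sigma> K len by simp
        then have "of_int (sign \<sigma>) * minor vs K = of_int (sign \<sigma>) * of_int (sign \<sigma>) * minor vs I"
          by (simp only: mult.assoc)
        also have "of_int (sign \<sigma>) * of_int (sign \<sigma>) = (1 :: 'a)" by (simp flip: of_int_mult)
        finally show ?thesis unfolding single using minorK[OF nm] by (simp add: mult_ac)
      qed
      then show ?thesis
        by (intro exI[of _ "\<lambda>i. if i = j then of_int (sign \<sigma>) * s else 0"]) blast
    qed
    have "j \<in> {j0, j1, j2, j3, j4}" using J(1) by blast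
    then consider "j = j0" | "j = j1" | "j = j2" | "j = j3" | "j = j4" by blast
    then show ?thesis
    proof cases
      case 1 then show ?thesis
        by (intro key[of "[j1, j2, j3, j4]" 1]) (use J in \<open>auto simp: normal_minors_def\<close>)
    next
      case 2 then show ?thesis
        by (intro key[of "[j0, j2, j3, j4]" "-1"]) (use J in \<open>auto simp: normal_minors_def\<close>)
    next
      case 3 then show ?thesis
        by (intro key[of "[j0, j1, j3, j4]" 1]) (use J in \<open>auto simp: normal_minors_def\<close>)
    next
      case 4 then show ?thesis
        by (intro key[of "[j0, j1, j2, j4]" "-1"]) (use J in \<open>auto simp: normal_minors_def\<close>)
    next
      case 5 then show ?thesis
        by (intro key[of "[j0, j1, j2, j3]" 1]) (use J in \<open>auto simp: normal_minors_def\<close>)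
    qed
  qed
  then have "\<forall>I. \<exists>e :: 5 \<Rightarrow> 'a. \<forall>vs n c. normal_minors [j0, j1, j2, j3, j4] vs n c \<longrightarrow>
     minor vs I = c * (\<Sum>i\<in>UNIV. e i * n $ i)" by blast
  from choice[OF this] show ?thesis by blast
qed

text \<open>In the columns \<open>j1, j2, j3, j4\<close> the vectors \<open>b j\<close> form
  \<open>n $ j0\<close> times the identity. The nonzero minor will show that the factor in
  \<open>normal_minors\<close> is nonzero.\<close>

lemma hyperplane_basis:
  fixes n :: "'a::field ^ 5"
  assumes J: "UNIV = {j0, j1, j2, j3, j4 :: 5}" "distinct [j0, j1, j2, j3, j4]" and n: "n $ j0 \<noteq> 0"
  obtains vs where "vec.span (set vs) = hyperplane n" "length vs = 4" "minor vs [j1, j2, j3, j4] \<noteq> 0"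
proof -
  define b where "b j = n $ j0 *s axis j 1 - n $ j *s axis j0 1" for j
  have b: "b j \<in> hyperplane n" for j unfolding b_def by (rule hyperplane_axis_pair)
  have b_nth: "b j $ i = (if i = j then n $ j0 else 0) - (if i = j0 then n $ j else 0)" for i j
    by (auto simp: b_def axis_def)
  show ?thesis
  proof (rule that[of "[b j1, b j2, b j3, b j4]"])
    show "vec.span (set [b j1, b j2, b j3, b j4]) = hyperplane n"
    proof
      show "vec.span (set [b j1, b j2, b j3, b j4]) \<subseteq> hyperplane n"
        by (rule vec.span_minimal[OF _ subspace_hyperplane]) (auto simp: b)
      show "hyperplane n \<subseteq> vec.span (set [b j1, b j2, b j3, b j4])"
      proof
        fix v assume "v \<in> hyperplane n"
        then have v: "n $ j0 * v $ j0 + n $ j1 * v $ j1 + n $ j2 * v $ j2 + n $ j3 * v $ j3 + n $ j4 * v $ j4 = 0"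
          unfolding hyperplane_def sum_over_list5[OF J] by simp
        let ?w = "(v $ j1 / n $ j0) *s b j1 + (v $ j2 / n $ j0) *s b j2 + (v $ j3 / n $ j0) *s b j3 + (v $ j4 / n $ j0) *s b j4"
        have "?w $ i = v $ i" for i
        proof -
          have i: "i = j0 \<or> i = j1 \<or> i = j2 \<or> i = j3 \<or> i = j4" using J(1) by blast
          have "n $ j0 * v $ j0 = - (n $ j1 * v $ j1 + n $ j2 * v $ j2 + n $ j3 * v $ j3 + n $ j4 * v $ j4)"
            using v by algebra
          then have "v $ j0 = - (n $ j1 * v $ j1 + n $ j2 * v $ j2 + n $ j3 * v $ j3 + n $ j4 * v $ j4) / n $ j0"
            using n by (simp add: nonzero_eq_divide_eq mult.commute)
          then show ?thesis using i J(2) n by (auto simp: b_nth add_divide_distrib diff_divide_distrib mult.commute)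
        qed
        then have "v = ?w" by (simp add: vec_eq_iff)
        also have "\<dots> \<in> vec.span (set [b j1, b j2, b j3, b j4])"
          by (intro vec.span_add vec.span_scale vec.span_base) auto
        finally show "v \<in> vec.span (set [b j1, b j2, b j3, b j4])" .
      qed
    qed
    show "minor [b j1, b j2, b j3, b j4] [j1, j2, j3, j4] \<noteq> 0"
      unfolding minor_4 using J(2) n by (auto simp: b_nth)
  qed simp
qed


section \<open>Tangent spaces and the dual variety\<close>

context cubic_hypersurface
begin

definition grad :: "'a ^ 5 \<Rightarrow> 'a ^ 5" where
  "grad x = (\<chi> i. T x x (axis i 1))"

lemma grad_nth: "grad x $ i = T x x (axis i 1)"
  by (simp add: grad_def)

lemma grad_pair: "(\<Sum>i\<in>UNIV. grad x $ i * v $ i) = T x x v"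
  by (simp add: grad_nth lfun_expand[OF lfun3, of x x v] mult.commute)

lemma hyperplane_grad: "hyperplane (grad x) = {v. T x x v = 0}"
  unfolding hyperplane_def grad_pair ..

lemma grad_0_iff: "grad x = 0 \<longleftrightarrow> (\<forall>v. T x x v = 0)"
proof
  assume "grad x = 0"
  then show "\<forall>v. T x x v = 0" using grad_pair[of x] by simp
qed (simp add: grad_def vec_eq_iff)

lemma directional_derivative:
  fixes G :: "(5, 'a) mpoly" and x v :: "'a ^ 5"
  obtains R where "\<And>t. poly R t = mp_eval G (($) (x + t *s v))"
    "poly (pderiv R) 0 = (\<Sum>i\<in>UNIV. mp_eval (mp_pderiv i G) (($) x) * v $ i)"
proof -
  define \<zeta> where "\<zeta> i = [:x $ i, v $ i:]" for i
  have fin: "finite (UNIV :: 5 set)" and vars: "mp_vars G \<subseteq> UNIV" by auto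
  obtain R where R: "\<And>t. poly R t = mp_eval G (\<lambda>i. poly (\<zeta> i) t)"
    "\<And>t. poly (pderiv R) t = (\<Sum>i\<in>UNIV. mp_eval (mp_pderiv i G) (\<lambda>i. poly (\<zeta> i) t) *
        poly (pderiv (\<zeta> i)) t)"
    using mp_eval_curve[OF fin vars, of \<zeta>] by blast
  have "(\<lambda>i. poly (\<zeta> i) t) = ($) (x + t *s v)" for t by (simp add: \<zeta>_def fun_eq_iff)
  moreover have "(\<lambda>i. poly (\<zeta> i) 0) = ($) x" by (simp add: \<zeta>_def fun_eq_iff)
  moreover have "poly (pderiv (\<zeta> i)) 0 = v $ i" for i by (simp add: \<zeta>_def pderiv_pCons)
  ultimately show ?thesis using that[of R] R(1) R(2)[of 0] by simp
qed

text \<open>A form vanishing on \<open>X\<close> is \<open>F\<close> times a polynomial function, so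
  in a direction with \<open>T x x v = 0\<close> it vanishes to second order at \<open>x\<close> and
  imposes no condition beyond that of \<open>F\<close>.\<close>

lemma tangent_space_eq:
  assumes x: "x \<noteq> 0" "F x = 0"
  shows "embedded_tangent_space X (vec.span {x}) = hyperplane (grad x)"
proof
  show "embedded_tangent_space X (vec.span {x}) \<subseteq> hyperplane (grad x)"
  proof
    fix v assume v: "v \<in> embedded_tangent_space X (vec.span {x})"
    have "vanishes_on point_coords Fm X" unfolding vanishes_on_X_iff by (simp add: Fm)
    then have "Fm \<in> forms_vanishing_on point_coords X"
      using homogeneous_Fm unfolding forms_vanishing_on_def by blast
    moreover have "($) x \<in> point_coords (vec.span {x})"
      using x by (auto simp: point_coords_def vec.span_base)
    ultimately have z: "(\<Sum>i\<in>UNIV. mp_eval (mp_pderiv i Fm) (($) x) * v $ i) = 0"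
      using v unfolding embedded_tangent_space_def by blast
    obtain R where R: "\<And>t. poly R t = mp_eval Fm (($) (x + t *s v))"
      "poly (pderiv R) 0 = (\<Sum>i\<in>UNIV. mp_eval (mp_pderiv i Fm) (($) x) * v $ i)"
      using directional_derivative by blast
    have "poly R t = poly [:F x, 3 * T x x v, 3 * T x v v, F v:] t" for t
      unfolding R(1) Fm F_line by (simp add: algebra_simps power2_eq_square power3_eq_cube)
    then have "R = [:F x, 3 * T x x v, 3 * T x v v, F v:]" using poly_eq_poly_eq_iff by blast
    then have "poly (pderiv R) 0 = 3 * T x x v" by (simp add: pderiv_pCons)
    then show "v \<in> hyperplane (grad x)" using z R(2) unfolding hyperplane_grad by simp
  qed
  show "hyperplane (grad x) \<subseteq> embedded_tangent_space X (vec.span {x})"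
  proof
    fix v assume "v \<in> hyperplane (grad x)"
    then have v: "T x x v = 0" by (simp add: hyperplane_grad)
    have "(\<Sum>i\<in>UNIV. mp_eval (mp_pderiv i G) y * v $ i) = 0"
      if G: "G \<in> forms_vanishing_on point_coords X" and y: "y \<in> point_coords (vec.span {x})" for G y
    proof -
      obtain c where c: "y = ($) (c *s x)" using y by (auto simp: point_coords_span)
      have "vanishes_on point_coords G X" using G by (simp add: forms_vanishing_on_def)
      then have "mp_eval G (($) w) = 0" if "w \<noteq> 0" "F w = 0" for w
        using that unfolding vanishes_on_X_iff by blast
      from vanishing_multiple[OF polyfun_mp_eval this]
      obtain S where S: "polyfun S" "\<And>x. mp_eval G (($) x) = F x * S x" by blast
      obtain s where s: "\<And>t. S (c *s x + t *s v) = poly s t" using polyfun_line[OF S(1)] by blast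
      obtain R where R: "\<And>t. poly R t = mp_eval G (($) (c *s x + t *s v))"
        "poly (pderiv R) 0 = (\<Sum>i\<in>UNIV. mp_eval (mp_pderiv i G) (($) (c *s x)) * v $ i)"
        using directional_derivative by blast
      have "poly R t = poly ([:0, 0, 3 * T (c *s x) v v, F v:] * s) t" for t
        unfolding R(1) S(2) F_line s using x(2) v
        by (simp add: T_simps algebra_simps power2_eq_square power3_eq_cube)
      then have "R = [:0, 0, 3 * T (c *s x) v v, F v:] * s" using poly_eq_poly_eq_iff by blast
      then have "poly (pderiv R) 0 = 0" by (simp add: pderiv_mult pderiv_pCons)
      then show ?thesis using R(2) c by simp
    qed
    then show "v \<in> embedded_tangent_space X (vec.span {x})"
      unfolding embedded_tangent_space_def by blast
  qed
qed

lemma gauss_image_eq: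
  "gauss_image 3 X = {hyperplane (grad x) | x. x \<noteq> 0 \<and> F x = 0 \<and> grad x \<noteq> 0}"
proof
  show "gauss_image 3 X \<subseteq> {hyperplane (grad x) | x. x \<noteq> 0 \<and> F x = 0 \<and> grad x \<noteq> 0}"
  proof
    fix L assume "L \<in> gauss_image 3 X"
    then obtain q where q: "q \<in> X" "L = embedded_tangent_space X q" "L \<in> Gr 3"
      unfolding gauss_image_def by blast
    then obtain x where x: "x \<noteq> 0" "F x = 0" "q = vec.span {x}" unfolding X_eq by blast
    then show "L \<in> {hyperplane (grad x) | x. x \<noteq> 0 \<and> F x = 0 \<and> grad x \<noteq> 0}"
      using q tangent_space_eq[OF x(1,2)] hyperplane_in_Gr_iff[of "grad x"] by auto
  qed
  show "{hyperplane (grad x) | x. x \<noteq> 0 \<and> F x = 0 \<and> grad x \<noteq> 0} \<subseteq> gauss_image 3 X"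
  proof
    fix L assume "L \<in> {hyperplane (grad x) | x. x \<noteq> 0 \<and> F x = 0 \<and> grad x \<noteq> 0}"
    then obtain x where x: "L = hyperplane (grad x)" "x \<noteq> 0" "F x = 0" "grad x \<noteq> 0" by blast
    have "L = embedded_tangent_space X (vec.span {x})" using x tangent_space_eq by simp
    moreover have "vec.span {x} \<in> X" using x by (simp add: span_in_X_iff)
    moreover have "L \<in> Gr 3" unfolding x(1) by (rule hyperplane_in_Gr_iff[THEN iffD2, OF x(4)])
    ultimately show "L \<in> gauss_image 3 X" unfolding gauss_image_def by blast
  qed
qed

lemma gauss_image_subset_Gr: "gauss_image 3 X \<subseteq> Gr 3"
  by (auto simp: gauss_image_def)

end

section \<open>Algebraic independence of components of the gradient\<close>

lemma homogenize:
  fixes Q :: "('i, 'a::field) mpoly"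
  obtains P M where "mp_vars P \<subseteq> insert n (mp_vars Q)"
    "\<And>z. z n \<noteq> 0 \<Longrightarrow> mp_eval P z = z n ^ M * mp_eval Q (\<lambda>i. z i / z n)"
proof -
  define M where "M = Max (mon_deg ` Poly_Mapping.keys Q)"
  define P where "P = (\<Sum>m\<in>Poly_Mapping.keys Q. Poly_Mapping.single (m + Poly_Mapping.single n (M - mon_deg m))
    (Poly_Mapping.lookup Q m))"
  have M: "mon_deg m \<le> M" if "m \<in> Poly_Mapping.keys Q" for m
    using that by (simp add: M_def)
  have "mp_vars P \<subseteq> insert n (mp_vars Q)"
  proof
    fix i assume "i \<in> mp_vars P"
    then obtain m' where m': "m' \<in> Poly_Mapping.keys P" "i \<in> Poly_Mapping.keys m'"
      by (auto simp: mp_vars_def)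
    have "Poly_Mapping.keys P \<subseteq> (\<Union>m\<in>Poly_Mapping.keys Q. {m + Poly_Mapping.single n (M - mon_deg m)})"
      unfolding P_def by (rule subset_trans[OF Poly_Mapping.keys_sum UN_mono]) (auto split: if_splits)
    then obtain m where m: "m \<in> Poly_Mapping.keys Q" "m' = m + Poly_Mapping.single n (M - mon_deg m)"
      using m'(1) by blast
    have "i \<in> Poly_Mapping.keys m \<or> i = n"
      using m'(2) unfolding m(2) keys_add_nat by (auto split: if_splits)
    with m(1) show "i \<in> insert n (mp_vars Q)" by (auto simp: mp_vars_def)
  qed
  moreover have "mp_eval P z = z n ^ M * mp_eval Q (\<lambda>i. z i / z n)" if "z n \<noteq> 0" for z
  proof -
    have "mp_eval Q (\<lambda>i. z i) = mp_eval Q (\<lambda>i. z n * (z i / z n))" using that by simp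
    have "mon_eval m z * z n ^ (M - mon_deg m) = z n ^ M * mon_eval m (\<lambda>i. z i / z n)"
      if m: "m \<in> Poly_Mapping.keys Q" for m
    proof -
      have "mon_eval m (\<lambda>i. z i / z n) = mon_eval m z / z n ^ mon_deg m"
        by (simp add: mon_eval_def mon_deg_def power_divide prod_dividef power_sum)
      then show ?thesis using M[OF m] \<open>z n \<noteq> 0\<close> by (simp add: power_diff)
    qed
    then show ?thesis
      unfolding P_def mp_eval_sum mp_eval_single mon_eval_add mon_eval_single mp_eval_keys[of Q]
      by (simp add: sum_distrib_left mult.left_commute cong: sum.cong)
  qed
  ultimately show ?thesis by (rule that)
qed

context cubic_hypersurface
begin

lemma grad_line: "grad (x + t *s w) $ i =
    poly [:grad x $ i, 2 * T x w (axis i 1), T w w (axis i 1):] t"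
  using comm12[of w x "axis i 1"] by (simp add: grad_nth T_simps algebra_simps)

lemma polyfun_grad: "polyfun (\<lambda>x. grad x $ i)"
  unfolding grad_nth by (intro pf_intros)

text \<open>Differentiating along the tangent directions of \<open>X\<close>: a linear relation between the
  differentials would be a multiple of the Euler vector.\<close>

lemma derivative_relation:
  assumes Q: "finite I" "mp_vars Q \<subseteq> I"
    "\<And>x. F x = 0 \<Longrightarrow> D x \<noteq> 0 \<Longrightarrow> mp_eval Q (\<lambda>i. grad x $ \<iota> i) = 0" and D: "polyfun D"
    and y: "F y = 0" "D y \<noteq> 0" and w: "T y y w = 0"
  shows "(\<Sum>i\<in>I. mp_eval (mp_pderiv i Q) (\<lambda>i. grad y $ \<iota> i) * T y w (axis (\<iota> i) 1)) = 0"
proof -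
  have "polyfun (\<lambda>x. mp_eval Q (\<lambda>i. grad x $ \<iota> i))"
    unfolding mp_eval_def by (intro pf_intros polyfun_grad)
  \<comment> \<open>The factor \<open>D\<close> turns a relation that holds where \<open>D\<close>
    is nonzero into one on the whole hypersurface.\<close>
  then have pf: "polyfun (\<lambda>x. mp_eval Q (\<lambda>i. grad x $ \<iota> i) * D x)" by (intro pf_intros D)
  have "mp_eval Q (\<lambda>i. grad x $ \<iota> i) * D x = 0" if "x \<noteq> 0" "F x = 0" for x
    using Q(3)[of x] that by auto
  from vanishing_multiple[OF pf this]
  obtain S where S: "polyfun S" "\<And>x. mp_eval Q (\<lambda>i. grad x $ \<iota> i) * D x = F x * S x" by blast
  obtain s where s: "\<And>t. S (y + t *s w) = poly s t" using polyfun_line[OF S(1)] by blast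
  obtain q where q: "\<And>t. D (y + t *s w) = poly q t" using polyfun_line[OF D] by blast
  define \<zeta> where "\<zeta> i = [:grad y $ \<iota> i, 2 * T y w (axis (\<iota> i) 1), T w w (axis (\<iota> i) 1):]" for i
  have \<zeta>: "poly (\<zeta> i) t = grad (y + t *s w) $ \<iota> i" for i t unfolding \<zeta>_def grad_line ..
  obtain R where R: "\<And>t. poly R t = mp_eval Q (\<lambda>i. poly (\<zeta> i) t)"
    "\<And>t. poly (pderiv R) t = (\<Sum>i\<in>I. mp_eval (mp_pderiv i Q) (\<lambda>i. poly (\<zeta> i) t) *
        poly (pderiv (\<zeta> i)) t)"
    using mp_eval_curve[OF Q(1,2), of \<zeta>] by blast
  \<comment> \<open>Since \<open>F y = 0\<close> and \<open>T y y w = 0\<close>, the restriction of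
    \<open>F\<close> to the line starts with the square of \<open>t\<close>.\<close>
  have "poly (R * q) t = poly ([:0, 0, 3 * T y w w, F w:] * s) t" for t
  proof -
    have "poly (R * q) t = F (y + t *s w) * poly s t"
      unfolding poly_mult R(1) \<zeta> q[symmetric] S(2) s[symmetric] ..
    then show ?thesis unfolding F_line using y(1) w
      by (simp add: algebra_simps power2_eq_square power3_eq_cube)
  qed
  then have Rq: "R * q = [:0, 0, 3 * T y w w, F w:] * s" using poly_eq_poly_eq_iff by blast
  have "poly (pderiv (R * q)) 0 = 0" unfolding Rq by (simp add: pderiv_mult pderiv_pCons)
  moreover have q0: "poly q 0 = D y" using q[of 0] by simp
  have R0: "poly R 0 = 0" unfolding R(1) \<zeta> using Q(3)[OF y] by simp
  ultimately have "poly (pderiv R) 0 = 0" using y(2) q0 R0 by (simp add: pderiv_mult)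
  then have "(\<Sum>i\<in>I. mp_eval (mp_pderiv i Q) (\<lambda>i. grad y $ \<iota> i) * (2 * T y w (axis (\<iota> i) 1))) = 0"
    unfolding R(2) \<zeta> by (simp add: \<zeta>_def pderiv_pCons)
  then have "2 * (\<Sum>i\<in>I. mp_eval (mp_pderiv i Q) (\<lambda>i. grad y $ \<iota> i) * T y w (axis (\<iota> i) 1)) = 0"
    unfolding sum_distrib_left by (simp add: mult.left_commute)
  then show ?thesis by simp
qed

text \<open>By \<open>rel\<close> the form \<open>T y _ \<Lambda>\<close> vanishes on the tangent
  hyperplane, so it is a multiple of \<open>T y y _\<close>, and invertibility of the Hessian makes
  \<open>\<Lambda>\<close> a multiple of \<open>y\<close>. The index \<open>j\<close> is left out
  because \<open>y $ j \<noteq> 0\<close> then forces this multiple to be zero.\<close>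

lemma derivatives_vanish:
  assumes I: "finite I" "inj_on \<iota> I" "j \<notin> \<iota> ` I" and i: "i \<in> I"
    and y: "y $ j \<noteq> 0" "det (hess y) \<noteq> 0"
    and rel: "\<And>w. T y y w = 0 \<Longrightarrow> (\<Sum>i\<in>I. \<gamma> i * T y w (axis (\<iota> i) 1)) = 0"
  shows "\<gamma> i = 0"
proof -
  define \<Lambda> where "\<Lambda> = (\<Sum>i\<in>I. \<gamma> i *s axis (\<iota> i) 1)"
  have nth: "\<Lambda> $ l = (\<Sum>i\<in>I. if \<iota> i = l then \<gamma> i else 0)" for l
    unfolding \<Lambda>_def sum_component by (intro sum.cong refl) (auto simp: axis_def)
  have T\<Lambda>: "T y w \<Lambda> = (\<Sum>i\<in>I. \<gamma> i * T y w (axis (\<iota> i) 1))" for w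
    unfolding \<Lambda>_def lfun_sum[OF lfun3] by (simp add: T_simps)
  have y0: "y \<noteq> 0" using y(1) by auto
  have inj: "v = 0" if "\<And>w. T y v w = 0" for v
    using y(2) that unfolding det_hess_0_iff by blast
  have "grad y \<noteq> 0"
    using inj[of y] y0 unfolding grad_0_iff by blast
  moreover have "(\<Sum>i\<in>UNIV. (\<chi> i. T y (axis i 1) \<Lambda>) $ i * v $ i) = 0" if "v \<in> hyperplane (grad y)" for v
  proof -
    have "T y v \<Lambda> = 0" using that rel unfolding hyperplane_grad T\<Lambda> by blast
    then show ?thesis by (simp add: lfun_expand[OF lfun2, of y v \<Lambda>] mult.commute)
  qed
  ultimately obtain c where c: "(\<chi> i. T y (axis i 1) \<Lambda>) = c *s grad y"
    by (rule orthogonal_to_hyperplane)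
  have "T y (axis i 1) \<Lambda> = c * T y y (axis i 1)" for i
    using arg_cong[OF c, of "\<lambda>v. v $ i"] by (simp add: grad_nth)
  then have "T y w \<Lambda> = c * T y y w" for w
    by (simp add: lfun_expand[OF lfun2, of y w \<Lambda>] lfun_expand[OF lfun3, of y y w] sum_distrib_left mult.left_commute)
  then have "T y (\<Lambda> - c *s y) w = 0" for w using comm23[of y \<Lambda> w] by (simp add: T_simps)
  then have \<Lambda>: "\<Lambda> = c *s y" using inj[of "\<Lambda> - c *s y"] by simp
  have "\<Lambda> $ j = 0" unfolding nth using I(3) by (intro sum.neutral) auto
  then have "\<Lambda> = 0" using y(1) unfolding \<Lambda> by simp
  then have "0 = (\<Sum>l\<in>I. if \<iota> l = \<iota> i then \<gamma> l else 0)" using nth[of "\<iota> i"] by simp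
  also have "\<dots> = (\<Sum>l\<in>I. if l = i then \<gamma> l else 0)"
    using I(2) i by (intro sum.cong refl) (auto dest: inj_onD)
  finally show ?thesis using I(1) i by simp
qed

text \<open>\<open>mp_zero_by_derivatives\<close> is applied to the gradients at points of the
  hypersurface where \<open>D\<close> is nonzero: by the two preceding lemmas, a relation valid
  there passes to its partial derivatives.\<close>

lemma gradient_independent:
  assumes I: "finite I" "inj_on \<iota> I" "j \<notin> \<iota> ` I"
    and x: "F x = 0" "grad x $ k \<noteq> 0" "x $ j \<noteq> 0" "det (hess x) \<noteq> 0"
    and Q: "mp_vars Q \<subseteq> I"
    "\<And>y. F y = 0 \<Longrightarrow> grad y $ k \<noteq> 0 \<Longrightarrow> y $ j \<noteq> 0 \<Longrightarrow> det (hess y) \<noteq> 0 \<Longrightarrow> mp_eval Q (\<lambda>i. grad y $ \<iota> i) = 0"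
  shows "Q = 0"
proof -
  define D where "D y = grad y $ k * y $ j * det (hess y)" for y
  have D: "polyfun D" unfolding D_def by (intro pf_intros polyfun_grad polyfun_det_hess)
  let ?U = "(\<lambda>y i. grad y $ \<iota> i) ` {y. F y = 0 \<and> D y \<noteq> 0}"
  show ?thesis
  proof (rule mp_zero_by_derivatives)
    show "(\<lambda>i. grad x $ \<iota> i) \<in> ?U" using x by (intro imageI) (simp add: D_def)
    show "mp_vars Q \<subseteq> I" by (rule Q(1))
    show "mp_eval Q z = 0" if "z \<in> ?U" for z using that Q(2) by (auto simp: D_def)
  next
    fix P i z assume P: "mp_vars P \<subseteq> I" "i \<in> I" "\<And>z. z \<in> ?U \<Longrightarrow> mp_eval P z = 0" and "z \<in> ?U"
    then obtain y where y: "F y = 0" "D y \<noteq> 0" "z = (\<lambda>i. grad y $ \<iota> i)" by blast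
    have "mp_eval P (\<lambda>i. grad y $ \<iota> i) = 0" if "F y = 0" "D y \<noteq> 0" for y
      using that by (intro P(3)) blast
    note rel = derivative_relation[OF I(1) P(1) this D y(1,2)]
    have "mp_eval (mp_pderiv i P) (\<lambda>i. grad y $ \<iota> i) = 0"
      by (rule derivatives_vanish[OF I P(2) _ _ rel]) (use y in \<open>auto simp: D_def\<close>)
    then show "mp_eval (mp_pderiv i P) z = 0" by (simp only: y(3))
  qed
qed

text \<open>The components \<open>a, b, c\<close> of the normal vector divided by the component
  \<open>k\<close> are rational functions on the dual variety. A relation between them, homogenized
  by a fourth variable standing for \<open>k\<close>, would relate four components of the
  gradient.\<close>

lemma dual_dim_ge:
  assumes J: "UNIV = {k, a, b, c, j :: 5}" "distinct [k, a, b, c, j]"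
    and x: "F x = 0" "grad x $ k \<noteq> 0" "x $ j \<noteq> 0" "det (hess x) \<noteq> 0"
  shows "enat 3 \<le> variety_dim pluecker_coords (dual_variety 3 X)"
proof -
  define g :: "(5 list, 'a) mpoly" where "g = mvar [a, b, c, j]"
  \<comment> \<open>The factors -1 cancel the signs in \<open>normal_minors\<close>.\<close>
  define f :: "nat \<Rightarrow> (5 list, 'a) mpoly" where "f i = (if i = 0 then mconst (-1) * mvar [k, b, c, j] else
    if i = 1 then mvar [k, a, c, j] else mconst (-1) * mvar [k, a, b, j])" for i
  define \<iota> where "\<iota> i = (if i = 0 then a else if i = 1 then b else if i = (2::nat) then c else k)" for i
  have normal: "\<exists>L z e. L \<in> dual_variety 3 X \<and> z \<in> pluecker_coords L \<and> e \<noteq> 0 \<and>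
      mp_eval g z = e * grad y $ k \<and> (\<forall>i<3. mp_eval (f i) z = e * grad y $ \<iota> i)"
    if y: "F y = 0" "grad y $ k \<noteq> 0" for y
  proof -
    have n0: "grad y \<noteq> 0" using y(2) by auto
    have y0: "y \<noteq> 0" using n0 by (auto simp: grad_0_iff T_simps)
    have L: "hyperplane (grad y) \<in> gauss_image 3 X" using y(1) n0 y0 unfolding gauss_image_eq by blast
    then have LG: "hyperplane (grad y) \<in> Gr 3" using gauss_image_subset_Gr by blast
    have L': "hyperplane (grad y) \<in> dual_variety 3 X"
      unfolding dual_variety_def using zariski_closure_subset[OF gauss_image_subset_Gr] L by blast
    obtain vs where vs: "vec.span (set vs) = hyperplane (grad y)" "length vs = 4" "minor vs [a, b, c, j] \<noteq> 0"
      using hyperplane_basis[OF J y(2)] by blast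
    obtain e where e: "normal_minors [k, a, b, c, j] vs (grad y) e"
      using normal_minors_exists[OF J n0 vs(1,2)] by blast
    have m: "minor vs [a, b, c, j] = e * grad y $ k" "minor vs [k, b, c, j] = - (e * grad y $ a)"
      "minor vs [k, a, c, j] = e * grad y $ b" "minor vs [k, a, b, j] = - (e * grad y $ c)"
      using e unfolding normal_minors_def by blast+
    have "minor vs \<in> pluecker_coords (hyperplane (grad y))"
      using LG vs unfolding pluecker_coords_def Gr_def by auto
    moreover have "mp_eval (f i) (minor vs) = e * grad y $ \<iota> i" if "i < 3" for i
    proof -
      have "i = 0 \<or> i = 1 \<or> i = 2" using that by auto
      then show ?thesis by (auto simp: f_def \<iota>_def m)
    qed
    moreover have "e \<noteq> 0" using m(1) vs(3) by auto
    moreover have "mp_eval g (minor vs) = e * grad y $ k" by (simp add: g_def m)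
    ultimately show ?thesis using L' by blast
  qed
  show ?thesis
  proof (rule variety_dim_ge)
    show "homogeneous 1 g" unfolding g_def by (rule homogeneous_mvar)
    show "homogeneous 1 (f i)" for i
      unfolding f_def by (auto simp del: One_nat_def intro: homogeneous_mvar homogeneous_mconst_mult)
    show "\<not> vanishes_on pluecker_coords g (dual_variety 3 X)"
      using normal[OF x(1,2)] x(2) unfolding vanishes_on_def by (metis mult_eq_0_iff)
    show "alg_indep_rational pluecker_coords (dual_variety 3 X) 3 f g"
      unfolding alg_indep_rational_def
    proof (intro allI impI)
      fix Q :: "(nat, 'a) mpoly"
      assume vars: "mp_vars Q \<subseteq> {..<3}" and
        Q: "\<forall>z\<in>dual_variety 3 X. \<forall>x\<in>pluecker_coords z. mp_eval g x \<noteq> 0 \<longrightarrow> mp_eval Q (\<lambda>i. mp_eval (f i) x / mp_eval g x) = 0"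
      have Q0: "mp_eval Q (\<lambda>i. grad y $ \<iota> i / grad y $ k) = 0" if y: "F y = 0" "grad y $ k \<noteq> 0" for y
      proof -
        obtain L z e where L: "L \<in> dual_variety 3 X" "z \<in> pluecker_coords L" "e \<noteq> 0"
          "mp_eval g z = e * grad y $ k" "\<forall>i<3. mp_eval (f i) z = e * grad y $ \<iota> i"
          using normal[OF y] by blast
        have "mp_eval g z \<noteq> 0" using L(3,4) y(2) by simp
        then have "mp_eval Q (\<lambda>i. mp_eval (f i) z / mp_eval g z) = 0"
          using Q L(1,2) by blast
        also have "mp_eval Q (\<lambda>i. mp_eval (f i) z / mp_eval g z) = mp_eval Q (\<lambda>i. grad y $ \<iota> i / grad y $ k)"
          by (rule mp_eval_cong) (use vars L(3-5) in auto)
        finally show ?thesis .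
      qed
      obtain P M where P: "mp_vars P \<subseteq> insert 3 (mp_vars Q)"
        "\<And>z. z 3 \<noteq> 0 \<Longrightarrow> mp_eval P z = z 3 ^ M * mp_eval Q (\<lambda>i. z i / z 3)"
        by (rule homogenize[where n = 3 and Q = Q]) (rule that)
      have \<iota>3: "\<iota> 3 = k" by (simp add: \<iota>_def)
      have "P = 0"
      proof (rule gradient_independent[where I = "{..<4}" and \<iota> = \<iota> and j = j, OF _ _ _ x])
        show "inj_on \<iota> {..<4}" using J(2) by (auto simp: inj_on_def \<iota>_def)
        show "j \<notin> \<iota> ` {..<4}" using J(2) by (auto simp: \<iota>_def)
        show "mp_vars P \<subseteq> {..<4}" using P(1) vars by fastforce
        show "mp_eval P (\<lambda>i. grad y $ \<iota> i) = 0" if "F y = 0" "grad y $ k \<noteq> 0" for y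
          using P(2)[of "\<lambda>i. grad y $ \<iota> i"] Q0[OF that] that(2) by (simp add: \<iota>3)
      qed simp
      show "Q = 0"
      proof (rule mp_eval_inject)
        fix z :: "nat \<Rightarrow> 'a"
        have "mp_eval Q z = mp_eval Q (\<lambda>i. (z(3 := 1)) i / (z(3 := 1)) 3)"
          by (rule mp_eval_cong) (use vars in auto)
        also have "\<dots> = mp_eval P (z(3 := 1))" using P(2)[of "z(3 := 1)"] by simp
        finally show "mp_eval Q z = 0" using \<open>P = 0\<close> by simp
      qed
    qed
  qed
qed

lemma hessian_vanishes:
  assumes dim: "variety_dim pluecker_coords (dual_variety 3 X) < enat 3" and x: "F x = 0"
  shows "det (hess x) = 0"
proof (rule ccontr)
  assume det: "det (hess x) \<noteq> 0"
  have "x \<noteq> 0"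
  proof
    assume "x = 0"
    then have "det (hess x) = 0"
      unfolding det_hess_0_iff by (intro exI[of _ "axis 1 1"]) (simp add: T_simps axis_eq_0_iff)
    with det show False ..
  qed
  then obtain j where j: "x $ j \<noteq> 0" by (metis vec_eq_iff zero_index)
  have "grad x \<noteq> 0"
    using det \<open>x \<noteq> 0\<close> unfolding det_hess_0_iff grad_0_iff by blast
  \<comment> \<open>By Euler's relation the gradient is orthogonal to \<open>x\<close> on the
    hypersurface, so it cannot be concentrated in a coordinate where \<open>x\<close> is
    nonzero.\<close>
  have "\<exists>k. k \<noteq> j \<and> grad x $ k \<noteq> 0"
  proof (rule ccontr)
    assume *: "\<not> ?thesis"
    have "0 = (\<Sum>i\<in>UNIV. grad x $ i * x $ i)" unfolding grad_pair x ..
    also have "\<dots> = (\<Sum>i\<in>UNIV. if i = j then grad x $ j * x $ j else 0)"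
      using * by (intro sum.cong refl) auto
    finally have "grad x $ j = 0" using j by simp
    then have "grad x = 0" using * unfolding vec_eq_iff by (metis zero_index)
    with \<open>grad x \<noteq> 0\<close> show False ..
  qed
  then obtain k where k: "k \<noteq> j" "grad x $ k \<noteq> 0" by blast
  obtain js where js: "set js = UNIV - {k, j}" "distinct js" using finite_distinct_list[of "UNIV - {k, j}"] by auto
  have "length js = 3" using distinct_card[OF js(2)] k(1) unfolding js(1) by (simp add: card_Diff_subset)
  then obtain a b c where js3: "js = [a, b, c]"
    by (auto simp: numeral_eq_Suc length_Suc_conv)
  have "UNIV = insert k (insert j (set js))" using js(1) by auto
  then have "UNIV = {k, a, b, c, j}" using js3 by auto
  moreover have "distinct [k, a, b, c, j]" using js js3 k(1) by auto
  ultimately have "enat 3 \<le> variety_dim pluecker_coords (dual_variety 3 X)"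
    by (rule dual_dim_ge[OF _ _ x k(2) j det])
  with dim show False by simp
qed

end

section \<open>Dual varieties of determinantal cubics\<close>

locale quadratic_parametrization =
  fixes \<alpha>1 \<alpha>2 \<alpha>3 \<alpha>4 \<alpha>5 \<alpha>6 :: "'i \<Rightarrow> 'a::field"
begin

text \<open>\<open>s\<close> absorbs the common factor of Pluecker coordinates;
  \<open>u, v, w\<close> are the components of the vector whose square is the adjugate
  matrix.\<close>

definition \<xi> :: "'a \<times> 'a \<times> 'a \<times> 'a \<Rightarrow> 'i \<Rightarrow> 'a" where
  "\<xi> = (\<lambda>(s, u, v, w) i. s * (\<alpha>1 i * u\<^sup>2 + \<alpha>2 i * v\<^sup>2 + \<alpha>3 i * w\<^sup>2 + \<alpha>4 i * (u * v) + \<alpha>5 i * (u * w) + \<alpha>6 i * (v * w)))"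

text \<open>Forms of degree \<open>m\<close> in the coordinates of \<open>\<xi>\<close> are
  \<open>s ^ m\<close> times forms of degree \<open>2 * m\<close> in three variables, which have
  only quadratically many monomials in \<open>m\<close>.\<close>

definition bmon :: "nat \<Rightarrow> nat \<times> nat \<Rightarrow> 'a \<times> 'a \<times> 'a \<times> 'a \<Rightarrow> 'a" where
  "bmon m = (\<lambda>(a, b) (s, u, v, w). s ^ m * (u ^ (2 * m - (a + b)) * v ^ a * w ^ b))"

definition Ix :: "nat \<Rightarrow> (nat \<times> nat) set" where
  "Ix m = {(a, b). a + b \<le> 2 * m}"

definition B :: "nat \<Rightarrow> ('a \<times> 'a \<times> 'a \<times> 'a \<Rightarrow> 'a) set" where
  "B m = bmon m ` Ix m"

lemma Ix_subset: "Ix m \<subseteq> {..2 * m} \<times> {..2 * m}"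
  by (auto simp: Ix_def)

lemma finite_B: "finite (B m)"
  unfolding B_def by (rule finite_imageI, rule finite_subset[OF Ix_subset]) auto

lemma card_B: "card (B m) \<le> (2 * m + 1)\<^sup>2"
proof -
  have "card (B m) \<le> card (Ix m)"
    unfolding B_def by (rule card_image_le, rule finite_subset[OF Ix_subset]) auto
  also have "\<dots> \<le> card ({..2 * m} \<times> {..2 * m})"
    by (rule card_mono[OF _ Ix_subset]) auto
  also have "\<dots> = (2 * m + 1)\<^sup>2" by (simp add: card_cartesian_product power2_eq_square)
  finally show ?thesis .
qed

lemma bmon_mult:
  assumes "t \<in> Ix m" "(a, b) \<in> Ix 1"
  shows "(\<lambda>y. bmon 1 (a, b) y * bmon m t y) \<in> spanfun (B (Suc m)) UNIV"
proof -
  obtain a' b' where t: "t = (a', b')" by (cases t)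
  have "(a + a', b + b') \<in> Ix (Suc m)" using assms t by (auto simp: Ix_def)
  then have mem: "bmon (Suc m) (a + a', b + b') \<in> spanfun (B (Suc m)) UNIV"
    by (intro spanfun_base[OF finite_B]) (simp add: B_def)
  have e: "2 * Suc m - (a + a' + (b + b')) = (2 * 1 - (a + b)) + (2 * m - (a' + b'))"
    using assms t by (auto simp: Ix_def)
  show ?thesis
    by (rule spanfun_cong[OF mem]) (simp only: t bmon_def split_beta fst_conv snd_conv e power_add power_Suc power_one_right,
      simp only: mult_ac)
qed

sublocale graded_functions B UNIV \<xi>
proof
  show "(\<lambda>_. 1) \<in> spanfun (B 0) UNIV"
  proof (rule spanfun_cong)
    show "bmon 0 (0, 0) \<in> spanfun (B 0) UNIV"
      by (rule spanfun_base[OF finite_B]) (auto simp: B_def Ix_def)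
  qed (simp add: bmon_def split_beta)
next
  fix g i m assume "g \<in> B m"
  then obtain t where t: "t \<in> Ix m" and g: "g = bmon m t" by (auto simp: B_def)
  have "(\<lambda>y. \<alpha>1 i * (bmon 1 (0, 0) y * g y) + (\<alpha>2 i * (bmon 1 (2, 0) y * g y) + (\<alpha>3 i * (bmon 1 (0, 2) y * g y)
      + (\<alpha>4 i * (bmon 1 (1, 0) y * g y) + (\<alpha>5 i * (bmon 1 (0, 1) y * g y) + \<alpha>6 i * (bmon 1 (1, 1) y * g y))))))
     \<in> spanfun (B (Suc m)) UNIV"
    unfolding g by (intro spanfun_add spanfun_scale bmon_mult[OF t]) (auto simp: Ix_def)
  then show "(\<lambda>y. \<xi> y i * g y) \<in> spanfun (B (Suc m)) UNIV"
    by (rule spanfun_cong) (auto simp: \<xi>_def bmon_def algebra_simps power2_eq_square)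
qed

text \<open>Quadratic growth is compared with the \<open>N ^ 3\<close> monomials in three functions.
  The relation \<open>R\<close> is a form, so its vanishing passes from \<open>Z\<close> to the
  closure.\<close>

lemma variety_dim_closure_le:
  assumes Z: "\<And>z x. z \<in> Z \<Longrightarrow> x \<in> co z \<Longrightarrow> x \<in> range \<xi>"
  shows "variety_dim co (zariski_closure co U Z) \<le> enat 2"
proof (rule variety_dim_le)
  fix d and f :: "nat \<Rightarrow> ('i, 'a) mpoly" and g :: "('i, 'a) mpoly"
  assume d: "homogeneous d g" "\<And>i. i \<le> 2 \<Longrightarrow> homogeneous d (f i)"
  define N where "N = (6 * d + 1)\<^sup>2 + 1"
  have N1: "N \<ge> 1" by (simp add: N_def)
  have "card (B (d * (3 * N))) \<le> (2 * (d * (3 * N)) + 1)\<^sup>2" by (rule card_B)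
  also have "\<dots> \<le> ((6 * d + 1) * N)\<^sup>2"
    using N1 by (intro power_mono) (auto simp: algebra_simps)
  also have "\<dots> = (6 * d + 1)\<^sup>2 * N\<^sup>2" by (simp only: power_mult_distrib)
  also have "\<dots> < N * N\<^sup>2" using N1 by (intro mult_strict_right_mono) (auto simp: N_def)
  also have "\<dots> = N ^ 3" by (simp add: power_numeral_reduce)
  finally have card: "card (B (d * (3 * N))) < N ^ 3" .
  have d': "homogeneous d (f i)" if "i < 3" for i using d(2) that by simp
  obtain Q R where Q: "Q \<noteq> 0" "mp_vars Q \<subseteq> {..<3}"
    and R: "homogeneous (d * (3 * N)) R" "\<And>y. y \<in> UNIV \<Longrightarrow> mp_eval R (\<xi> y) = 0"
    "\<And>x. mp_eval g x \<noteq> 0 \<Longrightarrow>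
       mp_eval R x = mp_eval g x ^ (3 * N) * mp_eval Q (\<lambda>i. mp_eval (f i) x / mp_eval g x)"
    by (rule dependence[OF d(1) d' finite_B card]) (assumption, rule that)
  have "vanishes_on co R Z" using Z R(2) unfolding vanishes_on_def by blast
  then have van: "vanishes_on co R (zariski_closure co U Z)" by (rule vanishes_on_closure[OF R(1)])
  have "mp_eval Q (\<lambda>i. mp_eval (f i) x / mp_eval g x) = 0"
    if "z \<in> zariski_closure co U Z" "x \<in> co z" "mp_eval g x \<noteq> 0" for z x
  proof -
    have "mp_eval R x = 0" using van that unfolding vanishes_on_def by blast
    then show ?thesis using R(3)[OF that(3)] that(3) by simp
  qed
  then show "\<not> alg_indep_rational co (zariski_closure co U Z) (Suc 2) f g"
    unfolding alg_indep_rational_def using Q by auto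
qed

end

text \<open>The 2 x 2 minors of the adjugate of a singular matrix vanish, as listed in
  \<open>r\<close>, and a symmetric matrix of rank at most one is \<open>w w\<^sup>T\<close> over an
  algebraically closed field. The cases follow its first nonzero diagonal entry.\<close>

lemma adjugate_rank_one:
  fixes a b c d e f :: "'a::alg_closed_field"
  assumes "det3 a b c d e f = 0"
  obtains u v w where "b * c - f\<^sup>2 = u\<^sup>2" "a * c - e\<^sup>2 = v\<^sup>2" "a * b - d\<^sup>2 = w\<^sup>2"
    "e * f - c * d = u * v" "d * f - b * e = u * w" "d * e - a * f = v * w"
proof -
  have z: "a * b * c + 2 * d * e * f - a * f\<^sup>2 - b * e\<^sup>2 - c * d\<^sup>2 = 0" using assms by (simp add: det3_def)
  define A where "A = b * c - f\<^sup>2"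
  define B where "B = a * c - e\<^sup>2"
  define C where "C = a * b - d\<^sup>2"
  define D where "D = e * f - c * d"
  define E where "E = d * f - b * e"
  define G where "G = d * e - a * f"
  note defs = A_def B_def C_def D_def E_def G_def
  have r: "A * B = D\<^sup>2" "A * C = E\<^sup>2" "B * C = G\<^sup>2" "A * G = D * E" "B * E = D * G" "C * D = E * G"
    unfolding defs using z by algebra+
  have "\<exists>u v w. A = u\<^sup>2 \<and> B = v\<^sup>2 \<and> C = w\<^sup>2 \<and> D = u * v \<and> E = u * w \<and> G = v * w"
  proof (cases "A = 0")
    case False
    obtain u where u: "u\<^sup>2 = A" using alg_closed_sqrt by blast
    then have "u \<noteq> 0" using False by auto
    have "B = (D / u)\<^sup>2" using r(1) u False by (simp add: power_divide nonzero_eq_divide_eq mult.commute)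
    moreover have "C = (E / u)\<^sup>2" using r(2) u False by (simp add: power_divide nonzero_eq_divide_eq mult.commute)
    moreover have "G = (D / u) * (E / u)" using r(4) u False \<open>u \<noteq> 0\<close>
      by (simp add: nonzero_eq_divide_eq mult.commute flip: power2_eq_square)
    ultimately show ?thesis using u \<open>u \<noteq> 0\<close> by (intro exI[of _ u] exI[of _ "D / u"] exI[of _ "E / u"]) simp
  next
    case A: True
    then have DE: "D = 0" "E = 0" using r(1,2) by auto
    show ?thesis
    proof (cases "B = 0")
      case False
      obtain v where v: "v\<^sup>2 = B" using alg_closed_sqrt by blast
      then have "v \<noteq> 0" using False by auto
      have "C = (G / v)\<^sup>2" using r(3) v False by (simp add: power_divide nonzero_eq_divide_eq mult.commute)
      then show ?thesis using A DE v \<open>v \<noteq> 0\<close> by (intro exI[of _ 0] exI[of _ v] exI[of _ "G / v"]) simp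
    next
      case True
      then have "G = 0" using r(3) by simp
      obtain w where "w\<^sup>2 = C" using alg_closed_sqrt by blast
      then show ?thesis using A DE True \<open>G = 0\<close> by (intro exI[of _ 0] exI[of _ 0] exI[of _ w]) simp
    qed
  qed
  then show ?thesis using that unfolding defs by blast
qed

lemma polyfun_det3 [pf_intros]:
  assumes "polyfun a" "polyfun b" "polyfun c" "polyfun d" "polyfun e" "polyfun f"
  shows "polyfun (\<lambda>x. det3 (a x) (b x) (c x) (d x) (e x) (f x))"
  unfolding det3_def by (intro pf_intros assms)

text \<open>The coefficient of \<open>t\<close> is the trace of the adjugate times the matrix of
  primed entries; it expresses the gradient of a determinantal cubic by the adjugate.\<close>

lemma det3_line:
  "det3 (a + t * a') (b + t * b') (c + t * c') (d + t * d') (e + t * e') (f + t * f') =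
    poly [:det3 a b c d e f, (b * c - f\<^sup>2) * a' + (a * c - e\<^sup>2) * b' + (a * b - d\<^sup>2) * c' +
      2 * ((e * f - c * d) * d' + (d * f - b * e) * e' + (d * e - a * f) * f'),
     (b' * c' - f'\<^sup>2) * a + (a' * c' - e'\<^sup>2) * b + (a' * b' - d'\<^sup>2) * c +
      2 * ((e' * f' - c' * d') * d + (d' * f' - b' * e') * e + (d' * e' - a' * f') * f),
     det3 a' b' c' d' e' f':] (t :: 'a::comm_ring_1)"
  by (simp add: det3_def algebra_simps power2_eq_square)

context cubic_hypersurface
begin

text \<open>In \<open>G = F * S\<close> both \<open>G\<close> and \<open>F\<close> are homogeneous
  of degree three, so \<open>S\<close> is constant along every ray where \<open>F\<close> is nonzero
  and has the value \<open>S 0\<close> there.\<close>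

lemma same_zero_set_multiple:
  assumes G: "polyfun G" "\<And>c x. G (c *s x) = c ^ 3 * G x" "\<And>x. x \<noteq> 0 \<Longrightarrow> F x = 0 \<longleftrightarrow> G x = 0"
  obtains \<kappa> where "\<And>x. F x = \<kappa> * G x"
proof -
  obtain S where S: "polyfun S" "\<And>x. G x = F x * S x"
    using vanishing_multiple[OF G(1)] G(3) by blast
  have S0: "S x = S 0" if x: "F x \<noteq> 0" for x
  proof -
    obtain q where q: "\<And>t. S (t *s x) = poly q t" using polyfun_line0[OF S(1)] by blast
    have "q - [:S x:] = 0"
    proof (rule poly_zero_off_0)
      fix t :: 'a assume t: "t \<noteq> 0"
      have "t ^ 3 * G x = t ^ 3 * F x * S (t *s x)" using S(2)[of "t *s x"] by (simp only: G(2) F_scale)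
      then have "S (t *s x) = S x" using t x S(2)[of x] by simp
      then show "poly (q - [:S x:]) t = 0" by (simp add: q)
    qed
    then have "q = [:S x:]" by simp
    then show ?thesis using q[of 0] by simp
  qed
  have GF: "G x = F x * S 0" for x using S(2)[of x] S0[of x] by (cases "F x = 0") auto
  obtain p where p: "F p = 1" by (rule F_one)
  then have "p \<noteq> 0" by (auto simp: T_simps)
  then have "S 0 \<noteq> 0" using G(3)[of p] GF[of p] p by auto
  then have "F x = inverse (S 0) * G x" for x by (simp add: GF)
  then show ?thesis by (rule that)
qed

lemma dual_dim_le_if_determinantal:
  assumes m: "lfun m1" "lfun m2" "lfun m3" "lfun m4" "lfun m5" "lfun m6"
    and F: "\<And>x. F x = \<kappa> * det3 (m1 x) (m2 x) (m3 x) (m4 x) (m5 x) (m6 x)"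
  shows "variety_dim pluecker_coords (dual_variety 3 X) \<le> enat 2"
proof -
  have J: "distinct [1, 2, 3, 4, 5 :: 5]" by simp
  obtain e :: "5 list \<Rightarrow> 5 \<Rightarrow> 'a" where "\<forall>vs n c. normal_minors [1, 2, 3, 4, 5] vs n c \<longrightarrow>
     (\<forall>I. minor vs I = c * (\<Sum>i\<in>UNIV. e I i * n $ i))"
    using pluecker_linear[OF UNIV_5 J] by blast
  then have e: "minor vs I = c * (\<Sum>i\<in>UNIV. e I i * n $ i)"
    if "normal_minors [1, 2, 3, 4, 5] vs n c" for vs n c I
    using that by blast
  \<comment> \<open>The division by 3 is there because the derivative of \<open>F\<close> at
    \<open>x\<close> is \<open>3 * T x x _\<close>; the factors 2 below belong to the off-diagonal
    entries.\<close>
  define \<alpha> where "\<alpha> m I = \<kappa> / 3 * (\<Sum>i\<in>UNIV. e I i * m (axis i 1))" for m :: "'a ^ 5 \<Rightarrow> 'a" and I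
  interpret quadratic_parametrization "\<alpha> m1" "\<alpha> m2" "\<alpha> m3" "\<lambda>I. 2 * \<alpha> m4 I" "\<lambda>I. 2 * \<alpha> m5 I" "\<lambda>I. 2 * \<alpha> m6 I" .
  have "z \<in> range \<xi>" if L: "L \<in> gauss_image 3 X" "z \<in> pluecker_coords L" for L z
  proof -
    obtain x where x: "L = hyperplane (grad x)" "x \<noteq> 0" "F x = 0" "grad x \<noteq> 0"
      using L(1) unfolding gauss_image_eq by blast
    have "\<kappa> \<noteq> 0" using F F_not_zero by auto
    then have "det3 (m1 x) (m2 x) (m3 x) (m4 x) (m5 x) (m6 x) = 0" using F[of x] x(3) by simp
    then obtain u v w where uvw: "m2 x * m3 x - (m6 x)\<^sup>2 = u\<^sup>2" "m1 x * m3 x - (m5 x)\<^sup>2 = v\<^sup>2"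
      "m1 x * m2 x - (m4 x)\<^sup>2 = w\<^sup>2" "m5 x * m6 x - m3 x * m4 x = u * v"
      "m4 x * m6 x - m2 x * m5 x = u * w" "m4 x * m5 x - m1 x * m6 x = v * w"
      by (rule adjugate_rank_one)
    have grad: "3 * T x x y = \<kappa> * (u\<^sup>2 * m1 y + v\<^sup>2 * m2 y + w\<^sup>2 * m3 y +
       2 * (u * v * m4 y + u * w * m5 y + v * w * m6 y))" for y
    proof -
      obtain r where r: "\<And>t. det3 (m1 (x + t *s y)) (m2 (x + t *s y)) (m3 (x + t *s y)) (m4 (x + t *s y))
         (m5 (x + t *s y)) (m6 (x + t *s y)) = poly r t" "coeff r 1 = u\<^sup>2 * m1 y + v\<^sup>2 * m2 y + w\<^sup>2 * m3 y +
          2 * (u * v * m4 y + u * w * m5 y + v * w * m6 y)"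
        by (simp only: lfun_simps[OF m(1)] lfun_simps[OF m(2)] lfun_simps[OF m(3)] lfun_simps[OF m(4)]
            lfun_simps[OF m(5)] lfun_simps[OF m(6)] det3_line uvw) (metis coeff_pCons_0 coeff_pCons_Suc One_nat_def)
      have "poly [:F x, 3 * T x x y, 3 * T x y y, F y:] t = poly (smult \<kappa> r) t" for t
        using F[of "x + t *s y"] unfolding F_line r(1)
        by (simp add: algebra_simps power2_eq_square power3_eq_cube)
      then have "[:F x, 3 * T x x y, 3 * T x y y, F y:] = smult \<kappa> r" using poly_eq_poly_eq_iff by blast
      then have "coeff [:F x, 3 * T x x y, 3 * T x y y, F y:] 1 = coeff (smult \<kappa> r) 1" by (rule arg_cong)
      then show ?thesis using r(2) by simp
    qed
    have dim: "vec.dim L = 4" using L(1) gauss_image_subset_Gr unfolding Gr_def by auto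
    obtain vs where vs: "z = minor vs" "vec.span (set vs) = L" "length vs = 4"
      using L(2) unfolding pluecker_coords_def dim by blast
    obtain c where c: "normal_minors [1, 2, 3, 4, 5] vs (grad x) c"
      using normal_minors_exists[OF UNIV_5 J x(4), of vs] vs x(1) by auto
    have "z I = \<xi> (c, u, v, w) I" for I
    proof -
      have g: "grad x $ i = \<kappa> / 3 * (u\<^sup>2 * m1 (axis i 1) + v\<^sup>2 * m2 (axis i 1) + w\<^sup>2 * m3 (axis i 1) +
       2 * (u * v * m4 (axis i 1) + u * w * m5 (axis i 1) + v * w * m6 (axis i 1)))" for i
        using grad[of "axis i 1"] by (simp add: grad_nth field_simps)
      have "z I = c * (\<Sum>i\<in>UNIV. e I i * grad x $ i)" using e[OF c] vs(1) by simp
      also have "(\<Sum>i\<in>UNIV. e I i * grad x $ i) = u\<^sup>2 * \<alpha> m1 I + v\<^sup>2 * \<alpha> m2 I + w\<^sup>2 * \<alpha> m3 I +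
         2 * (u * v * \<alpha> m4 I + u * w * \<alpha> m5 I + v * w * \<alpha> m6 I)"
        unfolding g \<alpha>_def sum_5 by algebra
      finally show ?thesis by (simp add: \<xi>_def algebra_simps)
    qed
    then have "z = \<xi> (c, u, v, w)" by (rule ext)
    then show ?thesis by blast
  qed
  then show ?thesis unfolding dual_variety_def by (rule variety_dim_closure_le)
qed

end

section \<open>The secant variety of the Veronese surface\<close>

lemma exhaust_6:
  fixes x :: 6
  shows "x = 1 \<or> x = 2 \<or> x = 3 \<or> x = 4 \<or> x = 5 \<or> x = 6"
proof (induct x)
  case (of_int z)
  then have "0 \<le> z" and "z < 6" by simp_all
  then have "z = 0 \<or> z = 1 \<or> z = 2 \<or> z = 3 \<or> z = 4 \<or> z = 5" by arith
  then show ?case by auto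
qed

lemma vector_6 [simp]:
  "(vector [a, b, c, d, e, f] :: 'a::zero ^ 6) $ 1 = a"
  "(vector [a, b, c, d, e, f] :: 'a ^ 6) $ 2 = b"
  "(vector [a, b, c, d, e, f] :: 'a ^ 6) $ 3 = c"
  "(vector [a, b, c, d, e, f] :: 'a ^ 6) $ 4 = d"
  "(vector [a, b, c, d, e, f] :: 'a ^ 6) $ 5 = e"
  "(vector [a, b, c, d, e, f] :: 'a ^ 6) $ 6 = f"
  unfolding vector_def by simp_all

lemma vec_eq_6:
  fixes x y :: "'a ^ 6"
  assumes "x $ 1 = y $ 1" "x $ 2 = y $ 2" "x $ 3 = y $ 3" "x $ 4 = y $ 4" "x $ 5 = y $ 5" "x $ 6 = y $ 6"
  shows "x = y"
proof -
  have "x $ i = y $ i" for i using exhaust_6[of i] assms by auto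
  then show ?thesis by (simp add: vec_eq_iff)
qed

definition det6 :: "'a::field ^ 6 \<Rightarrow> 'a" where
  "det6 y = det3 (y $ 1) (y $ 2) (y $ 3) (y $ 4) (y $ 5) (y $ 6)"

lemma det6_scale: "det6 (c *s y) = c ^ 3 * det6 y"
  by (simp add: det6_def det3_def algebra_simps power2_eq_square power3_eq_cube)

definition det6_form :: "(6, 'a::field) mpoly" where
  "det6_form = mvar 1 * mvar 2 * mvar 3 + mconst 2 * (mvar 4 * mvar 5 * mvar 6) +
     mconst (-1) * (mvar 1 * mvar 6 * mvar 6) + mconst (-1) * (mvar 2 * mvar 5 * mvar 5) +
     mconst (-1) * (mvar 3 * mvar 4 * mvar 4)"

lemma mp_eval_det6_form: "mp_eval det6_form (($) y) = det6 y"
  by (simp add: det6_form_def det6_def det3_def power2_eq_square)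

lemma homogeneous_det6_form: "homogeneous 3 det6_form"
proof -
  have "homogeneous 3 (mvar i * mvar j * mvar k)" for i j k :: 6
    using homogeneous_mult[OF homogeneous_mult[OF homogeneous_mvar homogeneous_mvar] homogeneous_mvar]
    by (simp add: numeral_3_eq_3)
  then show ?thesis unfolding det6_form_def by (intro homogeneous_add homogeneous_mconst_mult)
qed

definition ver :: "'a::field \<times> 'a \<times> 'a \<Rightarrow> 'a ^ 6" where
  "ver = (\<lambda>(a, b, c). vector [a\<^sup>2, b\<^sup>2, c\<^sup>2, a * b, a * c, b * c])"

lemma veronese_surface_eq: "veronese_surface = {vec.span {ver u} | u. u \<noteq> (0, 0, 0)}"
  by (auto simp: veronese_surface_def ver_def)

lemma ver_0 [simp]: "ver (0, 0, 0) = 0"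
  by (rule vec_eq_6) (simp_all add: ver_def)

lemma det6_secant: "det6 (s *s ver u + t *s ver v) = 0"
proof -
  obtain a b c where u: "u = (a, b, c)" by (cases u)
  obtain a' b' c' where v: "v = (a', b', c')" by (cases v)
  show ?thesis unfolding u v det6_def det3_def ver_def by simp algebra
qed

text \<open>Splitting off the rank one matrix of \<open>(u, v, w)\<close> clears the first row and
  column and leaves a singular symmetric 2 x 2 block with entries \<open>B, G, C\<close>, which has
  rank at most one.\<close>

lemma sum_of_two_rank_one_if_corner:
  fixes a b c d e f :: "'a::alg_closed_field"
  assumes "det3 a b c d e f = 0" "a \<noteq> 0"
  obtains u v w r s where "a = u\<^sup>2" "b = v\<^sup>2 + r\<^sup>2" "c = w\<^sup>2 + s\<^sup>2" "d = u * v" "e = u * w" "f = v * w + r * s"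
proof -
  obtain u where u: "u\<^sup>2 = a" using alg_closed_sqrt by blast
  then have u0: "u \<noteq> 0" using assms(2) by auto
  define v where "v = d / u"
  define w where "w = e / u"
  have d: "d = u * v" and e: "e = u * w" using u0 by (simp_all add: v_def w_def)
  define B where "B = b - v\<^sup>2"
  define C where "C = c - w\<^sup>2"
  define G where "G = f - v * w"
  have "u\<^sup>2 * (B * C - G\<^sup>2) = 0"
    using assms(1) unfolding det3_def d e u[symmetric] B_def C_def G_def by algebra
  then have BC: "B * C = G\<^sup>2" using u0 by simp
  have "\<exists>r s. B = r\<^sup>2 \<and> C = s\<^sup>2 \<and> G = r * s"
  proof (cases "B = 0")
    case True
    then have "G = 0" using BC by simp
    obtain s where "s\<^sup>2 = C" using alg_closed_sqrt by blast
    then show ?thesis using True \<open>G = 0\<close> by (intro exI[of _ 0] exI[of _ s]) simp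
  next
    case False
    obtain r where r: "r\<^sup>2 = B" using alg_closed_sqrt by blast
    then have "r \<noteq> 0" using False by auto
    have "C = (G / r)\<^sup>2" using BC r False by (simp add: power_divide nonzero_eq_divide_eq mult.commute)
    then show ?thesis using r \<open>r \<noteq> 0\<close> by (intro exI[of _ r] exI[of _ "G / r"]) simp
  qed
  then obtain r s where "B = r\<^sup>2" "C = s\<^sup>2" "G = r * s" by blast
  then have "b = v\<^sup>2 + r\<^sup>2" "c = w\<^sup>2 + s\<^sup>2" "f = v * w + r * s"
    unfolding B_def C_def G_def by (simp_all add: algebra_simps)
  with u d e that show ?thesis by blast
qed

text \<open>Completing the square needs a nonzero diagonal entry. Without one, the matrix is
  \<open>x y\<^sup>T + y x\<^sup>T\<close>, which is half the difference of \<open>(x + y) (x + y)\<^sup>T\<close> and \<open>(x - y) (x - y)\<^sup>T\<close>.\<close>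

lemma det6_0_imp_secant:
  fixes y :: "'a::{alg_closed_field, field_char_0} ^ 6"
  assumes "det6 y = 0"
  obtains u v where "y = ver u + ver v"
proof -
  have z: "det3 (y $ 1) (y $ 2) (y $ 3) (y $ 4) (y $ 5) (y $ 6) = 0" using assms by (simp add: det6_def)
  \<comment> \<open>With \<open>i\<close> and \<open>h\<close> the product \<open>2 * p * q\<close>
    is the sum of the squares of \<open>h * (p + q)\<close> and \<open>i * h * (p - q)\<close>, so
    the difference of two squares becomes a sum.\<close>
  obtain i :: 'a where i: "i\<^sup>2 = - 1" using alg_closed_sqrt by blast
  obtain h :: 'a where h: "h\<^sup>2 = 1 / 2" using alg_closed_sqrt by blast
  have h2: "2 * h\<^sup>2 = 1" unfolding h by simp
  consider "y $ 1 \<noteq> 0" | "y $ 2 \<noteq> 0" | "y $ 3 \<noteq> 0" | "y $ 1 = 0" "y $ 2 = 0" "y $ 3 = 0" by blast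
  then have "\<exists>u v. y = ver u + ver v"
  proof cases
    case 1
    obtain u v w r s where "y $ 1 = u\<^sup>2" "y $ 2 = v\<^sup>2 + r\<^sup>2" "y $ 3 = w\<^sup>2 + s\<^sup>2" "y $ 4 = u * v" "y $ 5 = u * w"
      "y $ 6 = v * w + r * s"
      by (rule sum_of_two_rank_one_if_corner[OF z 1])
    then have "y = ver (u, v, w) + ver (0, r, s)" by (intro vec_eq_6) (simp_all add: ver_def)
    then show ?thesis by blast
  next
    case 2
    have "det3 (y $ 2) (y $ 1) (y $ 3) (y $ 4) (y $ 6) (y $ 5) = 0" using z by (simp add: det3_def algebra_simps)
    then obtain u v w r s where "y $ 2 = u\<^sup>2" "y $ 1 = v\<^sup>2 + r\<^sup>2" "y $ 3 = w\<^sup>2 + s\<^sup>2" "y $ 4 = u * v" "y $ 6 = u * w"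
      "y $ 5 = v * w + r * s"
      by (rule sum_of_two_rank_one_if_corner[OF _ 2])
    then have "y = ver (v, u, w) + ver (r, 0, s)" by (intro vec_eq_6) (simp_all add: ver_def mult.commute)
    then show ?thesis by blast
  next
    case 3
    have "det3 (y $ 3) (y $ 2) (y $ 1) (y $ 6) (y $ 5) (y $ 4) = 0" using z by (simp add: det3_def algebra_simps)
    then obtain u v w r s where "y $ 3 = u\<^sup>2" "y $ 2 = v\<^sup>2 + r\<^sup>2" "y $ 1 = w\<^sup>2 + s\<^sup>2" "y $ 6 = u * v" "y $ 5 = u * w"
      "y $ 4 = v * w + r * s"
      by (rule sum_of_two_rank_one_if_corner[OF _ 3])
    then have "y = ver (w, v, u) + ver (s, r, 0)" by (intro vec_eq_6) (simp_all add: ver_def mult.commute)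
    then show ?thesis by blast
  next
    case 4
    have *: ?thesis
      if "y $ 1 = 2 * x1 * z1" "y $ 2 = 2 * x2 * z2" "y $ 3 = 2 * x3 * z3" "y $ 4 = x1 * z2 + x2 * z1"
        "y $ 5 = x1 * z3 + x3 * z1" "y $ 6 = x2 * z3 + x3 * z2" for x1 x2 x3 z1 z2 z3
    proof -
      have sq: "2 * p * q = (h * (p + q))\<^sup>2 + (i * h * (p - q))\<^sup>2" for p q
        using h2 i by algebra
      have pr: "p * q' + p' * q = h * (p + q) * (h * (p' + q')) + i * h * (p - q) * (i * h * (p' - q'))" for p q p' q'
        using h2 i by algebra
      have "y = ver (h * (x1 + z1), h * (x2 + z2), h * (x3 + z3)) +
          ver (i * h * (x1 - z1), i * h * (x2 - z2), i * h * (x3 - z3))"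
        by (rule vec_eq_6) (simp_all only: that sq[of x1 z1] sq[of x2 z2] sq[of x3 z3] pr[where p = x1 and q = z1 and p' = x2 and q' = z2]
            pr[where p = x1 and q = z1 and p' = x3 and q' = z3] pr[where p = x2 and q = z2 and p' = x3 and q' = z3] ver_def split_conv vector_6 vector_add_component)
      then show ?thesis by blast
    qed
    \<comment> \<open>With zero diagonal the determinant is twice the product of the other three
      entries.\<close>
    have "y $ 4 = 0 \<or> y $ 5 = 0 \<or> y $ 6 = 0" using z unfolding det3_def 4 by simp
    then show ?thesis
    proof (elim disjE)
      assume "y $ 4 = 0" then show ?thesis using 4 by (intro *[of "y $ 5" 0 "y $ 6" 0 0 1]) simp_all
    next
      assume "y $ 5 = 0" then show ?thesis using 4 by (intro *[of "y $ 4" 0 0 1 "y $ 6" 0]) simp_all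
    next
      assume "y $ 6 = 0" then show ?thesis using 4 by (intro *[of 0 1 "y $ 4" 0 "y $ 5" 0]) simp_all
    qed
  qed
  then show ?thesis using that by blast
qed

text \<open>The union of the secant lines is already closed: \<open>det6_form\<close> vanishes on
  it, and every zero of this form is a sum of two Veronese vectors.\<close>

lemma secant_variety_veronese_eq:
  "secant_variety veronese_surface =
     {vec.span {y} | y :: 'a::{alg_closed_field, field_char_0} ^ 6. y \<noteq> 0 \<and> det6 y = 0}"
proof -
  let ?Z = "{r \<in> proj_space. \<exists>p\<in>veronese_surface. \<exists>q\<in>veronese_surface. r \<subseteq> vec.span (p \<union> q)} :: ('a ^ 6) set set"
  have "vanishes_on point_coords det6_form ?Z"
    unfolding vanishes_on_def
  proof (intro ballI)
    fix r x assume r: "r \<in> ?Z" and x: "x \<in> point_coords r"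
    obtain y where y: "x = ($) y" "y \<in> r" using x by (auto simp: point_coords_def)
    obtain u v where "r \<subseteq> vec.span (vec.span {ver u} \<union> vec.span {ver v})"
      using r unfolding veronese_surface_eq by blast
    also have "\<dots> = vec.span ({ver u} \<union> {ver v})" by (simp only: vec.span_Un vec.span_span)
    finally have "y \<in> vec.span {ver u, ver v}" using y(2) by (auto simp: insert_commute)
    then obtain s t where "y = s *s ver u + t *s ver v"
      by (auto simp: vec.span_breakdown_eq vec.span_singleton algebra_simps)
    then show "mp_eval det6_form x = 0" unfolding y(1) mp_eval_det6_form by (simp only: det6_secant)
  qed
  then have form: "det6_form \<in> forms_vanishing_on point_coords ?Z"
    unfolding forms_vanishing_on_def using homogeneous_det6_form by blast
  show ?thesis
    unfolding secant_variety_def join_def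
  proof (intro subset_antisym subsetI)
    fix r assume r: "r \<in> zariski_closure point_coords proj_space ?Z"
    then obtain y where y: "y \<noteq> 0" "r = vec.span {y}" unfolding zariski_closure_def zero_locus_def Gr_0_iff by blast
    have "($) y \<in> point_coords r" using y by (auto simp: point_coords_def vec.span_base)
    then have "mp_eval det6_form (($) y) = 0"
      using r form unfolding zariski_closure_def zero_locus_def vanishes_on_def by blast
    with y show "r \<in> {vec.span {y} | y. y \<noteq> 0 \<and> det6 y = 0}" unfolding mp_eval_det6_form by blast
  next
    fix r :: "('a ^ 6) set" assume "r \<in> {vec.span {y} | y. y \<noteq> 0 \<and> det6 y = 0}"
    then obtain y where y: "y \<noteq> 0" "r = vec.span {y}" "det6 y = 0" by blast
    obtain u v where uv: "y = ver u + ver v" using det6_0_imp_secant[OF y(3)] .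
    \<comment> \<open>The zero triple gives no point of the surface, so it is replaced by the other
      triple.\<close>
    define u' where "u' = (if u = (0, 0, 0) then v else u)"
    define v' where "v' = (if v = (0, 0, 0) then u else v)"
    have ne: "u' \<noteq> (0, 0, 0)" "v' \<noteq> (0, 0, 0)" using y(1) unfolding uv u'_def v'_def by auto
    have "ver u \<in> vec.span (vec.span {ver u'} \<union> vec.span {ver v'})"
      by (cases "u = (0, 0, 0)") (auto simp: u'_def vec.span_zero intro!: vec.span_base)
    moreover have "ver v \<in> vec.span (vec.span {ver u'} \<union> vec.span {ver v'})"
      by (cases "v = (0, 0, 0)") (auto simp: v'_def vec.span_zero intro!: vec.span_base)
    ultimately have "y \<in> vec.span (vec.span {ver u'} \<union> vec.span {ver v'})"
      unfolding uv by (rule vec.span_add)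
    then have "r \<subseteq> vec.span (vec.span {ver u'} \<union> vec.span {ver v'})"
      unfolding y(2) by (intro vec.span_minimal) auto
    moreover have "vec.span {ver u'} \<in> veronese_surface" "vec.span {ver v'} \<in> veronese_surface"
      using ne unfolding veronese_surface_eq by blast+
    ultimately have "r \<in> ?Z" using y span_singleton_in_Gr_0 by blast
    then show "r \<in> zariski_closure point_coords proj_space ?Z"
      using zariski_closure_subset[of ?Z proj_space point_coords] by blast
  qed
qed

lemma span_in_secant_variety_iff:
  fixes y :: "'a::{alg_closed_field, field_char_0} ^ 6"
  assumes "y \<noteq> 0"
  shows "vec.span {y} \<in> secant_variety veronese_surface \<longleftrightarrow> det6 y = 0"
proof
  assume "vec.span {y} \<in> secant_variety veronese_surface"
  then obtain z where z: "vec.span {y} = vec.span {z}" "z \<noteq> 0" "det6 z = 0"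
    unfolding secant_variety_veronese_eq by blast
  then obtain c where "c \<noteq> 0" "z = c *s y" using span_singleton_eqD by metis
  then show "det6 y = 0" using z(3) by (simp add: det6_scale)
qed (use assms secant_variety_veronese_eq in blast)


section \<open>Developable cubics\<close>

lemma image_span_singleton:
  "Vector_Spaces.linear (*s) (*s) f \<Longrightarrow> f ` vec.span {x} = vec.span {f x}"
  by (simp add: vec.linear_span_image[symmetric])

context cubic_hypersurface
begin

text \<open>The six entries form a linear map \<open>f\<close> with \<open>det6 (f x) = F x\<close>.
  Translation by a kernel vector of \<open>f\<close> preserves \<open>F\<close>, so a nonzero one
  would be a vertex of \<open>X\<close>; hence \<open>f\<close> is injective and its image is the
  hyperplane.\<close>

lemma hyperplane_section_if_determinantal:
  assumes nc: "\<not> is_cone X" and determinantal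
  obtains H where "H \<in> Gr 4" "projectively_equivalent_in X H {L \<in> secant_variety veronese_surface. L \<subseteq> H}"
proof -
  obtain m1 m2 m3 m4 m5 m6 where m: "lfun m1" "lfun m2" "lfun m3" "lfun m4" "lfun m5" "lfun m6"
    and Fdet: "\<And>x. F x = det3 (m1 x) (m2 x) (m3 x) (m4 x) (m5 x) (m6 x)"
    using assms(2) unfolding determinantal_def by blast
  note ms = lfun_simps[OF m(1)] lfun_simps[OF m(2)] lfun_simps[OF m(3)] lfun_simps[OF m(4)]
    lfun_simps[OF m(5)] lfun_simps[OF m(6)]
  define f :: "'a ^ 5 \<Rightarrow> 'a ^ 6" where "f x = vector [m1 x, m2 x, m3 x, m4 x, m5 x, m6 x]" for x
  have det: "det6 (f x) = F x" for x by (simp add: f_def det6_def Fdet)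
  have lin: "Vector_Spaces.linear (*s) (*s) f"
    unfolding Vector_Spaces.linear_iff
    by (intro conjI vec.vector_space_axioms allI; rule vec_eq_6) (simp_all add: f_def ms)
  have ker: "v = 0" if v: "f v = 0" for v
  proof (rule ccontr)
    assume "v \<noteq> 0"
    have F_add: "F (y + t *s v) = F y" for y t
    proof -
      have "f (y + t *s v) = f y"
        using v by (simp add: vec.linear_add[OF lin] vec.linear_scale[OF lin])
      then show ?thesis by (simp only: det[symmetric])
    qed
    have Tv: "T y y v = 0" for y
    proof -
      have "poly [:0, 3 * T y y v, 3 * T y v v, F v:] t = poly 0 t" for t
        using F_add[of y t] unfolding F_line
        by (simp add: algebra_simps power2_eq_square power3_eq_cube)
      then have "[:0, 3 * T y y v, 3 * T y v v, F v:] = 0" using poly_eq_poly_eq_iff by blast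
      then show ?thesis by simp
    qed
    have "T v y z = 0" for y z
    proof -
      have "2 * T y z v = T (y + z) (y + z) v - T y y v - T z z v"
        using comm12[of z y v] by (simp add: T_simps)
      then have "T y z v = 0" by (simp add: Tv)
      then show ?thesis using T_perm by metis
    qed
    with \<open>v \<noteq> 0\<close> have "is_cone X" by (rule vertex_imp_cone)
    with nc show False ..
  qed
  then have inj: "inj f" unfolding vec.linear_inj_iff_eq_0[OF lin] by blast
  show ?thesis
  proof (rule that)
    have "vec.subspace (range f)" by (rule vec.linear_subspace_image[OF lin vec.subspace_UNIV])
    moreover have "vec.dim (range f) = 5"
      using vec.dim_image_eq[OF lin, of UNIV] inj by (simp add: vec_dim_card inj_on_subset del: vec.dim_UNIV)
    ultimately show "range f \<in> Gr 4" by (simp add: Gr_def)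
    have "(\<lambda>L. f ` L) ` X = {L \<in> secant_variety veronese_surface. L \<subseteq> range f}"
    proof (intro subset_antisym subsetI)
      fix L assume "L \<in> (\<lambda>L. f ` L) ` X"
      then obtain x where x: "x \<noteq> 0" "F x = 0" "L = f ` vec.span {x}" unfolding X_eq by blast
      have "f x \<noteq> 0" using ker x(1) by blast
      then have "L \<in> secant_variety veronese_surface"
        unfolding x(3) image_span_singleton[OF lin] by (simp add: span_in_secant_variety_iff det x(2))
      then show "L \<in> {L \<in> secant_variety veronese_surface. L \<subseteq> range f}" using x(3) by blast
    next
      fix L assume "L \<in> {L \<in> secant_variety veronese_surface. L \<subseteq> range f}"
      then obtain y where y: "y \<noteq> 0" "det6 y = 0" "L = vec.span {y}" "L \<subseteq> range f"
        unfolding secant_variety_veronese_eq by blast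
      then obtain x where x: "y = f x" using vec.span_base by blast
      have "x \<noteq> 0" using y(1) x vec.linear_0[OF lin] by blast
      then have "vec.span {x} \<in> X" using y(2) unfolding x det by (simp add: span_in_X_iff)
      then show "L \<in> (\<lambda>L. f ` L) ` X" unfolding y(3) x image_span_singleton[OF lin, symmetric] by blast
    qed
    then show "projectively_equivalent_in X (range f) {L \<in> secant_variety veronese_surface. L \<subseteq> range f}"
      unfolding projectively_equivalent_in_def
      using lin inj by (intro exI[of _ f]) (simp add: bij_betw_def)
  qed
qed

text \<open>\<open>F\<close> and the pull-back of \<open>det6\<close> under \<open>f\<close> are
  cubics with the same zeros, hence proportional, which makes \<open>F\<close> determinantal up to a
  constant.\<close>

lemma dual_dim_le_if_hyperplane_section:
  assumes "projectively_equivalent_in X H {L \<in> secant_variety veronese_surface. L \<subseteq> H}"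
  shows "variety_dim pluecker_coords (dual_variety 3 X) \<le> enat 2"
proof -
  obtain f where lin: "Vector_Spaces.linear (*s) (*s) f" and bij: "bij_betw f UNIV H"
    and im: "(\<lambda>L. f ` L) ` X = {L \<in> secant_variety veronese_surface. L \<subseteq> H}"
    using assms unfolding projectively_equivalent_in_def by blast
  have inj: "inj f" and H: "range f = H" using bij by (simp_all add: bij_betw_def)
  have m: "lfun (\<lambda>x. f x $ i)" for i
    by (rule lfunI) (simp_all add: vec.linear_add[OF lin] vec.linear_scale[OF lin])
  have iff: "F x = 0 \<longleftrightarrow> det6 (f x) = 0" if x: "x \<noteq> 0" for x
  proof -
    have fx: "f x \<noteq> 0" using x inj vec.linear_0[OF lin] by (metis injD)
    have "f ` vec.span {x} \<subseteq> H" using H by blast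
    have "F x = 0 \<longleftrightarrow> vec.span {x} \<in> X" using x by (simp add: span_in_X_iff)
    also have "\<dots> \<longleftrightarrow> f ` vec.span {x} \<in> (\<lambda>L. f ` L) ` X"
      by (metis (no_types, lifting) imageE image_eqI inj inj_image_eq_iff)
    also have "\<dots> \<longleftrightarrow> f ` vec.span {x} \<in> secant_variety veronese_surface"
      unfolding im using \<open>f ` vec.span {x} \<subseteq> H\<close> by blast
    also have "\<dots> \<longleftrightarrow> det6 (f x) = 0"
      unfolding image_span_singleton[OF lin] by (rule span_in_secant_variety_iff[OF fx])
    finally show ?thesis .
  qed
  have "polyfun (\<lambda>x. det6 (f x))" unfolding det6_def by (intro pf_intros polyfun_lfun m)
  moreover have "det6 (f (c *s x)) = c ^ 3 * det6 (f x)" for c x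
    by (simp only: vec.linear_scale[OF lin] det6_scale)
  ultimately obtain \<kappa> where "\<And>x. F x = \<kappa> * det6 (f x)"
    using iff by (rule same_zero_set_multiple) (assumption, rule that)
  then show ?thesis unfolding det6_def by (rule dual_dim_le_if_determinantal[OF m m m m m m])
qed

lemma developable_iff_hyperplane_section:
  assumes "\<not> is_cone X"
  shows "developable X \<longleftrightarrow>
    (\<exists>H :: ('a ^ 6) set. H \<in> Gr 4 \<and>
       projectively_equivalent_in X H {L \<in> secant_variety veronese_surface. L \<subseteq> H})"
proof
  assume "developable X"
  then have dim: "variety_dim pluecker_coords (dual_variety 3 X) < enat 3"
    unfolding developable_def variety_dim_X by auto
  have "determinantal"
  proof (rule determinantal_if_hessian_vanishes[OF sym_trilinear_axioms no_linear_factor])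
    show "\<exists>y z. T v y z \<noteq> 0" if "v \<noteq> 0" for v using vertex_imp_cone[OF that] assms by blast
  qed (rule hessian_vanishes[OF dim])
  from hyperplane_section_if_determinantal[OF assms this]
  obtain H :: "('a ^ 6) set" where "H \<in> Gr 4"
    "projectively_equivalent_in X H {L \<in> secant_variety veronese_surface. L \<subseteq> H}" by blast
  then show "\<exists>H :: ('a ^ 6) set. H \<in> Gr 4 \<and>
       projectively_equivalent_in X H {L \<in> secant_variety veronese_surface. L \<subseteq> H}" by blast
next
  assume "\<exists>H :: ('a ^ 6) set. H \<in> Gr 4 \<and>
       projectively_equivalent_in X H {L \<in> secant_variety veronese_surface. L \<subseteq> H}"
  then have "variety_dim pluecker_coords (dual_variety 3 X) \<le> enat 2"
    using dual_dim_le_if_hyperplane_section by blast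
  also have "\<dots> < enat 3" by simp
  finally show "developable X" unfolding developable_def variety_dim_X by blast
qed

end

theorem theorem1p1:
  fixes X :: "('a::{alg_closed_field, field_char_0} ^ 5) set set"
  assumes "irreducible_hypersurface 3 X"
    and "\<not> is_cone X"
  shows "developable X \<longleftrightarrow>
    (\<exists>H :: ('a ^ 6) set. H \<in> Gr 4 \<and>
       projectively_equivalent_in X H {L \<in> secant_variety veronese_surface. L \<subseteq> H})"
proof -
  obtain P :: "(5, 'a) mpoly" where P: "homogeneous 3 P" "irreducible P" "X = zero_locus point_coords proj_space {P}"
    using assms(1) unfolding irreducible_hypersurface_def by blast
  obtain T :: "'a ^ 5 \<Rightarrow> 'a ^ 5 \<Rightarrow> 'a ^ 5 \<Rightarrow> 'a" where T: "sym_trilinear T" "\<And>x. mp_eval P (($) x) = T x x x"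
    by (rule cubic_form_polarization[OF P(1)]) (rule that)
  interpret sym_trilinear T by (rule T(1))
  interpret cubic_hypersurface T P X
    by unfold_locales (fact T(2) P(1) P(3) irreducible_no_linear_factor[OF T P(2)])+
  show ?thesis by (rule developable_iff_hyperplane_section[OF assms(2)])
qed

end
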